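(* Let $0<p\le1$, let $W\in\mathcal{LP}$, and put $\widetilde W(z):=(1-|z|)^2W(z)$ for $z\in\mathbb D$. For every arc $I\subseteq\mathbb T$ define $$h_{\widetilde W}(I):=\frac{1}{|I|^{p+2}}\int_{Q_I^{\mathrm{up}}}\widetilde W(z)\,dA(z).$$ Then the following statements are equivalent. (i) The identity embedding $\mathrm{id}:\mathcal Q_p\to L^2(W\,dA)$ is bounded; that is, there exists a constant $C>0$ such that $$\int_{\mathbb D}|F(z)|^2W(z)\,dA(z)\le C\|F\|_{\mathcal Q_p}^2\qquad\text{for all }F\in\mathcal Q_p.$$ (ii) There exists a dyadic system $\mathcal D$ on $\mathbb T$ such that $\|h_{\widetilde W}\|_{\mathcal B_p(\mathcal D)}<\infty$, where for each fixed $\mathcal D$ the sequence is understood as $\{h_{\widetilde W}(I)\}_{I\in\mathcal D}$. Moreover, $$\|\mathrm{id}\|_{\mathcal Q_p\to L^2(W\,dA)}^2\simeq W(\mathbb D)+\inf_{\mathcal D}\|h_{\widetilde W}\|_{\mathcal B_p(\mathcal D)}\simeq W(\mathbb D)+\sup_{\mathcal D}\|h_{\widetilde W}\|_{\mathcal B_p(\mathcal D)},$$ where the infimum and supremum are taken over all dyadic systems $\mathcal D$ on $\mathbb T$.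
   Context: $\mathbb D$ is the open unit disc, $\mathbb T$ the unit circle, $dA$ is normalized area measure on $\mathbb D$, and $H(\mathbb D)$ is the space of holomorphic functions on $\mathbb D$. For $a\in\mathbb D$, $\sigma_a(z)=\frac{a-z}{1-\overline a z}$ and $g(z,a)=\log\frac{1}{|\sigma_a(z)|}$. $\mathcal Q_p$ is the space of $f\in H(\mathbb D)$ with $\|f\|_{\mathcal Q_p,*}^2:=\sup_{a\in\mathbb D}\int_{\mathbb D}|f'(z)|^2g(z,a)^p\,dA(z)<\infty$, normed by $\|f\|_{\mathcal Q_p}:=|f(0)|+\|f\|_{\mathcal Q_p,*}$. A weight $W\ge0$ on $\mathbb D$ (a nonnegative measurable function) belongs to the Littlewood–Paley class $\mathcal{LP}$ if for every $n\in\mathbb N$ ($n\geq 1$) and every $0<q<\infty$, $$\int_{\mathbb D}|f(z)|^qW(z)\,dA(z)\simeq\int_{\mathbb D}|f^{(n)}(z)|^q(1-|z|)^{nq}W(z)\,dA(z)+\sum_{j=0}^{n-1}|f^{(j)}(0)|^q$$ for all $f\in H(\mathbb D)$, where the implicit constants may depend on $W,n,q$ but not on $f$. $W(\mathbb D):=\int_{\mathbb D}W\,dA$. $|I|$ denotes arc length normalized so that $|\mathbb T|=1$; arcs include $\mathbb T$ itself. For an arc $I$, $Q_I^{\mathrm{up}}:=\{re^{it}: e^{it}\in I,\ 1-|I|\le r<1-\frac{|I|}{2}\}$. A dyadic system on $\mathbb T$ is a family $\mathcal D=\bigcup_{k\ge0}\mathcal D_k$ of half-open arcs where $\mathcal D_0=\{\mathbb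 T\}$, each $\mathcal D_k$ is a partition of $\mathbb T$ into $2^k$ arcs of length $2^{-k}$, and each arc of $\mathcal D_{k+1}$ is contained in an arc of $\mathcal D_k$. For a nonnegative sequence $h=\{h(I)\}_{I\in\mathcal D}$, the dyadic $p$-capacity gauge is $$\|h\|_{\mathcal B_p(\mathcal D)}:=\inf\Big\{\sum_{J\in\mathcal D}\lambda_J|J|^p:\ \lambda_J\ge0,\ \sum_{J\in\mathcal D,\,J\supseteq I}\lambda_J\ge h(I)\ \text{for all }I\in\mathcal D\Big\}\in[0,\infty],$$ with $\inf\emptyset=+\infty$. In the norm equivalences of the claim, $A\simeq B$ means $C^{-1}B\le A\le CB$ with a constant $C\ge1$ depending only on $p$ and on the implicit constants in the definition of $W\in\mathcal{LP}$; the operator norm is $+\infty$ if the embedding is not bounded. *)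

theory Defs
  imports "HOL-Analysis.Analysis"
begin

abbreviation unit_disc :: "complex set" where
  "unit_disc \<equiv> ball 0 1"

abbreviation unit_circle :: "complex set" where
  "unit_circle \<equiv> sphere 0 1"

definition disc_area :: "complex measure" where
  "disc_area = scale_measure (ennreal (1 / pi)) (lebesgue_on unit_disc)"


section \<open>The spaces \<open>Q\<^sub>p\<close>\<close>

definition disc_automorphism :: "complex \<Rightarrow> complex \<Rightarrow> complex" where
  "disc_automorphism a z = (a - z) / (1 - cnj a * z)"

text \<open>
  The Green function is infinite at \<open>z = a\<close>, where the real-valued term below evaluates to 0;
  a single point does not affect the area integrals.
\<close>

definition green :: "complex \<Rightarrow> complex \<Rightarrow> real" where
  "green z a = ln (1 / cmod (disc_automorphism a z))"

definition Qp_seminorm_sq :: "real \<Rightarrow> (complex \<Rightarrow> complex) \<Rightarrow> ennreal" where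
  "Qp_seminorm_sq p f =
     (SUP a\<in>unit_disc. \<integral>\<^sup>+z. ennreal ((cmod (deriv f z))\<^sup>2 * green z a powr p) \<partial>disc_area)"

definition Qp_space :: "real \<Rightarrow> (complex \<Rightarrow> complex) set" where
  "Qp_space p = {f. f holomorphic_on unit_disc \<and> Qp_seminorm_sq p f < \<infinity>}"

text \<open>Meaningful only for members of \<^const>\<open>Qp_space\<close>, because of the conversion to a real number.\<close>

definition Qp_norm :: "real \<Rightarrow> (complex \<Rightarrow> complex) \<Rightarrow> real" where
  "Qp_norm p f = cmod (f 0) + sqrt (enn2real (Qp_seminorm_sq p f))"


section \<open>Littlewood--Paley weights\<close>

definition comparable :: "real \<Rightarrow> ennreal \<Rightarrow> ennreal \<Rightarrow> bool" where
  "comparable C A B \<longleftrightarrow> ennreal (1 / C) * B \<le> A \<and> A \<le> ennreal C * B"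

definition weight :: "(complex \<Rightarrow> real) \<Rightarrow> bool" where
  "weight W \<longleftrightarrow> W \<in> borel_measurable disc_area \<and> (\<forall>z\<in>unit_disc. 0 \<le> W z)"

definition LP_estimate :: "(complex \<Rightarrow> real) \<Rightarrow> nat \<Rightarrow> real \<Rightarrow> real \<Rightarrow> bool" where
  "LP_estimate W n q C \<longleftrightarrow>
     (\<forall>f. f holomorphic_on unit_disc \<longrightarrow>
        comparable C
          (\<integral>\<^sup>+z. ennreal (cmod (f z) powr q * W z) \<partial>disc_area)
          ((\<integral>\<^sup>+z. ennreal (cmod ((deriv ^^ n) f z) powr q
                     * (1 - cmod z) powr (real n * q) * W z) \<partial>disc_area)
           + ennreal (\<Sum>j<n. cmod ((deriv ^^ j) f 0) powr q)))"

definition LP_class :: "(complex \<Rightarrow> real) set" where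
  "LP_class = {W. weight W \<and> (\<forall>n\<ge>1. \<forall>q>0. \<exists>C\<ge>1. LP_estimate W n q C)}"

text \<open>
  The members of the class for which \<open>K n q\<close> is an admissible implicit constant for every \<open>n\<close>
  and \<open>q\<close>. Uniformity over this set expresses that a constant depends on the weight only
  through its implicit Littlewood--Paley constants.
\<close>

definition LP_class_with :: "(nat \<Rightarrow> real \<Rightarrow> real) \<Rightarrow> (complex \<Rightarrow> real) set" where
  "LP_class_with K = {W. weight W \<and> (\<forall>n\<ge>1. \<forall>q>0. K n q \<ge> 1 \<and> LP_estimate W n q (K n q))}"

lemma LP_class_eq_Union: "LP_class = (\<Union>K. LP_class_with K)"
proof
  show "(\<Union>K. LP_class_with K) \<subseteq> LP_class"
    by (auto simp: LP_class_def LP_class_with_def)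
  show "LP_class \<subseteq> (\<Union>K. LP_class_with K)"
  proof
    fix W assume "W \<in> LP_class"
    then have W: "weight W"
      and ex: "\<forall>n q. \<exists>C. n \<ge> 1 \<longrightarrow> q > 0 \<longrightarrow> C \<ge> 1 \<and> LP_estimate W n q C"
      unfolding LP_class_def by blast+
    from ex obtain K where "\<forall>n q. n \<ge> 1 \<longrightarrow> q > 0 \<longrightarrow> K n q \<ge> 1 \<and> LP_estimate W n q (K n q)"
      by metis
    with W show "W \<in> (\<Union>K. LP_class_with K)"
      by (auto simp: LP_class_with_def)
  qed
qed

definition total_mass :: "(complex \<Rightarrow> real) \<Rightarrow> ennreal" where
  "total_mass W = (\<integral>\<^sup>+z. ennreal (W z) \<partial>disc_area)"


section \<open>The embedding into \<open>L\<^sup>2(W dA)\<close>\<close>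

definition L2_norm_sq :: "(complex \<Rightarrow> real) \<Rightarrow> (complex \<Rightarrow> complex) \<Rightarrow> ennreal" where
  "L2_norm_sq W F = (\<integral>\<^sup>+z. ennreal ((cmod (F z))\<^sup>2 * W z) \<partial>disc_area)"

definition Qp_embedding_bounded :: "real \<Rightarrow> (complex \<Rightarrow> real) \<Rightarrow> bool" where
  "Qp_embedding_bounded p W \<longleftrightarrow>
     (\<exists>C>0. \<forall>F\<in>Qp_space p. L2_norm_sq W F \<le> ennreal (C * (Qp_norm p F)\<^sup>2))"

text \<open>
  The least \<open>M\<close> with \<open>\<parallel>F\<parallel> \<le> M \<parallel>F\<parallel>\<close> (the norms of \<open>L\<^sup>2(W dA)\<close> and \<open>Q\<^sub>p\<close>) for all \<open>F\<close>,
  and \<open>\<infinity>\<close> if there is none.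
\<close>

definition Qp_embedding_norm :: "real \<Rightarrow> (complex \<Rightarrow> real) \<Rightarrow> ennreal" where
  "Qp_embedding_norm p W =
     Inf {ennreal M | M. 0 \<le> M \<and> (\<forall>F\<in>Qp_space p. L2_norm_sq W F \<le> ennreal ((M * Qp_norm p F)\<^sup>2))}"


section \<open>Arcs and dyadic systems\<close>

text \<open>Arcs open at either end point are admitted, and so is the whole circle.\<close>

definition half_open_arc :: "complex set \<Rightarrow> bool" where
  "half_open_arc I \<longleftrightarrow>
     (\<exists>\<theta> l. 0 < l \<and> l \<le> 2 * pi \<and> (I = cis ` {\<theta>..<\<theta> + l} \<or> I = cis ` {\<theta><..\<theta> + l}))"

definition arc_len :: "complex set \<Rightarrow> real" where
  "arc_len I = measure lebesgue {t \<in> {0..<1}. cis (2 * pi * t) \<in> I}"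

definition dyadic_system :: "complex set set \<Rightarrow> bool" where
  "dyadic_system D \<longleftrightarrow>
     (\<exists>L :: nat \<Rightarrow> complex set set.
        D = (\<Union>k. L k) \<and> L 0 = {unit_circle} \<and>
        (\<forall>k. partition_on unit_circle (L k) \<and> card (L k) = 2 ^ k \<and>
             (\<forall>I\<in>L k. half_open_arc I \<and> arc_len I = 1 / 2 ^ k) \<and>
             (\<forall>I\<in>L (Suc k). \<exists>J\<in>L k. I \<subseteq> J)))"

definition dyadic_gauge ::
    "real \<Rightarrow> complex set set \<Rightarrow> (complex set \<Rightarrow> ennreal) \<Rightarrow> ennreal" where
  "dyadic_gauge p D h =
     Inf {(\<Sum>\<^sub>\<infinity>J\<in>D. ennreal (lam J * arc_len J powr p)) | lam :: complex set \<Rightarrow> real.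
            (\<forall>J\<in>D. 0 \<le> lam J) \<and> (\<forall>I\<in>D. h I \<le> (\<Sum>\<^sub>\<infinity>J\<in>{J\<in>D. I \<subseteq> J}. ennreal (lam J)))}"

definition upper_box :: "complex set \<Rightarrow> complex set" where
  "upper_box I = {of_real r * w | r w. w \<in> I \<and> 1 - arc_len I \<le> r \<and> r < 1 - arc_len I / 2}"

definition box_density :: "real \<Rightarrow> (complex \<Rightarrow> real) \<Rightarrow> complex set \<Rightarrow> ennreal" where
  "box_density p V I =
     ennreal (1 / arc_len I powr (p + 2)) * (\<integral>\<^sup>+z\<in>upper_box I. ennreal (V z) \<partial>disc_area)"

definition tilde_weight :: "(complex \<Rightarrow> real) \<Rightarrow> complex \<Rightarrow> real" where
  "tilde_weight W z = (1 - cmod z)\<^sup>2 * W z"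

end

theory Submission
  imports Defs "HOL-Complex_Analysis.Complex_Analysis"
begin

text \<open>
  By the first-order Littlewood--Paley estimate with exponent two, the embedding is bounded exactly if the integral of
  \<open>|F'|\<^sup>2\<close> against \<open>(1 - |z|)\<^sup>2 W\<close> is controlled by the \<open>Q\<^sub>p\<close> norm of \<open>F\<close>. The constant function \<open>1\<close> shows moreover that
  \<open>W\<close> has total mass comparable to one. A function \<open>F\<close> lies in \<open>Q\<^sub>p\<close> if \<open>|F'|\<^sup>2 (1 - |z|)\<^sup>p dA\<close> puts mass at most
  a multiple of \<open>|J|\<^sup>p\<close> over every arc \<open>J\<close>, and this condition is dual to the gauge.

  \<^bold>\<open>Coverings bound the embedding.\<close> By a mean value inequality \<open>|F'|\<^sup>2\<close> on the upper box of \<open>I\<close> is at most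
  its average over a slightly larger box, so the weighted integral of \<open>|F'|\<^sup>2\<close> is at most the sum over \<open>I\<close> of the box
  density \<open>h I\<close> times the mass that \<open>|F'|\<^sup>2 (1 - |z|)\<^sup>p dA\<close> puts near that box. If weights \<open>lam J\<close> cover \<open>h\<close>, interchanging the two
  sums leaves \<open>lam J\<close> times the mass over \<open>J\<close>, hence at most \<open>lam J |J|\<^sup>p\<close> times the squared seminorm. This
  is \<open>covering_bounds_area_integral\<close>.

  \<^bold>\<open>The embedding bounds packings.\<close> A packing is a nonnegative \<open>\<mu>\<close> on finitely many arcs whose mass inside \<open>J\<close>
  is at most \<open>|J|\<^sup>p\<close>. The test functions have as derivative a sum of kernels \<open>k\<^sub>I\<close> concentrated near the boxes, with
  coefficients of modulus \<open>(\<mu> I / |I|\<^sup>p\<^sup>+\<^sup>2)\<^sup>1\<^sup>/\<^sup>2\<close> and arbitrary signs. Their seminorms are bounded uniformly in the signs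
  (\<open>signed_kernel_sum_seminorm_le\<close>): Cauchy--Schwarz removes the signs, each kernel is integrated against the Green function, and the
  packing condition sums the results. Averaging the embedding inequality over the signs (\<open>sign_average\<close>)
  bounds the pairing of \<open>h\<close> and \<open>\<mu>\<close>.

  \<^bold>\<open>Duality.\<close> Dyadic arcs form a laminar family, for which the cheapest covering and the best packing have the same
  value, by a greedy construction (\<open>laminar_covering_packing\<close>); a diagonal limit extends this to the infinite tree
  (\<open>dyadic_gauge_le\<close>).

  Since the first bound holds with the gauge of any dyadic system and the second one for every dyadic system, the gauges of all
  dyadic systems are comparable once the total mass is added, which gives both the infimum and the supremum.
\<close>

section \<open>Normalized area on the disc\<close>

lemma space_disc_area [simp]: "space disc_area = unit_disc"
  by (simp add: disc_area_def space_scale_measure)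

lemma sets_disc_area: "sets disc_area = sets (lebesgue_on unit_disc)"
  by (simp add: disc_area_def)

lemma measurable_disc_area:
  "f \<in> borel_measurable disc_area \<longleftrightarrow> f \<in> borel_measurable (lebesgue_on unit_disc)"
  using measurable_cong_sets[OF sets_disc_area refl] by blast

lemma borel_measurable_disc_area:
  assumes "f \<in> borel_measurable borel"
  shows "f \<in> borel_measurable disc_area"
  unfolding measurable_disc_area
  by (intro measurable_restrict_space1 measurable_completion) (use assms in simp)

lemma continuous_on_borel_measurable_disc_area:
  "continuous_on unit_disc f \<Longrightarrow> f \<in> borel_measurable disc_area"
  unfolding measurable_disc_area by (rule continuous_imp_measurable_on_sets_lebesgue) auto

lemma nn_integral_disc_area:
  assumes "f \<in> borel_measurable borel"
  shows "(\<integral>\<^sup>+z. f z \<partial>disc_area) = ennreal (1 / pi) * (\<integral>\<^sup>+z. f z * indicator unit_disc z \<partial>lborel)"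
proof -
  have "(\<integral>\<^sup>+z. f z \<partial>disc_area) = ennreal (1 / pi) * (\<integral>\<^sup>+z. f z \<partial>lebesgue_on unit_disc)"
    unfolding disc_area_def
    by (rule nn_integral_scale_measure)
       (rule borel_measurable_disc_area[OF assms, unfolded measurable_disc_area])
  also have "(\<integral>\<^sup>+z. f z \<partial>lebesgue_on unit_disc) = (\<integral>\<^sup>+z. f z * indicator unit_disc z \<partial>lebesgue)"
    by (rule nn_integral_restrict_space) auto
  finally show ?thesis
    by (simp add: nn_integral_completion)
qed

lemma emeasure_lborel_complex_ball:
  "0 \<le> r \<Longrightarrow> emeasure lborel (ball (c::complex) r) = ennreal (pi * r\<^sup>2)"
  using emeasure_ball[of r c] by (simp add: unit_ball_vol_2)

lemma indicator_ball_measurable: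
  "(indicator (ball (c::complex) r) :: complex \<Rightarrow> ennreal) \<in> borel_measurable borel"
  "(indicator (ball c r) :: complex \<Rightarrow> ennreal) \<in> borel_measurable disc_area"
proof -
  show *: "(indicator (ball c r) :: complex \<Rightarrow> ennreal) \<in> borel_measurable borel"
    by (rule borel_measurable_indicator) simp
  show "(indicator (ball c r) :: complex \<Rightarrow> ennreal) \<in> borel_measurable disc_area"
    by (rule borel_measurable_disc_area[OF *])
qed

lemma nn_integral_disc_area_ball:
  assumes "0 \<le> r" "ball c r \<subseteq> unit_disc"
  shows "(\<integral>\<^sup>+z. indicator (ball c r) z \<partial>disc_area) = ennreal (r\<^sup>2)"
proof -
  have "(\<integral>\<^sup>+z. indicator (ball c r) z \<partial>disc_area)
      = ennreal (1 / pi) * (\<integral>\<^sup>+z. indicator (ball c r) z * indicator unit_disc z \<partial>lborel)"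
    by (rule nn_integral_disc_area) (rule indicator_ball_measurable)
  also have "(\<lambda>z. indicator (ball c r) z * indicator unit_disc z) = (indicator (ball c r) :: complex \<Rightarrow> ennreal)"
    using assms(2) by (auto simp: indicator_def fun_eq_iff)
  finally show ?thesis
    using assms(1) by (simp add: emeasure_lborel_complex_ball flip: ennreal_mult'')
qed

lemma nn_integral_disc_area_ball_le:
  assumes "0 \<le> r"
  shows "(\<integral>\<^sup>+z. indicator (ball c r) z \<partial>disc_area) \<le> ennreal (r\<^sup>2)"
proof -
  have "(\<integral>\<^sup>+z. indicator (ball c r) z \<partial>disc_area)
      = ennreal (1 / pi) * (\<integral>\<^sup>+z. indicator (ball c r) z * indicator unit_disc z \<partial>lborel)"
    by (rule nn_integral_disc_area) (rule indicator_ball_measurable)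
  also have "\<dots> \<le> ennreal (1 / pi) * (\<integral>\<^sup>+z. indicator (ball c r) z \<partial>lborel)"
    by (intro mult_left_mono nn_integral_mono) (auto simp: indicator_def)
  also have "\<dots> = ennreal (r\<^sup>2)"
    using assms by (simp add: emeasure_lborel_complex_ball flip: ennreal_mult'')
  finally show ?thesis .
qed

lemma AE_disc_area_neq: "AE z in disc_area. z \<noteq> a"
proof -
  have "AE z in lebesgue_on unit_disc. z \<noteq> a"
    by (rule AE_restrict_space_iff[THEN iffD2])
       (use AE_completion[OF AE_lborel_singleton[of a]] in auto)
  then have "AE z in density (lebesgue_on unit_disc) (\<lambda>_. ennreal (1 / pi)). z \<noteq> a"
    by (subst AE_density) auto
  also have "density (lebesgue_on unit_disc) (\<lambda>_. ennreal (1 / pi)) = disc_area"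
    unfolding disc_area_def
    by (rule measure_eqI) (auto simp: emeasure_density nn_integral_cmult_indicator)
  finally show ?thesis .
qed

section \<open>Area integrals of powers\<close>

lemma geometric_suminf_ennreal:
  assumes "0 \<le> a" "a < (1::real)" "0 \<le> c"
  shows "(\<Sum>k. ennreal (c * a ^ k)) = ennreal (c / (1 - a))"
proof -
  have "(\<lambda>k. c * a ^ k) sums (c * (1 / (1 - a)))"
    by (intro sums_mult geometric_sums) (use assms in simp)
  then show ?thesis
    using assms by (intro suminf_ennreal_eq) auto
qed

text \<open>Domination by a series of weighted balls reduces an area integral to a geometric series of
  areas, in place of a computation in polar coordinates.\<close>

lemma nn_integral_suminf_balls_le:
  assumes "\<And>k. 0 \<le> c k" "\<And>k. 0 \<le> r k"
    and "\<And>z. z \<in> unit_disc \<Longrightarrow> f z \<le> (\<Sum>k. ennreal (c k) * indicator (ball w (r k)) z)"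
    and "\<And>k. c k * (r k)\<^sup>2 = b * a ^ k" "0 \<le> a" "a < 1" "0 \<le> b"
  shows "(\<integral>\<^sup>+z. f z \<partial>disc_area) \<le> ennreal (b / (1 - a))"
proof -
  have "(\<integral>\<^sup>+z. f z \<partial>disc_area) \<le> (\<integral>\<^sup>+z. (\<Sum>k. ennreal (c k) * indicator (ball w (r k)) z) \<partial>disc_area)"
    by (rule nn_integral_mono) (use assms(3) in auto)
  also have "\<dots> = (\<Sum>k. \<integral>\<^sup>+z. ennreal (c k) * indicator (ball w (r k)) z \<partial>disc_area)"
    by (rule nn_integral_suminf) (intro borel_measurable_times_ennreal indicator_ball_measurable borel_measurable_const)
  also have "\<dots> = (\<Sum>k. ennreal (c k) * (\<integral>\<^sup>+z. indicator (ball w (r k)) z \<partial>disc_area))"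
    by (subst nn_integral_cmult) (auto intro: indicator_ball_measurable)
  also have "\<dots> \<le> (\<Sum>k. ennreal (c k) * ennreal ((r k)\<^sup>2))"
    by (intro suminf_le mult_left_mono nn_integral_disc_area_ball_le assms) auto
  also have "\<dots> = (\<Sum>k. ennreal (b * a ^ k))"
    using assms(4) by (simp add: assms(1) flip: ennreal_mult)
  also have "\<dots> = ennreal (b / (1 - a))"
    by (rule geometric_suminf_ennreal) (use assms in auto)
  finally show ?thesis .
qed

lemma term_le_suminf_ennreal: "f k \<le> (\<Sum>k. f k :: ennreal)"
  using sum_le_suminf[of f "{k}"] by (auto intro: summableI)

text \<open>Sum over the dyadic balls of radii \<open>2\<^sup>k\<^sup>+\<^sup>1 \<eta>\<close>; the exponent beyond the dimension makes the
  series geometric.\<close>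

lemma nn_integral_max_powr_le:
  assumes r: "2 < r" and \<eta>: "0 < \<eta>"
  shows "(\<integral>\<^sup>+z. ennreal (max \<eta> (cmod (z - w)) powr (- r)) \<partial>disc_area)
           \<le> ennreal (4 / (1 - 2 powr (2 - r)) * \<eta> powr (2 - r))"
proof -
  have "(\<integral>\<^sup>+z. ennreal (max \<eta> (cmod (z - w)) powr (- r)) \<partial>disc_area)
          \<le> ennreal ((4 * \<eta> powr (2 - r)) / (1 - 2 powr (2 - r)))"
  proof (rule nn_integral_suminf_balls_le[where c = "\<lambda>k. (2 ^ k * \<eta>) powr (- r)" and r = "\<lambda>k. 2 ^ (k + 1) * \<eta>" and w = w])
    fix k :: nat
    have "(2 ^ k * \<eta>) powr (- r) * (2 ^ (k + 1) * \<eta>)\<^sup>2 = 4 * ((2 ^ k * \<eta>) powr (- r) * (2 ^ k * \<eta>) powr 2)"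
      using \<eta> by (simp add: power_mult_distrib)
    also have "\<dots> = 4 * (2 ^ k * \<eta>) powr (2 - r)"
      by (simp flip: powr_add)
    also have "\<dots> = 4 * \<eta> powr (2 - r) * (2 powr (2 - r)) ^ k"
      using \<eta> by (simp add: powr_mult powr_powr mult.commute flip: powr_realpow)
    finally show "(2 ^ k * \<eta>) powr (- r) * (2 ^ (k + 1) * \<eta>)\<^sup>2 = 4 * \<eta> powr (2 - r) * (2 powr (2 - r)) ^ k" .
  next
    fix z :: complex
    have "\<exists>k. max \<eta> (cmod (z - w)) powr (- r) \<le> (2 ^ k * \<eta>) powr (- r) \<and> z \<in> ball w (2 ^ (k + 1) * \<eta>)"
    proof (cases "cmod (z - w) < 2 * \<eta>")
      case True
      then show ?thesis
        using \<eta> r by (intro exI[of _ 0]) (auto simp: dist_norm norm_minus_commute intro!: powr_mono2')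
    next
      case False
      define u where "u = cmod (z - w) / \<eta>"
      have u: "u \<ge> 2" using False \<eta> by (simp add: u_def field_simps)
      define k where "k = nat \<lfloor>log 2 u\<rfloor>"
      have "log 2 u \<ge> 0" using u by simp
      then have k: "real k \<le> log 2 u" "log 2 u < real k + 1" by (auto simp: k_def)
      have "2 ^ k \<le> u" "u < 2 ^ (k + 1)"
        using k u by (auto simp: le_log_iff log_less_iff powr_add powr_realpow)
      then have "2 ^ k * \<eta> \<le> cmod (z - w)" "cmod (z - w) < 2 ^ (k + 1) * \<eta>"
        using \<eta> by (auto simp: u_def field_simps)
      then show ?thesis
        using \<eta> r by (intro exI[of _ k]) (auto simp: dist_norm norm_minus_commute intro!: powr_mono2')
    qed
    then obtain k where k: "max \<eta> (cmod (z - w)) powr (- r) \<le> (2 ^ k * \<eta>) powr (- r)"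
      "z \<in> ball w (2 ^ (k + 1) * \<eta>)" by blast
    have "ennreal (max \<eta> (cmod (z - w)) powr (- r))
        \<le> ennreal ((2 ^ k * \<eta>) powr (- r)) * indicator (ball w (2 ^ (k + 1) * \<eta>)) z"
      using k by (simp add: ennreal_leI)
    also have "\<dots> \<le> (\<Sum>k. ennreal ((2 ^ k * \<eta>) powr (- r)) * indicator (ball w (2 ^ (k + 1) * \<eta>)) z)"
      by (rule term_le_suminf_ennreal)
    finally show "ennreal (max \<eta> (cmod (z - w)) powr (- r))
      \<le> (\<Sum>k. ennreal ((2 ^ k * \<eta>) powr (- r)) * indicator (ball w (2 ^ (k + 1) * \<eta>)) z)" .
  next
    show "2 powr (2 - r) < 1" using r powr_less_mono[of "2 - r" 0 2] by simp
  qed (use \<eta> r in auto)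
  then show ?thesis by (simp add: field_simps)
qed

text \<open>The same summation over shrinking balls: the singularity is integrable because the exponent
  stays below the dimension.\<close>

lemma nn_integral_powr_ball_le:
  assumes t: "0 \<le> t" "t < 2" and d: "0 < d"
  shows "(\<integral>\<^sup>+z. ennreal (cmod (z - a) powr (- t)) * indicator (ball a d) z \<partial>disc_area)
           \<le> ennreal (4 / (1 - 2 powr (t - 2)) * d powr (2 - t))"
proof -
  have "(\<integral>\<^sup>+z. ennreal (cmod (z - a) powr (- t)) * indicator (ball a d) z \<partial>disc_area)
          \<le> ennreal ((2 powr t * d powr (2 - t)) / (1 - 2 powr (t - 2)))"
  proof (rule nn_integral_suminf_balls_le[where c = "\<lambda>k. (d / 2 ^ (k + 1)) powr (- t)" and r = "\<lambda>k. d / 2 ^ k" and w = a])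
    fix k :: nat
    have "(d / 2 ^ (k + 1)) powr (- t) = 2 powr t * (d / 2 ^ k) powr (- t)"
    proof -
      have "(d / 2 ^ (k + 1)) powr (- t) = ((1 / 2) * (d / 2 ^ k)) powr (- t)" by simp
      also have "\<dots> = (1 / 2) powr (- t) * (d / 2 ^ k) powr (- t)" by (rule powr_mult)
      also have "(1 / 2 :: real) powr (- t) = 2 powr t" by (simp add: powr_divide powr_minus_divide)
      finally show ?thesis .
    qed
    then have "(d / 2 ^ (k + 1)) powr (- t) * (d / 2 ^ k)\<^sup>2 = 2 powr t * ((d / 2 ^ k) powr (- t) * (d / 2 ^ k) powr 2)"
      using d by simp
    also have "\<dots> = 2 powr t * (d / 2 ^ k) powr (2 - t)"
      by (simp flip: powr_add)
    also have "(d / 2 ^ k) powr (2 - t) = d powr (2 - t) * (2 powr (t - 2)) ^ k"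
    proof -
      have "(d / 2 ^ k) powr (2 - t) = d powr (2 - t) / (2 ^ k) powr (2 - t)"
        using d by (simp add: powr_divide)
      also have "(2 ^ k) powr (2 - t) = (2::real) powr (real k * (2 - t))"
        by (simp add: powr_powr flip: powr_realpow)
      also have "d powr (2 - t) / 2 powr (real k * (2 - t)) = d powr (2 - t) * 2 powr (- (real k * (2 - t)))"
        by (simp only: powr_minus_divide) simp
      also have "2 powr (- (real k * (2 - t))) = (2 powr (t - 2)) ^ k"
        by (simp add: powr_powr mult.commute right_diff_distrib flip: powr_realpow)
      finally show ?thesis .
    qed
    finally show "(d / 2 ^ (k + 1)) powr (- t) * (d / 2 ^ k)\<^sup>2 = 2 powr t * d powr (2 - t) * (2 powr (t - 2)) ^ k"
      by simp
  next
    fix z :: complex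
    show "ennreal (cmod (z - a) powr (- t)) * indicator (ball a d) z
      \<le> (\<Sum>k. ennreal ((d / 2 ^ (k + 1)) powr (- t)) * indicator (ball a (d / 2 ^ k)) z)"
    proof (cases "z \<in> ball a d \<and> z \<noteq> a")
      case True
      define u where "u = d / cmod (z - a)"
      have "0 < cmod (z - a)" "cmod (z - a) < d" using True by (auto simp: dist_norm norm_minus_commute)
      then have u: "u > 1" unfolding u_def by simp
      define k where "k = nat (\<lceil>log 2 u\<rceil> - 1)"
      have "log 2 u > 0" using u by simp
      then have k: "real k < log 2 u" "log 2 u \<le> real k + 1" unfolding k_def by linarith+
      have "2 ^ k < u" "u \<le> 2 ^ (k + 1)"
        using k u by (auto simp: less_log_iff log_le_iff powr_add powr_realpow)
      then have k2: "cmod (z - a) < d / 2 ^ k" "d / 2 ^ (k + 1) \<le> cmod (z - a)"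
        using True by (auto simp: u_def field_simps)
      have "cmod (z - a) powr (- t) \<le> (d / 2 ^ (k + 1)) powr (- t)"
        using k2 d t by (intro powr_mono2') auto
      then have "ennreal (cmod (z - a) powr (- t)) * indicator (ball a d) z
        \<le> ennreal ((d / 2 ^ (k + 1)) powr (- t)) * indicator (ball a (d / 2 ^ k)) z"
        using True k2 by (simp add: ennreal_leI dist_norm norm_minus_commute)
      also have "\<dots> \<le> (\<Sum>k. ennreal ((d / 2 ^ (k + 1)) powr (- t)) * indicator (ball a (d / 2 ^ k)) z)"
        by (rule term_le_suminf_ennreal)
      finally show ?thesis .
    qed auto
  next
    show "2 powr (t - 2) < 1" using t powr_less_mono[of "t - 2" 0 2] by simp
  qed (use d t in auto)
  also have "\<dots> \<le> ennreal (4 / (1 - 2 powr (t - 2)) * d powr (2 - t))"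
  proof (rule ennreal_leI)
    have "2 powr t \<le> (2::real) powr 2" using t by (intro powr_mono) auto
    moreover have "2 powr (t - 2) < (1::real)" using t powr_less_mono[of "t - 2" 0 2] by simp
    ultimately show "2 powr t * d powr (2 - t) / (1 - 2 powr (t - 2)) \<le> 4 / (1 - 2 powr (t - 2)) * d powr (2 - t)"
      by (auto intro!: divide_right_mono mult_right_mono simp: )
  qed
  finally show ?thesis .
qed

section \<open>A mean value inequality over area\<close>

text \<open>Cauchy's formula for \<open>g\<^sup>2\<close> on a circle whose centre \<open>v\<close> need not be the point \<open>w\<close>. The distance of \<open>w\<close> to the
  circle is at least half its radius, which costs the factor two.\<close>

lemma circle_mean_le:
  assumes g: "g holomorphic_on ball w r" and r: "0 < r" and v: "v \<in> ball w (r / 4)"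
  shows "ennreal ((cmod (g w))\<^sup>2)
    \<le> 2 * (\<integral>\<^sup>+t. ennreal ((cmod (g (v + circlepath 0 (r / 2) t)))\<^sup>2) * indicator {0..1} t \<partial>lborel)"
proof -
  have v': "cmod (w - v) < r / 4" using v by (simp add: dist_norm)
  have sub: "cball v (r / 2) \<subseteq> ball w r"
  proof
    fix u assume "u \<in> cball v (r / 2)"
    then have "cmod (u - v) \<le> r / 2" by (simp add: dist_norm norm_minus_commute)
    moreover have "cmod (w - u) \<le> cmod (w - v) + cmod (u - v)"
      using norm_triangle_ineq4[of "w - v" "u - v"] by simp
    ultimately show "u \<in> ball w r" using v' r by (simp add: dist_norm)
  qed
  let ?\<gamma> = "circlepath v (r / 2)"
  have \<gamma>: "?\<gamma> t = v + circlepath 0 (r / 2) t" for t by (simp add: circlepath)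
  have in_cball: "?\<gamma> t \<in> cball v (r / 2)" if "t \<in> {0..1}" for t
    using r by (simp add: circlepath dist_norm norm_mult)
  have hol: "(\<lambda>u. (g u)\<^sup>2) holomorphic_on cball v (r / 2)"
    by (intro holomorphic_intros holomorphic_on_subset[OF g] sub)
  have "((\<lambda>u. (g u)\<^sup>2 / (u - w)) has_contour_integral (2 * of_real pi * \<i> * (g w)\<^sup>2)) ?\<gamma>"
    by (rule Cauchy_integral_circlepath_simple[OF hol]) (use v' r in simp)
  then have int: "((\<lambda>t. (g (?\<gamma> t))\<^sup>2 / (?\<gamma> t - w) * vector_derivative ?\<gamma> (at t within {0..1}))
      has_integral (2 * of_real pi * \<i> * (g w)\<^sup>2)) {0..1}" (is "(?f has_integral _) _")
    by (simp add: has_contour_integral_def)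
  have cont: "continuous_on {0..1} (\<lambda>t. 4 * pi * (cmod (g (?\<gamma> t)))\<^sup>2)"
  proof (intro continuous_intros)
    show "continuous_on {0..1} (\<lambda>t. g (?\<gamma> t))"
    proof (rule continuous_on_compose2[of "cball v (r / 2)" g])
      show "continuous_on (cball v (r / 2)) g"
        using holomorphic_on_imp_continuous_on[OF g] sub continuous_on_subset by blast
      show "continuous_on {0..1} ?\<gamma>"
        unfolding circlepath by (intro continuous_intros)
    qed (use in_cball in auto)
  qed
  have bound: "cmod (?f t) \<le> 4 * pi * (cmod (g (?\<gamma> t)))\<^sup>2" if t: "t \<in> {0..1}" for t
  proof -
    have "cmod (?\<gamma> t - v) = r / 2" using r by (simp add: circlepath norm_mult)
    moreover have "cmod (?\<gamma> t - v) \<le> cmod (?\<gamma> t - w) + cmod (w - v)"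
      using norm_triangle_ineq[of "?\<gamma> t - w" "w - v"] by simp
    ultimately have ge: "r / 4 \<le> cmod (?\<gamma> t - w)" using v' by simp
    have vd: "cmod (vector_derivative ?\<gamma> (at t within {0..1})) = pi * r"
      using t r by (subst vector_derivative_circlepath01) (auto simp: norm_mult)
    have "cmod (?f t) = (cmod (g (?\<gamma> t)))\<^sup>2 / cmod (?\<gamma> t - w) * (pi * r)"
      by (simp add: norm_mult norm_divide norm_power vd)
    also have "\<dots> \<le> (cmod (g (?\<gamma> t)))\<^sup>2 / (r / 4) * (pi * r)"
      using ge r less_le_trans[of 0 "r / 4", OF _ ge]
      by (intro mult_right_mono divide_left_mono mult_pos_pos) auto
    also have "\<dots> = 4 * pi * (cmod (g (?\<gamma> t)))\<^sup>2" using r by simp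
    finally show ?thesis .
  qed
  have "cmod (integral {0..1} ?f) \<le> integral {0..1} (\<lambda>t. 4 * pi * (cmod (g (?\<gamma> t)))\<^sup>2)"
    by (rule integral_norm_bound_integral[OF has_integral_integrable[OF int] integrable_continuous_real[OF cont] bound])
  then have "2 * pi * (cmod (g w))\<^sup>2 \<le> integral {0..1} (\<lambda>t. 4 * pi * (cmod (g (?\<gamma> t)))\<^sup>2)"
    using int by (simp add: integral_unique norm_mult norm_power)
  also have "\<dots> = 4 * pi * integral {0..1} (\<lambda>t. (cmod (g (?\<gamma> t)))\<^sup>2)"
    by simp
  finally have le: "(cmod (g w))\<^sup>2 \<le> 2 * integral {0..1} (\<lambda>t. (cmod (g (?\<gamma> t)))\<^sup>2)"
    by simp
  have "(\<lambda>t. 1 / (4 * pi) * (4 * pi * (cmod (g (?\<gamma> t)))\<^sup>2)) integrable_on {0..1}"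
    by (intro integrable_continuous_real continuous_intros cont)
  then have "((\<lambda>t. (cmod (g (?\<gamma> t)))\<^sup>2) has_integral integral {0..1} (\<lambda>t. (cmod (g (?\<gamma> t)))\<^sup>2)) {0..1}"
    by (simp add: has_integral_integral)
  then have "(\<integral>\<^sup>+t. ennreal ((cmod (g (?\<gamma> t)))\<^sup>2) * indicator {0..1} t \<partial>lborel)
     = ennreal (integral {0..1} (\<lambda>t. (cmod (g (?\<gamma> t)))\<^sup>2))"
    by (intro nn_integral_has_integral_lebesgue') auto
  then show ?thesis
    using ennreal_leI[OF le] unfolding \<gamma> by (simp add: ennreal_mult')
qed

text \<open>Averaging the circle inequality over the centre \<open>v\<close> of the circle turns it into an area inequality
  that uses only the translation invariance of Lebesgue measure.\<close>

lemma area_mean_le: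
  assumes g: "g holomorphic_on unit_disc" and r: "0 < r" and sub: "ball w r \<subseteq> unit_disc"
  shows "ennreal ((cmod (g w))\<^sup>2)
    \<le> ennreal (32 / r\<^sup>2) * (\<integral>\<^sup>+u. ennreal ((cmod (g u))\<^sup>2) * indicator (ball w r) u \<partial>disc_area)"
proof -
  define H where "H = (\<lambda>u. ennreal (indicator (ball w r) u *\<^sub>R (cmod (g u))\<^sup>2))"
  have H_eq: "H u = ennreal ((cmod (g u))\<^sup>2) * indicator (ball w r) u" for u
    by (simp add: H_def indicator_def)
  have g': "g holomorphic_on ball w r" using g sub holomorphic_on_subset by blast
  have [measurable]: "H \<in> borel_measurable borel"
    unfolding H_def
    by (intro measurable_compose[OF _ measurable_ennreal] borel_measurable_continuous_on_indicator
        continuous_intros holomorphic_on_imp_continuous_on[OF g']) simp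
  have [measurable]: "circlepath (0::complex) (r / 2) \<in> borel_measurable borel"
    unfolding circlepath by (intro borel_measurable_continuous_onI continuous_intros)
  let ?c = "circlepath (0::complex) (r / 2)"
  have "ennreal ((cmod (g w))\<^sup>2) * ennreal (pi * (r / 4)\<^sup>2)
      = (\<integral>\<^sup>+v. ennreal ((cmod (g w))\<^sup>2) * indicator (ball w (r / 4)) v \<partial>lborel)"
    using r by (subst nn_integral_cmult_indicator) (auto simp: emeasure_lborel_complex_ball)
  also have "\<dots> \<le> (\<integral>\<^sup>+v. 2 * (\<integral>\<^sup>+t. H (v + ?c t) * indicator {0..1} t \<partial>lborel) \<partial>lborel)"
  proof (rule nn_integral_mono)
    fix v :: complex
    show "ennreal ((cmod (g w))\<^sup>2) * indicator (ball w (r / 4)) v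
        \<le> 2 * (\<integral>\<^sup>+t. H (v + ?c t) * indicator {0..1} t \<partial>lborel)"
    proof (cases "v \<in> ball w (r / 4)")
      case True
      have "v + ?c t \<in> ball w r" for t
      proof -
        have "cmod (?c t) = r / 2" using r by (simp add: circlepath norm_mult)
        moreover have "cmod (w - (v + ?c t)) \<le> cmod (w - v) + cmod (?c t)"
          using norm_triangle_ineq4[of "w - v" "?c t"] by (simp add: algebra_simps)
        ultimately show ?thesis using True r by (simp add: dist_norm)
      qed
      then show ?thesis
        using circle_mean_le[OF g' r True] True by (simp add: H_eq)
    qed auto
  qed
  also have "\<dots> = 2 * (\<integral>\<^sup>+v. (\<integral>\<^sup>+t. H (v + ?c t) * indicator {0..1} t \<partial>lborel) \<partial>lborel)"
    by (rule nn_integral_cmult) measurable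
  also have "(\<integral>\<^sup>+v. (\<integral>\<^sup>+t. H (v + ?c t) * indicator {0..1} t \<partial>lborel) \<partial>lborel)
      = (\<integral>\<^sup>+t. (\<integral>\<^sup>+v. H (v + ?c t) * indicator {0..1} t \<partial>lborel) \<partial>lborel)"
    by (rule lborel_pair.Fubini') measurable
  also have "\<dots> = (\<integral>\<^sup>+t. (\<integral>\<^sup>+v. H v \<partial>lborel) * indicator {0..1::real} t \<partial>lborel)"
  proof (rule nn_integral_cong)
    fix t :: real
    have "(\<integral>\<^sup>+v. H (v + ?c t) * indicator {0..1} t \<partial>lborel) = (\<integral>\<^sup>+v. H (?c t + v) \<partial>lborel) * indicator {0..1} t"
      by (subst nn_integral_multc) (auto simp: add.commute)
    also have "(\<integral>\<^sup>+v. H (?c t + v) \<partial>lborel) = (\<integral>\<^sup>+v. H v \<partial>distr lborel borel ((+) (?c t)))"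
      by (subst nn_integral_distr) auto
    also have "\<dots> = (\<integral>\<^sup>+v. H v \<partial>lborel)"
      by (simp add: lborel_distr_plus)
    finally show "(\<integral>\<^sup>+v. H (v + ?c t) * indicator {0..1} t \<partial>lborel) = (\<integral>\<^sup>+v. H v \<partial>lborel) * indicator {0..1} t" .
  qed
  also have "\<dots> = (\<integral>\<^sup>+v. H v \<partial>lborel)"
    by (subst nn_integral_cmult_indicator) auto
  finally have 1: "ennreal ((cmod (g w))\<^sup>2) * ennreal (pi * (r / 4)\<^sup>2) \<le> 2 * (\<integral>\<^sup>+v. H v \<partial>lborel)" .
  have "(\<integral>\<^sup>+v. H v \<partial>disc_area) = ennreal (1 / pi) * (\<integral>\<^sup>+v. H v * indicator unit_disc v \<partial>lborel)"
    by (rule nn_integral_disc_area) measurable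
  also have "(\<lambda>v. H v * indicator unit_disc v) = H"
    using sub by (auto simp: fun_eq_iff H_eq indicator_def)
  finally have 2: "(\<integral>\<^sup>+v. H v \<partial>disc_area) = ennreal (1 / pi) * (\<integral>\<^sup>+v. H v \<partial>lborel)" .
  have "ennreal ((cmod (g w))\<^sup>2) = ennreal (16 / (pi * r\<^sup>2)) * (ennreal ((cmod (g w))\<^sup>2) * ennreal (pi * (r / 4)\<^sup>2))"
    using r by (simp add: power2_eq_square flip: ennreal_mult)
  also have "\<dots> \<le> ennreal (16 / (pi * r\<^sup>2)) * (2 * (\<integral>\<^sup>+v. H v \<partial>lborel))"
    by (intro mult_left_mono 1) auto
  also have "\<dots> = ennreal (32 / r\<^sup>2) * (\<integral>\<^sup>+v. H v \<partial>disc_area)"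
  proof -
    have "ennreal (16 / (pi * r\<^sup>2)) * 2 = ennreal (32 / r\<^sup>2) * ennreal (1 / pi)"
      using r by (subst ennreal_numeral[symmetric], subst (1 2) ennreal_mult[symmetric]) auto
    then show ?thesis unfolding 2 by (simp add: mult.assoc flip: mult.assoc)
  qed
  finally show ?thesis by (simp add: H_eq)
qed

section \<open>Arcs and their upper boxes\<close>

lemma cis_eq_cis_iff: "cis x = cis y \<longleftrightarrow> (\<exists>k::int. x = y + 2 * pi * k)"
proof -
  have "cis x = cis y \<longleftrightarrow> (\<exists>n::int. \<i> * complex_of_real x = \<i> * complex_of_real y + (of_int (2 * n) * pi) * \<i>)"
    by (simp only: cis_conv_exp exp_eq)
  also have "(\<lambda>n::int. \<i> * complex_of_real x = \<i> * complex_of_real y + (of_int (2 * n) * pi) * \<i>) = (\<lambda>n. x = y + 2 * pi * n)"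
  proof
    fix n :: int
    have "\<i> * complex_of_real x = \<i> * complex_of_real y + (of_int (2 * n) * pi) * \<i>
        \<longleftrightarrow> \<i> * complex_of_real x = \<i> * complex_of_real (y + 2 * pi * n)"
      by (simp add: algebra_simps)
    also have "\<dots> \<longleftrightarrow> x = y + 2 * pi * n"
      by (simp only: mult_cancel_left of_real_eq_iff) simp
    finally show "(\<i> * complex_of_real x = \<i> * complex_of_real y + (of_int (2 * n) * pi) * \<i>) = (x = y + 2 * pi * n)" .
  qed
  finally show ?thesis .
qed

lemma cmod_cis_diff_le: "cmod (cis x - cis y) \<le> \<bar>x - y\<bar>"
proof -
  have "cis x - cis y = cis y * (exp (\<i> * of_real (x - y)) - 1)"
    by (simp add: cis_conv_exp algebra_simps flip: exp_add)
  then have "cmod (cis x - cis y) = 2 * \<bar>sin ((x - y) / 2)\<bar>"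
    by (simp only: norm_mult dist_exp_i_1) simp
  also have "\<dots> \<le> 2 * \<bar>(x - y) / 2\<bar>"
    by (intro mult_left_mono abs_sin_x_le_abs_x) auto
  finally show ?thesis by simp
qed

text \<open>Modulo the period, the parameter interval of length \<open>l\<close> meets two consecutive periods; its two
  pieces have total length \<open>l\<close>. The set is squeezed between an open and a closed version of the same measure, so
  all types of end points are treated at once.\<close>

lemma arc_len_cis_image:
  assumes l: "0 < l" "l \<le> 2 * pi" and X: "X \<in> sets borel" "{\<theta><..<\<theta> + l} \<subseteq> X" "X \<subseteq> {\<theta>..\<theta> + l}"
  shows "arc_len (cis ` X) = l / (2 * pi)"
proof -
  define n :: int where "n = \<lfloor>\<theta> / (2 * pi)\<rfloor>"
  define a where "a = \<theta> / (2 * pi) - n"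
  define b where "b = l / (2 * pi)"
  have a: "0 \<le> a" "a < 1" unfolding a_def n_def by linarith+
  have b: "0 < b" "b \<le> 1" using l by (auto simp: b_def)
  have \<theta>: "\<theta> = 2 * pi * (a + n)" by (simp add: a_def)
  have l_eq: "l = 2 * pi * b" by (simp add: b_def)
  define Y where "Y = {s::real. 2 * pi * (s + n) \<in> X}"
  have Y1: "{a<..<a + b} \<subseteq> Y" and Y2: "Y \<subseteq> {a..a + b}"
  proof -
    show "{a<..<a + b} \<subseteq> Y"
    proof
      fix s assume "s \<in> {a<..<a + b}"
      then have "2 * pi * (a + n) < 2 * pi * (s + n)" "2 * pi * (s + n) < 2 * pi * (a + n + b)"
        by (auto intro!: mult_strict_left_mono)
      then show "s \<in> Y" using X(2) by (auto simp: Y_def \<theta> l_eq algebra_simps)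
    qed
    show "Y \<subseteq> {a..a + b}"
    proof
      fix s assume "s \<in> Y"
      then have "2 * pi * (a + n) \<le> 2 * pi * (s + n)" "2 * pi * (s + n) \<le> 2 * pi * (a + n + b)"
        using X(3) by (auto simp: Y_def \<theta> l_eq distrib_left)
      then show "s \<in> {a..a + b}" by (simp add: mult_le_cancel_left_pos)
    qed
  qed
  have Ymeas: "Y \<in> sets borel"
    using measurable_sets[OF _ X(1), of "\<lambda>s::real. 2 * pi * (s + n)" borel] by (simp add: Y_def vimage_def)
  have Y'meas: "{s. s + 1 \<in> Y} \<in> sets borel"
    using measurable_sets[OF _ Ymeas, of "\<lambda>s::real. s + 1" borel] by (simp add: vimage_def)
  define S where "S = {t \<in> {0..<1}. cis (2 * pi * t) \<in> cis ` X}"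
  have S_eq: "S = {0..<1} \<inter> (Y \<union> {s. s + 1 \<in> Y})"
  proof -
    have "cis (2 * pi * t) \<in> cis ` X \<longleftrightarrow> t \<in> Y \<or> t + 1 \<in> Y" if t: "t \<in> {0..<1}" for t
    proof
      assume "cis (2 * pi * t) \<in> cis ` X"
      then obtain x where x: "x \<in> X" "cis x = cis (2 * pi * t)" by auto
      then obtain k :: int where k: "x = 2 * pi * t + 2 * pi * k" using cis_eq_cis_iff by blast
      define j where "j = k - n"
      have "x = 2 * pi * ((t + j) + n)" using k by (simp add: j_def algebra_simps)
      then have j: "t + j \<in> Y" using x(1) by (simp add: Y_def)
      then have "a \<le> t + j" "t + j \<le> a + b" using Y2 by auto
      then have "-1 < real_of_int j" "real_of_int j < 2" using t a b by auto
      then have "j = 0 \<or> j = 1" by linarith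
      then show "t \<in> Y \<or> t + 1 \<in> Y" using j by auto
    next
      assume "t \<in> Y \<or> t + 1 \<in> Y"
      then obtain j :: int where "t + j \<in> Y" by (metis add.right_neutral of_int_0 of_int_1)
      then have "2 * pi * (t + j + n) \<in> X" by (simp add: Y_def)
      moreover have "cis (2 * pi * (t + j + n)) = cis (2 * pi * t)"
        unfolding cis_eq_cis_iff by (rule exI[of _ "j + n"]) (simp add: algebra_simps)
      ultimately show "cis (2 * pi * t) \<in> cis ` X" by (metis imageI)
    qed
    then show ?thesis by (auto simp: S_def)
  qed
  have Smeas: "S \<in> sets lborel" unfolding S_eq using Ymeas Y'meas by auto
  have up: "S \<subseteq> {a..min 1 (a + b)} \<union> {0..a + b - 1}"
    unfolding S_eq using Y2 by auto
  have lo: "{a<..<min 1 (a + b)} \<union> {0<..<a + b - 1} \<subseteq> S"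
  proof
    fix t assume "t \<in> {a<..<min 1 (a + b)} \<union> {0<..<a + b - 1}"
    then consider "t \<in> {a<..<a + b}" "t \<in> {0..<1}" | "t + 1 \<in> {a<..<a + b}" "t \<in> {0..<1}"
      using a b by fastforce
    then show "t \<in> S" unfolding S_eq using Y1 by cases blast+
  qed
  have eq: "(min 1 (a + b) - a) + max 0 (a + b - 1) = b" by simp
  have "emeasure lborel S \<le> emeasure lborel ({a..min 1 (a + b)} \<union> {0..a + b - 1})"
    by (rule emeasure_mono[OF up]) simp
  also have "\<dots> \<le> emeasure lborel {a..min 1 (a + b)} + emeasure lborel {0..a + b - 1}"
    by (rule emeasure_subadditive) auto
  also have "\<dots> = ennreal (min 1 (a + b) - a) + ennreal (max 0 (a + b - 1))"
    using a b by (auto simp: emeasure_lborel_Icc_eq max_def)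
  also have "\<dots> = ennreal b"
    using a b eq by (subst ennreal_plus[symmetric]) auto
  finally have 1: "emeasure lborel S \<le> ennreal b" .
  have "ennreal b = ennreal (min 1 (a + b) - a) + ennreal (max 0 (a + b - 1))"
    using a b eq by (subst ennreal_plus[symmetric]) auto
  also have "\<dots> = emeasure lborel {a<..<min 1 (a + b)} + emeasure lborel {0<..<a + b - 1}"
    using a b by (auto simp: emeasure_lborel_Ioo max_def)
  also have "\<dots> = emeasure lborel ({a<..<min 1 (a + b)} \<union> {0<..<a + b - 1})"
    using b by (intro plus_emeasure) auto
  also have "\<dots> \<le> emeasure lborel S"
    by (rule emeasure_mono[OF lo Smeas])
  finally have "emeasure lborel S = ennreal b" using 1 by simp
  then have "emeasure lebesgue S = ennreal b" using Smeas by simp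
  then have "measure lebesgue S = b" using b by (simp add: measure_def)
  then show ?thesis by (simp add: arc_len_def S_def b_def)
qed

text \<open>A half-open interval is a countable union of compact ones, and so is its image.\<close>

lemma borel_cis_image:
  fixes \<theta> l :: real
  shows "cis ` {\<theta>..<l} \<in> sets borel" "cis ` {\<theta><..l} \<in> sets borel"
proof -
  have comp: "cis ` {x..y} \<in> sets borel" for x y
    by (intro borel_closed compact_imp_closed compact_continuous_image continuous_intros) auto
  have "{\<theta>..<l} = (\<Union>n. {\<theta>..l - 1 / real (Suc n)})"
  proof (intro equalityI subsetI)
    fix x assume x: "x \<in> {\<theta>..<l}"
    then obtain n where "inverse (real (Suc n)) < l - x" using reals_Archimedean[of "l - x"] by auto
    then show "x \<in> (\<Union>n. {\<theta>..l - 1 / real (Suc n)})" using x by (auto simp: field_simps intro!: exI[of _ n])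
  next
    fix x assume "x \<in> (\<Union>n. {\<theta>..l - 1 / real (Suc n)})"
    then obtain n where x: "\<theta> \<le> x" "x \<le> l - 1 / real (Suc n)" by auto
    have "0 < 1 / real (Suc n)" by simp
    with x show "x \<in> {\<theta>..<l}" unfolding atLeastLessThan_iff by linarith
  qed
  then have "cis ` {\<theta>..<l} = (\<Union>n. cis ` {\<theta>..l - 1 / real (Suc n)})" by (metis image_UN)
  then show "cis ` {\<theta>..<l} \<in> sets borel" using comp by auto
  have "{\<theta><..l} = (\<Union>n. {\<theta> + 1 / real (Suc n)..l})"
  proof (intro equalityI subsetI)
    fix x assume x: "x \<in> {\<theta><..l}"
    then obtain n where "inverse (real (Suc n)) < x - \<theta>" using reals_Archimedean[of "x - \<theta>"] by auto
    then show "x \<in> (\<Union>n. {\<theta> + 1 / real (Suc n)..l})" using x by (auto simp: field_simps intro!: exI[of _ n])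
  next
    fix x assume "x \<in> (\<Union>n. {\<theta> + 1 / real (Suc n)..l})"
    then obtain n where x: "\<theta> + 1 / real (Suc n) \<le> x" "x \<le> l" by auto
    have "0 < 1 / real (Suc n)" by simp
    with x show "x \<in> {\<theta><..l}" unfolding greaterThanAtMost_iff by linarith
  qed
  then have "cis ` {\<theta><..l} = (\<Union>n. cis ` {\<theta> + 1 / real (Suc n)..l})" by (metis image_UN)
  then show "cis ` {\<theta><..l} \<in> sets borel" using comp by auto
qed

lemma half_open_arc_borel: "half_open_arc I \<Longrightarrow> I \<in> sets borel"
  using borel_cis_image by (auto simp: half_open_arc_def)

lemma half_open_arc_subset: "half_open_arc I \<Longrightarrow> I \<subseteq> unit_circle"
  by (auto simp: half_open_arc_def)

text \<open>The midpoint angle is determined up to the period only. The arc is squeezed between an open and a closed arc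
  about it because half-open arcs may be open at either end.\<close>

definition arc_centre :: "complex set \<Rightarrow> real" where
  "arc_centre I = (SOME c. cis ` {c - pi * arc_len I<..<c + pi * arc_len I} \<subseteq> I \<and>
                           I \<subseteq> cis ` {c - pi * arc_len I..c + pi * arc_len I})"

text \<open>The radius \<open>1 - 3/4 |I|\<close> is the middle one of the upper box.\<close>

definition box_centre :: "complex set \<Rightarrow> complex" where
  "box_centre I = of_real (1 - 3 / 4 * arc_len I) * cis (arc_centre I)"

lemma half_open_arcE:
  assumes "half_open_arc I"
  shows "0 < arc_len I" "arc_len I \<le> 1"
    "cis ` {arc_centre I - pi * arc_len I<..<arc_centre I + pi * arc_len I} \<subseteq> I"
    "I \<subseteq> cis ` {arc_centre I - pi * arc_len I..arc_centre I + pi * arc_len I}"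
proof -
  obtain \<theta> l where l: "0 < l" "l \<le> 2 * pi" and I: "I = cis ` {\<theta>..<\<theta> + l} \<or> I = cis ` {\<theta><..\<theta> + l}"
    using assms by (auto simp: half_open_arc_def)
  then obtain X where X: "I = cis ` X" "X \<in> sets borel" "{\<theta><..<\<theta> + l} \<subseteq> X" "X \<subseteq> {\<theta>..\<theta> + l}"
    by (elim disjE) (auto intro: that[of "{\<theta>..<\<theta> + l}"] that[of "{\<theta><..\<theta> + l}"])
  have len: "arc_len I = l / (2 * pi)"
    using arc_len_cis_image[OF l X(2-4)] X(1) by simp
  then show "0 < arc_len I" "arc_len I \<le> 1" using l by auto
  have l_eq: "pi * arc_len I = l / 2" by (simp add: len)
  have "cis ` {\<theta> + l / 2 - pi * arc_len I<..<\<theta> + l / 2 + pi * arc_len I} \<subseteq> I \<and>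
        I \<subseteq> cis ` {\<theta> + l / 2 - pi * arc_len I..\<theta> + l / 2 + pi * arc_len I}"
    using X unfolding l_eq by (auto simp: algebra_simps)
  then have "cis ` {arc_centre I - pi * arc_len I<..<arc_centre I + pi * arc_len I} \<subseteq> I \<and>
             I \<subseteq> cis ` {arc_centre I - pi * arc_len I..arc_centre I + pi * arc_len I}"
    unfolding arc_centre_def by (rule someI)
  then show "cis ` {arc_centre I - pi * arc_len I<..<arc_centre I + pi * arc_len I} \<subseteq> I"
    "I \<subseteq> cis ` {arc_centre I - pi * arc_len I..arc_centre I + pi * arc_len I}" by auto
qed

lemma cmod_box_centre: "half_open_arc I \<Longrightarrow> cmod (box_centre I) = 1 - 3 / 4 * arc_len I"
  unfolding box_centre_def norm_mult norm_of_real norm_cis using half_open_arcE(1,2)[of I] by simp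

lemma box_centre_in_disc: "half_open_arc I \<Longrightarrow> box_centre I \<in> unit_disc"
  using half_open_arcE(1)[of I] by (simp add: cmod_box_centre)

lemma cmod_upper_box:
  assumes "half_open_arc I" "z \<in> upper_box I"
  shows "1 - arc_len I \<le> cmod z" "cmod z < 1 - arc_len I / 2"
proof -
  obtain r u where "z = of_real r * u" "u \<in> I" and r: "1 - arc_len I \<le> r" "r < 1 - arc_len I / 2"
    using assms(2) by (auto simp: upper_box_def)
  moreover have "cmod u = 1" using half_open_arc_subset[OF assms(1)] \<open>u \<in> I\<close> by auto
  ultimately have "cmod z = r" using half_open_arcE(2)[OF assms(1)] by (simp add: norm_mult)
  with r show "1 - arc_len I \<le> cmod z" "cmod z < 1 - arc_len I / 2" by auto
qed

lemma upper_box_iff: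
  assumes "half_open_arc I" "z \<noteq> 0"
  shows "z \<in> upper_box I \<longleftrightarrow> sgn z \<in> I \<and> 1 - arc_len I \<le> cmod z \<and> cmod z < 1 - arc_len I / 2"
proof
  assume "z \<in> upper_box I"
  then obtain r u where z: "z = of_real r * u" "u \<in> I" and r: "1 - arc_len I \<le> r" "r < 1 - arc_len I / 2"
    by (auto simp: upper_box_def)
  have "cmod u = 1" using half_open_arc_subset[OF assms(1)] z(2) by auto
  moreover have "r > 0" using r half_open_arcE(2)[OF assms(1)] assms(2) z by (cases "r = 0") auto
  ultimately have "sgn z = u" "cmod z = r" using z by (auto simp: sgn_div_norm norm_mult scaleR_conv_of_real)
  then show "sgn z \<in> I \<and> 1 - arc_len I \<le> cmod z \<and> cmod z < 1 - arc_len I / 2" using z r by auto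
next
  assume *: "sgn z \<in> I \<and> 1 - arc_len I \<le> cmod z \<and> cmod z < 1 - arc_len I / 2"
  have "z = of_real (cmod z) * sgn z" using assms(2) by (simp add: sgn_div_norm scaleR_conv_of_real)
  then show "z \<in> upper_box I" unfolding upper_box_def using * by blast
qed

lemma borel_upper_box:
  assumes "half_open_arc I"
  shows "upper_box I \<in> sets borel"
proof -
  have "upper_box I - {0} = {z. sgn z \<in> I \<and> 1 - arc_len I \<le> cmod z \<and> cmod z < 1 - arc_len I / 2} - {0}"
    using upper_box_iff[OF assms] by auto
  moreover have "{z. sgn z \<in> I \<and> 1 - arc_len I \<le> cmod z \<and> cmod z < 1 - arc_len I / 2} \<in> sets borel"
  proof -
    have [measurable]: "I \<in> sets borel" by (rule half_open_arc_borel[OF assms])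
    have [measurable]: "(sgn :: complex \<Rightarrow> complex) \<in> borel_measurable borel"
      unfolding sgn_div_norm[abs_def] by measurable
    show ?thesis by measurable
  qed
  ultimately have "upper_box I - {0} \<in> sets borel" by auto
  moreover have "upper_box I \<inter> {0} \<in> sets borel" by (cases "0 \<in> upper_box I") auto
  ultimately have "(upper_box I - {0}) \<union> (upper_box I \<inter> {0}) \<in> sets borel" by (rule sets.Un)
  then show ?thesis by (simp add: Int_commute Un_Diff_Int)
qed

lemma cmod_polar_diff_le:
  assumes "0 \<le> r" "r \<le> 1"
  shows "cmod (of_real r * cis x - of_real r' * cis y) \<le> \<bar>r - r'\<bar> + \<bar>x - y\<bar>"
proof -
  have "of_real r * cis x - of_real r' * cis y = of_real (r - r') * cis y + of_real r * (cis x - cis y)"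
    by (simp add: algebra_simps)
  then have "cmod (of_real r * cis x - of_real r' * cis y) \<le> cmod (of_real (r - r') * cis y) + cmod (of_real r * (cis x - cis y))"
    by (metis norm_triangle_ineq)
  also have "\<dots> = \<bar>r - r'\<bar> + r * cmod (cis x - cis y)" using assms by (simp only: norm_mult norm_of_real) simp
  also have "\<dots> \<le> \<bar>r - r'\<bar> + 1 * \<bar>x - y\<bar>"
    using assms cmod_cis_diff_le[of x y] by (intro add_left_mono mult_mono) auto
  finally show ?thesis by simp
qed

text \<open>The distance is at most \<open>|I|/4\<close> radially and \<open>\<pi> |I|\<close> along the arc.\<close>

lemma upper_box_near_centre:
  assumes "half_open_arc I" "z \<in> upper_box I"
  shows "cmod (z - box_centre I) \<le> 4 * arc_len I"
proof -
  note I = half_open_arcE[OF assms(1)]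
  obtain r u where z: "z = of_real r * u" "u \<in> I" and r: "1 - arc_len I \<le> r" "r < 1 - arc_len I / 2"
    using assms(2) by (auto simp: upper_box_def)
  obtain x where x: "u = cis x" "\<bar>x - arc_centre I\<bar> \<le> pi * arc_len I"
    using I(4) z(2) by (force simp: abs_le_iff)
  have "cmod (z - box_centre I) \<le> \<bar>r - (1 - 3 / 4 * arc_len I)\<bar> + \<bar>x - arc_centre I\<bar>"
    unfolding z x box_centre_def by (rule cmod_polar_diff_le) (use r I in auto)
  also have "\<dots> \<le> arc_len I / 4 + pi * arc_len I"
    by (intro add_mono x(2)) (use r in \<open>simp add: abs_le_iff field_simps\<close>)
  also have "\<dots> \<le> arc_len I / 4 + 3.75 * arc_len I"
    using I pi_less_4 pi_approx by (intro add_left_mono mult_right_mono) auto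
  finally show ?thesis by simp
qed

text \<open>The logarithm of \<open>z / w\<close> is small for \<open>z\<close> in the ball around the box centre \<open>w\<close>, so the argument of \<open>z\<close>
  stays within the arc.\<close>

lemma ball_subset_upper_box:
  assumes "half_open_arc I"
  shows "ball (box_centre I) (arc_len I / 8) \<subseteq> upper_box I"
proof
  note I = half_open_arcE[OF assms]
  let ?s = "arc_len I" and ?w = "box_centre I"
  fix z assume "z \<in> ball ?w (?s / 8)"
  then have z: "cmod (z - ?w) < ?s / 8" by (simp add: dist_norm norm_minus_commute)
  have w: "cmod ?w = 1 - 3 / 4 * ?s" by (rule cmod_box_centre[OF assms])
  then have w4: "cmod ?w \<ge> 1 / 4" and w0: "?w \<noteq> 0" using I by auto
  define \<zeta> where "\<zeta> = (z - ?w) / ?w"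
  have "cmod \<zeta> = cmod (z - ?w) / cmod ?w" by (simp add: \<zeta>_def norm_divide)
  also have "\<dots> \<le> cmod (z - ?w) / (1 / 4)" using w4 w0 by (intro divide_left_mono) (auto intro!: mult_pos_pos)
  finally have \<zeta>: "cmod \<zeta> < ?s / 2" using z by simp
  then have "cmod \<zeta> < 1 / 2" using I by simp
  then have "cmod (Ln (1 + \<zeta>)) \<le> 2 * cmod \<zeta>" by (rule norm_Ln_le)
  then have "\<bar>Im (Ln (1 + \<zeta>))\<bar> < ?s" using \<zeta> abs_Im_le_cmod[of "Ln (1 + \<zeta>)"] by linarith
  also have "?s \<le> pi * ?s" using I pi_gt3 by simp
  finally have y: "\<bar>Im (Ln (1 + \<zeta>))\<bar> < pi * ?s" .
  have "1 + \<zeta> \<noteq> 0"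
  proof
    assume "1 + \<zeta> = 0"
    then have "\<zeta> = - 1" by (simp add: add_eq_0_iff)
    then show False using \<open>cmod \<zeta> < 1 / 2\<close> by simp
  qed
  then have "1 + \<zeta> = exp (Ln (1 + \<zeta>))" by simp
  also have "\<dots> = of_real (exp (Re (Ln (1 + \<zeta>)))) * cis (Im (Ln (1 + \<zeta>)))"
    by (rule exp_eq_polar)
  finally have "?w * (1 + \<zeta>) = ?w * (of_real (exp (Re (Ln (1 + \<zeta>)))) * cis (Im (Ln (1 + \<zeta>))))"
    by (rule arg_cong)
  also have "\<dots> = of_real ((1 - 3 / 4 * ?s) * exp (Re (Ln (1 + \<zeta>)))) * cis (arc_centre I + Im (Ln (1 + \<zeta>)))"
    by (simp only: box_centre_def of_real_mult cis_mult[symmetric] mult_ac)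
  finally have "?w * (1 + \<zeta>) = of_real ((1 - 3 / 4 * ?s) * exp (Re (Ln (1 + \<zeta>)))) * cis (arc_centre I + Im (Ln (1 + \<zeta>)))" .
  moreover have "?w * (1 + \<zeta>) = z" using w0 by (simp add: \<zeta>_def field_simps)
  ultimately have z_eq: "z = of_real ((1 - 3 / 4 * ?s) * exp (Re (Ln (1 + \<zeta>)))) * cis (arc_centre I + Im (Ln (1 + \<zeta>)))" by simp
  have "cmod z = (1 - 3 / 4 * ?s) * exp (Re (Ln (1 + \<zeta>)))"
    using I by (subst z_eq) (simp only: norm_mult norm_of_real norm_cis abs_mult, simp)
  with z_eq have z': "z = of_real (cmod z) * cis (arc_centre I + Im (Ln (1 + \<zeta>)))" by simp
  have "cis (arc_centre I + Im (Ln (1 + \<zeta>))) \<in> I"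
  proof (rule subsetD[OF I(3)], rule imageI)
    show "arc_centre I + Im (Ln (1 + \<zeta>)) \<in> {arc_centre I - pi * ?s<..<arc_centre I + pi * ?s}"
      using y by (auto simp: abs_less_iff)
  qed
  moreover have "1 - ?s \<le> cmod z" "cmod z < 1 - ?s / 2"
  proof -
    have "\<bar>cmod z - cmod ?w\<bar> \<le> cmod (z - ?w)" by (rule norm_triangle_ineq3)
    then show "1 - ?s \<le> cmod z" "cmod z < 1 - ?s / 2" using z w I by auto
  qed
  ultimately show "z \<in> upper_box I" unfolding upper_box_def using z' by blast
qed

lemma arc_len_mono:
  assumes "half_open_arc I" "half_open_arc J" "I \<subseteq> J"
  shows "arc_len I \<le> arc_len J"
proof -
  have *: "{t \<in> {0..<1}. cis (2 * pi * t) \<in> K} \<in> lmeasurable" if "half_open_arc K" for K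
  proof -
    have [measurable]: "K \<in> sets borel" by (rule half_open_arc_borel[OF that])
    have [measurable]: "cis \<in> borel_measurable borel"
      by (intro borel_measurable_continuous_onI continuous_intros)
    have "{t \<in> {0..<1}. cis (2 * pi * t) \<in> K} \<in> sets borel" by measurable
    then show ?thesis
      by (intro bounded_set_imp_lmeasurable sets_completionI_sets)
         (auto intro: bounded_subset[of "{0..<1}"])
  qed
  show ?thesis unfolding arc_len_def
    by (intro measure_mono_fmeasurable * assms fmeasurableD) (use assms(3) in auto)
qed

text \<open>The distance is at most \<open>3/4 |J|\<close> radially and \<open>\<pi> |J|\<close> along the arc.\<close>

lemma box_centre_near:
  assumes "half_open_arc I" "half_open_arc J" "I \<subseteq> J"
  shows "cmod (box_centre I - box_centre J) \<le> 4 * arc_len J"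
proof -
  note I = half_open_arcE[OF assms(1)] and J = half_open_arcE[OF assms(2)]
  have le: "arc_len I \<le> arc_len J" by (rule arc_len_mono[OF assms])
  have "cis (arc_centre I) \<in> J" using I(1,3) assms(3) by (auto simp: image_subset_iff)
  then obtain x where x: "cis (arc_centre I) = cis x" "\<bar>x - arc_centre J\<bar> \<le> pi * arc_len J"
    using J(4) by (force simp: abs_le_iff)
  have "cmod (box_centre I - box_centre J) \<le> \<bar>(1 - 3 / 4 * arc_len I) - (1 - 3 / 4 * arc_len J)\<bar> + \<bar>x - arc_centre J\<bar>"
    unfolding box_centre_def x by (rule cmod_polar_diff_le) (use I in auto)
  also have "\<dots> \<le> 3 / 4 * arc_len J + pi * arc_len J"
    by (intro add_mono x(2)) (use le I in auto)
  also have "\<dots> \<le> 3 / 4 * arc_len J + 3.25 * arc_len J"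
    using J pi_approx by (intro add_left_mono mult_right_mono) auto
  finally show ?thesis by simp
qed

section \<open>The kernel \<open>1 - cnj a z\<close> on the disc\<close>

lemma cmod_one_minus_bounds:
  assumes "w \<in> unit_disc" "z \<in> unit_disc"
  shows "cmod (z - w) \<le> cmod (1 - cnj w * z)" "1 - cmod w \<le> cmod (1 - cnj w * z)"
    "1 - cmod z \<le> cmod (1 - cnj w * z)" "0 < cmod (1 - cnj w * z)"
    "cmod (1 - cnj w * z) \<le> 2"
proof -
  have w: "cmod w < 1" and z: "cmod z < 1" using assms by auto
  have le1: "cmod (cnj w * z) \<le> cmod w" using w z by (simp add: norm_mult mult_left_le)
  have le2: "cmod (cnj w * z) \<le> cmod z" using w z by (simp add: norm_mult mult_left_le_one_le)
  have tr: "1 - cmod (cnj w * z) \<le> cmod (1 - cnj w * z)"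
    using norm_triangle_ineq2[of 1 "cnj w * z"] by simp
  show "1 - cmod w \<le> cmod (1 - cnj w * z)" "1 - cmod z \<le> cmod (1 - cnj w * z)" "0 < cmod (1 - cnj w * z)"
    using le1 le2 tr w by linarith+
  show "cmod (1 - cnj w * z) \<le> 2"
    using norm_triangle_ineq4[of 1 "cnj w * z"] le1 w by simp
  have "(cmod (1 - cnj w * z))\<^sup>2 - (cmod (z - w))\<^sup>2 = (1 - (cmod w)\<^sup>2) * (1 - (cmod z)\<^sup>2)"
    unfolding cmod_power2 by (simp add: algebra_simps power2_eq_square)
  also have "\<dots> \<ge> 0" using w z by (intro mult_nonneg_nonneg) (auto simp: power_le_one)
  finally have "(cmod (z - w))\<^sup>2 \<le> (cmod (1 - cnj w * z))\<^sup>2" by simp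
  then show "cmod (z - w) \<le> cmod (1 - cnj w * z)" by (rule power2_le_imp_le) simp
qed

lemma one_minus_disc_automorphism_sq:
  assumes "a \<in> unit_disc" "z \<in> unit_disc"
  shows "1 - (cmod (disc_automorphism a z))\<^sup>2
    = (1 - (cmod a)\<^sup>2) * (1 - (cmod z)\<^sup>2) / (cmod (1 - cnj a * z))\<^sup>2"
proof -
  have pos: "0 < cmod (1 - cnj a * z)" by (rule cmod_one_minus_bounds(4)[OF assms])
  have "(cmod (1 - cnj a * z))\<^sup>2 - (cmod (a - z))\<^sup>2 = (1 - (cmod a)\<^sup>2) * (1 - (cmod z)\<^sup>2)"
    unfolding cmod_power2 by (simp add: algebra_simps power2_eq_square)
  moreover have "1 - (cmod (disc_automorphism a z))\<^sup>2
    = ((cmod (1 - cnj a * z))\<^sup>2 - (cmod (a - z))\<^sup>2) / (cmod (1 - cnj a * z))\<^sup>2"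
    using pos unfolding disc_automorphism_def norm_divide power_divide
    by (simp only: diff_divide_distrib) simp
  ultimately show ?thesis by simp
qed

lemma cmod_disc_automorphism_bounds:
  assumes "a \<in> unit_disc" "z \<in> unit_disc" "z \<noteq> a"
  shows "0 < cmod (disc_automorphism a z)" "cmod (disc_automorphism a z) \<le> 1"
proof -
  have pos: "0 < cmod (1 - cnj a * z)" by (rule cmod_one_minus_bounds(4)[OF assms(1,2)])
  show "0 < cmod (disc_automorphism a z)" using pos assms(3) by (auto simp: disc_automorphism_def)
  show "cmod (disc_automorphism a z) \<le> 1"
    using pos cmod_one_minus_bounds(1)[OF assms(1,2)]
    by (simp add: disc_automorphism_def norm_divide norm_minus_commute)
qed

text \<open>From \<open>ln t \<le> t - 1\<close> for \<open>t\<close> the square of the modulus of the automorphism.\<close>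

lemma green_lower:
  assumes "a \<in> unit_disc" "z \<in> unit_disc" "z \<noteq> a"
  shows "(1 - (cmod a)\<^sup>2) * (1 - (cmod z)\<^sup>2) / (cmod (1 - cnj a * z))\<^sup>2 \<le> 2 * green z a"
proof -
  let ?x = "cmod (disc_automorphism a z)"
  note x = cmod_disc_automorphism_bounds[OF assms]
  have "ln (?x\<^sup>2) \<le> ?x\<^sup>2 - 1" using x by (intro ln_le_minus_one) auto
  moreover have "ln (?x\<^sup>2) = 2 * ln ?x" using x by (simp add: ln_realpow)
  moreover have "green z a = - ln ?x" using x by (simp add: green_def ln_div)
  ultimately show ?thesis
    using one_minus_disc_automorphism_sq[OF assms(1,2)] by simp
qed

text \<open>From \<open>ln (1 / x) \<le> 1 / x - 1\<close>; the factor \<open>1 / x\<close> keeps the logarithmic pole under control.\<close>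

lemma green_upper:
  assumes "a \<in> unit_disc" "z \<in> unit_disc"
  shows "0 \<le> green z a"
    and "green z a \<le> 4 * ((1 - cmod a) * (1 - cmod z)) / (cmod (1 - cnj a * z) * cmod (z - a))"
proof -
  let ?x = "cmod (disc_automorphism a z)" and ?d = "cmod (1 - cnj a * z)"
  have d: "0 < ?d" by (rule cmod_one_minus_bounds(4)[OF assms])
  have "0 \<le> green z a \<and> green z a \<le> 4 * ((1 - cmod a) * (1 - cmod z)) / (?d * cmod (z - a))"
  proof (cases "z = a")
    case True
    then show ?thesis by (simp add: green_def disc_automorphism_def)
  next
    case False
    note x = cmod_disc_automorphism_bounds[OF assms False]
    have g: "green z a = ln (1 / ?x)" by (simp add: green_def)
    have "ln (1 / ?x) \<le> 1 / ?x - 1" using x by (intro ln_le_minus_one) auto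
    also have "\<dots> = (1 - ?x) / ?x" using x by (simp add: diff_divide_distrib)
    also have "\<dots> \<le> (1 - ?x\<^sup>2) / ?x"
      using x by (intro divide_right_mono) (auto simp: power2_eq_square mult_left_le)
    also have "\<dots> = (1 - (cmod a)\<^sup>2) * (1 - (cmod z)\<^sup>2) / (?d\<^sup>2 * ?x)"
      unfolding one_minus_disc_automorphism_sq[OF assms] by simp
    also have "?d\<^sup>2 * ?x = ?d * cmod (z - a)"
      using d by (simp add: disc_automorphism_def norm_divide norm_minus_commute power2_eq_square)
    finally have g1: "ln (1 / ?x) \<le> (1 - (cmod a)\<^sup>2) * (1 - (cmod z)\<^sup>2) / (?d * cmod (z - a))" .
    have "(1 - (cmod a)\<^sup>2) * (1 - (cmod z)\<^sup>2) \<le> (2 * (1 - cmod a)) * (2 * (1 - cmod z))"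
    proof (intro mult_mono)
      have "1 - t\<^sup>2 \<le> 2 * (1 - t)" for t :: real using zero_le_power2[of "1 - t"] by (simp add: power2_eq_square algebra_simps)
      then show "1 - (cmod a)\<^sup>2 \<le> 2 * (1 - cmod a)" "1 - (cmod z)\<^sup>2 \<le> 2 * (1 - cmod z)" by blast+
    qed (use assms in \<open>auto simp: power_le_one\<close>)
    also have "(2 * (1 - cmod a)) * (2 * (1 - cmod z)) = 4 * ((1 - cmod a) * (1 - cmod z))" by (simp only: mult_ac)
    finally have "(1 - (cmod a)\<^sup>2) * (1 - (cmod z)\<^sup>2) / (?d * cmod (z - a))
       \<le> 4 * ((1 - cmod a) * (1 - cmod z)) / (?d * cmod (z - a))"
      by (rule divide_right_mono) simp
    with g1 have "green z a \<le> 4 * ((1 - cmod a) * (1 - cmod z)) / (?d * cmod (z - a))"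
      unfolding g by simp
    moreover have "0 \<le> green z a" unfolding g using x by simp
    ultimately show ?thesis by simp
  qed
  then show "0 \<le> green z a"
    and "green z a \<le> 4 * ((1 - cmod a) * (1 - cmod z)) / (cmod (1 - cnj a * z) * cmod (z - a))" by auto
qed

section \<open>Dyadic trees of arcs\<close>

text \<open>A dyadic system keeps only the union of its generations; here the generations \<open>L k\<close> themselves are fixed.\<close>

locale dyadic_tree =
  fixes L :: "nat \<Rightarrow> complex set set"
  assumes root: "L 0 = {unit_circle}"
    and part: "partition_on unit_circle (L k)"
    and card_level: "card (L k) = 2 ^ k"
    and arc: "I \<in> L k \<Longrightarrow> half_open_arc I"
    and len: "I \<in> L k \<Longrightarrow> arc_len I = 1 / 2 ^ k"
    and refine: "I \<in> L (Suc k) \<Longrightarrow> \<exists>J\<in>L k. I \<subseteq> J"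
begin

definition nodes :: "complex set set" where
  "nodes = (\<Union>k. L k)"

lemma finite_level: "finite (L k)"
  using card_level[of k] by (intro card_ge_0_finite) simp

lemma countable_nodes: "countable nodes"
  unfolding nodes_def using finite_level by (intro countable_UN) (auto intro: countable_finite)

lemma node_arc: "I \<in> nodes \<Longrightarrow> half_open_arc I"
  unfolding nodes_def using arc by auto

lemma node_nonempty: "I \<in> nodes \<Longrightarrow> I \<noteq> {}"
  unfolding nodes_def using part by (auto dest: partition_onD3)

lemma level_unique: "I \<in> L k \<Longrightarrow> J \<in> L k \<Longrightarrow> I \<inter> J \<noteq> {} \<Longrightarrow> I = J"
  using partition_onD2[OF part[of k]] by (auto dest: disjointD)

lemma ancestor: "I \<in> L m \<Longrightarrow> k \<le> m \<Longrightarrow> \<exists>J\<in>L k. I \<subseteq> J"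
proof (induction m arbitrary: I)
  case (Suc m)
  show ?case
  proof (cases "k = Suc m")
    case False
    obtain J where J: "J \<in> L m" "I \<subseteq> J" using refine[OF Suc.prems(1)] by blast
    then obtain K where "K \<in> L k" "J \<subseteq> K" using Suc.IH[OF J(1)] Suc.prems(2) False by auto
    then show ?thesis using J by blast
  qed (use Suc.prems in auto)
qed auto

lemma level_nested:
  assumes "I \<in> L m" "J \<in> L k" "k \<le> m" "I \<inter> J \<noteq> {}"
  shows "I \<subseteq> J"
proof -
  obtain K where K: "K \<in> L k" "I \<subseteq> K" using ancestor[OF assms(1,3)] by blast
  then have "K = J" using level_unique[OF K(1) assms(2)] assms(4) by blast
  then show ?thesis using K by simp
qed

lemma nodes_nested:
  assumes "I \<in> nodes" "J \<in> nodes" "I \<inter> J \<noteq> {}"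
  shows "I \<subseteq> J \<or> J \<subseteq> I"
proof -
  obtain m k where "I \<in> L m" "J \<in> L k" using assms(1,2) by (auto simp: nodes_def)
  then show ?thesis
    using level_nested[of I m J k] level_nested[of J k I m] assms(3) by (cases "k \<le> m") auto
qed

text \<open>In particular a node has only finitely many supersets among the nodes, so the sums in the covering condition are finite.\<close>

lemma superset_level:
  assumes "I \<in> L m" "J \<in> nodes" "I \<subseteq> J"
  shows "J \<in> (\<Union>k\<le>m. L k)"
proof -
  obtain k where k: "J \<in> L k" using assms(2) by (auto simp: nodes_def)
  have ne: "I \<noteq> {}" using node_nonempty assms(1) by (auto simp: nodes_def)
  show ?thesis
  proof (cases "k \<le> m")
    case False
    then have "J \<subseteq> I" using level_nested[OF k assms(1)] assms(3) ne by auto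
    then have "J = I" using assms(3) by auto
    then show ?thesis using assms(1) by auto
  qed (use k in auto)
qed

lemma circle_node: "unit_circle \<in> nodes" "I \<in> nodes \<Longrightarrow> I \<subseteq> unit_circle" "arc_len unit_circle = 1"
proof -
  show "unit_circle \<in> nodes" using root unfolding nodes_def by blast
  show "I \<in> nodes \<Longrightarrow> I \<subseteq> unit_circle" by (intro half_open_arc_subset node_arc)
  show "arc_len unit_circle = 1" using len[of unit_circle 0] root by simp
qed

lemma upper_box_disjoint:
  assumes "I \<in> nodes" "J \<in> nodes" "I \<noteq> J"
  shows "upper_box I \<inter> upper_box J = {}"
proof (rule ccontr)
  assume "upper_box I \<inter> upper_box J \<noteq> {}"
  then obtain z where z: "z \<in> upper_box I" "z \<in> upper_box J" by auto
  obtain m k where mk: "I \<in> L m" "J \<in> L k" using assms(1,2) by (auto simp: nodes_def)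
  have arcs: "half_open_arc I" "half_open_arc J" using node_arc assms(1,2) by auto
  have half: "1 / 2 ^ j / 2 \<ge> 1 / (2::real) ^ i" if "j < i" for i j :: nat
  proof -
    have "(2::real) ^ Suc j \<le> 2 ^ i" using that by (intro power_increasing) auto
    then show ?thesis by (simp add: field_simps)
  qed
  have "1 - 1 / 2 ^ m \<le> cmod z" "cmod z < 1 - 1 / 2 ^ m / 2" "1 - 1 / 2 ^ k \<le> cmod z" "cmod z < 1 - 1 / 2 ^ k / 2"
    using cmod_upper_box[OF arcs(1) z(1)] cmod_upper_box[OF arcs(2) z(2)] len[OF mk(1)] len[OF mk(2)] by auto
  then have mk_eq: "m = k" using half[of m k] half[of k m] by (cases m k rule: linorder_cases) auto
  show False
  proof (cases "z = 0")
    case True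
    then have "1 \<le> arc_len I" using cmod_upper_box[OF arcs(1) z(1)] by simp
    then have "(2::real) ^ m \<le> 1" using len[OF mk(1)] by (simp add: field_simps)
    have "m = 0"
    proof (rule ccontr)
      assume "m \<noteq> 0"
      then have "1 < (2::real) ^ m" by (intro one_less_power) auto
      with \<open>(2::real) ^ m \<le> 1\<close> show False by linarith
    qed
    then show False using mk mk_eq root assms(3) by auto
  next
    case False
    then have "sgn z \<in> I \<inter> J" using z upper_box_iff arcs by auto
    then show False using level_unique[of I m J] mk mk_eq assms(3) by blast
  qed
qed

lemma upper_boxes_cover:
  assumes "z \<in> unit_disc"
  shows "\<exists>I\<in>nodes. z \<in> upper_box I"
proof (cases "z = 0")
  case True
  have "of_real 0 * 1 \<in> upper_box unit_circle"
    unfolding upper_box_def using circle_node(3) by (auto intro!: exI[of _ "0::real"] exI[of _ "1::complex"])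
  then show ?thesis using True circle_node(1) by auto
next
  case False
  define t where "t = 1 - cmod z"
  have t: "0 < t" "t < 1" using assms False by (auto simp: t_def)
  define k where "k = nat \<lfloor>log 2 (1 / t)\<rfloor>"
  have "log 2 (1 / t) \<ge> 0" using t by simp
  then have k: "real k \<le> log 2 (1 / t)" "log 2 (1 / t) < real k + 1" by (auto simp: k_def)
  then have "2 ^ k \<le> 1 / t" "1 / t < 2 ^ (k + 1)"
    using t by (auto simp: le_log_iff log_less_iff powr_add powr_realpow)
  then have kt: "t \<le> 1 / 2 ^ k" "1 / 2 ^ k / 2 < t" using t by (auto simp: field_simps)
  have "sgn z \<in> unit_circle" using False by (simp add: norm_sgn)
  then obtain I where I: "I \<in> L k" "sgn z \<in> I" using partition_onD1[OF part[of k]] by auto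
  have "z \<in> upper_box I"
    using upper_box_iff[OF arc[OF I(1)] False] I kt len[OF I(1)] by (simp add: t_def)
  then show ?thesis using I by (auto simp: nodes_def)
qed

text \<open>The balls around the box centres lie in the pairwise disjoint boxes, so comparing areas bounds the number of
  boxes of size at least \<open>\<rho>\<close> near a point.\<close>

lemma card_near_le:
  assumes S: "finite S" "S \<subseteq> nodes" and \<rho>: "0 < \<rho>" "0 \<le> c"
    and big: "\<And>I. I \<in> S \<Longrightarrow> \<rho> \<le> arc_len I"
    and near: "\<And>I. I \<in> S \<Longrightarrow> cmod (box_centre I - u) \<le> c * \<rho>"
  shows "real (card S) \<le> (8 * c + 1)\<^sup>2"
proof -
  let ?B = "\<lambda>I. ball (box_centre I) (\<rho> / 8)"
  have sub: "?B I \<subseteq> upper_box I" if "I \<in> S" for I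
  proof -
    have "?B I \<subseteq> ball (box_centre I) (arc_len I / 8)" using big[OF that] by (intro subset_ball) auto
    then show ?thesis using ball_subset_upper_box[of I] node_arc S that by blast
  qed
  have disj: "disjoint_family_on ?B S"
    unfolding disjoint_family_on_def
  proof (intro ballI impI)
    fix I J assume "I \<in> S" "J \<in> S" "I \<noteq> J"
    then show "?B I \<inter> ?B J = {}" using sub upper_box_disjoint[of I J] S by blast
  qed
  have "of_nat (card S) * ennreal (pi * (\<rho> / 8)\<^sup>2) = (\<Sum>I\<in>S. emeasure lborel (?B I))"
    using \<rho> by (simp add: emeasure_lborel_complex_ball)
  also have "\<dots> = emeasure lborel (\<Union>I\<in>S. ?B I)"
    by (rule sum_emeasure) (use S disj in auto)
  also have "\<dots> \<le> emeasure lborel (ball u ((c + 1 / 8) * \<rho>))"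
  proof (rule emeasure_mono)
    show "(\<Union>I\<in>S. ?B I) \<subseteq> ball u ((c + 1 / 8) * \<rho>)"
    proof (intro UN_least subsetI)
      fix I z assume I: "I \<in> S" and z: "z \<in> ?B I"
      have "cmod (u - z) \<le> cmod (box_centre I - u) + cmod (box_centre I - z)"
        using norm_triangle_ineq4[of "box_centre I - z" "box_centre I - u"] by simp
      then show "z \<in> ball u ((c + 1 / 8) * \<rho>)"
        using near[OF I] z by (simp add: dist_norm algebra_simps)
    qed
  qed simp
  also have "\<dots> = ennreal (pi * ((c + 1 / 8) * \<rho>)\<^sup>2)"
    using \<rho> by (intro emeasure_lborel_complex_ball) auto
  finally have "ennreal (real (card S) * (pi * (\<rho> / 8)\<^sup>2)) \<le> ennreal (pi * ((c + 1 / 8) * \<rho>)\<^sup>2)"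
    by (simp add: ennreal_mult'' ennreal_of_nat_eq_real_of_nat)
  then have "real (card S) * (pi * (\<rho> / 8)\<^sup>2) \<le> pi * ((c + 1 / 8) * \<rho>)\<^sup>2"
    using \<rho> by (subst (asm) ennreal_le_iff) auto
  also have "pi * ((c + 1 / 8) * \<rho>)\<^sup>2 = (8 * c + 1)\<^sup>2 * (pi * (\<rho> / 8)\<^sup>2)"
    by (simp add: power2_eq_square field_simps)
  finally show ?thesis using \<rho> by (simp add: mult_le_cancel_right)
qed

end

lemma dyadic_systemE:
  assumes "dyadic_system D"
  obtains L where "dyadic_tree L" "D = dyadic_tree.nodes L"
proof -
  obtain L :: "nat \<Rightarrow> complex set set" where D: "D = (\<Union>k. L k)" and L: "L 0 = {unit_circle}"
    "\<forall>k. partition_on unit_circle (L k) \<and> card (L k) = 2 ^ k \<and>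
             (\<forall>I\<in>L k. half_open_arc I \<and> arc_len I = 1 / 2 ^ k) \<and>
             (\<forall>I\<in>L (Suc k). \<exists>J\<in>L k. I \<subseteq> J)"
    using assms unfolding dyadic_system_def by blast
  have "dyadic_tree L" by unfold_locales (use L in auto)
  moreover from this have "D = dyadic_tree.nodes L" by (simp add: D dyadic_tree.nodes_def)
  ultimately show ?thesis using that by blast
qed

text \<open>The arcs with end points at the \<open>2\<^sup>k\<close>-th roots of unity.\<close>

lemma dyadic_system_exists: "\<exists>D. dyadic_system D"
proof -
  define P where "P = (\<lambda>(k::nat) (j::nat). {2 * pi * j / 2 ^ k..<2 * pi * j / 2 ^ k + 2 * pi / 2 ^ k})"
  define L where "L = (\<lambda>k. (\<lambda>j. cis ` P k j) ` {..<2 ^ k})"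
  have P_iff: "x \<in> P k j \<longleftrightarrow> real j \<le> x * 2 ^ k / (2 * pi) \<and> x * 2 ^ k / (2 * pi) < real j + 1" for x k j
    unfolding P_def by (simp add: field_simps)
  have P_range: "0 \<le> x \<and> x < 2 * pi" if "x \<in> P k j" "j < 2 ^ k" for x k j
  proof -
    have "real j + 1 \<le> 2 ^ k" using that(2) by (metis Suc_leI of_nat_Suc of_nat_le_iff of_nat_numeral of_nat_power add.commute)
    then have "x * 2 ^ k / (2 * pi) < 2 ^ k" using that(1) by (auto simp: P_iff)
    then have "x < 2 * pi" by (simp add: field_simps)
    moreover have "0 \<le> 2 * pi * j / 2 ^ k" by simp
    from order.trans[OF this] have "0 \<le> x" using that(1) unfolding P_def by simp
    ultimately show ?thesis by simp
  qed
  have P_ex: "\<exists>j<2 ^ k. x \<in> P k j" if "0 \<le> x" "x < 2 * pi" for x k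
  proof -
    let ?y = "x * 2 ^ k / (2 * pi)"
    have y: "0 \<le> ?y" "?y < 2 ^ k" using that by (auto simp: field_simps)
    define j where "j = nat \<lfloor>?y\<rfloor>"
    have j: "real j \<le> ?y" "?y < real j + 1" using y(1) by (auto simp: j_def)
    then have "real j < 2 ^ k" using y by linarith
    then have "j < 2 ^ k" by (metis of_nat_less_iff of_nat_numeral of_nat_power)
    then show ?thesis using j by (auto simp: P_iff)
  qed
  have P_meet: "i = j" if meet: "cis ` P k i \<inter> cis ` P k j \<noteq> {}" and ij: "i < 2 ^ k" "j < 2 ^ k" for i j k
  proof -
    obtain x y where xy: "x \<in> P k i" "y \<in> P k j" "cis x = cis y" using meet by force
    then obtain n :: int where n: "x = y + 2 * pi * n" using cis_eq_cis_iff by blast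
    have n': "2 * pi * real_of_int n < 2 * pi * 1" "2 * pi * (-1) < 2 * pi * real_of_int n"
      using P_range[OF xy(1) ij(1)] P_range[OF xy(2) ij(2)] n by linarith+
    have "real_of_int n < 1" by (rule mult_left_less_imp_less[OF n'(1)]) simp
    moreover have "-1 < real_of_int n" by (rule mult_left_less_imp_less[OF n'(2)]) simp
    ultimately have "n = 0" by linarith
    then have "x = y" using n by simp
    then show ?thesis using xy(1,2) by (auto simp: P_iff)
  qed
  have P_ne: "2 * pi * j / 2 ^ k \<in> P k j" for k j by (simp add: P_def)
  have inj: "inj_on (\<lambda>j. cis ` P k j) {..<2 ^ k}" for k
    by (rule inj_onI) (metis P_meet P_ne Int_absorb empty_iff image_eqI lessThan_iff)
  have "dyadic_system (\<Union>k. L k)"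
    unfolding dyadic_system_def
  proof (intro exI[of _ L] conjI allI ballI refl)
    have circ: "\<Union> (L k) = unit_circle" for k
    proof
      show "\<Union> (L k) \<subseteq> unit_circle" by (auto simp: L_def)
      show "unit_circle \<subseteq> \<Union> (L k)"
      proof
        fix z :: complex assume "z \<in> unit_circle"
        then have "cmod z = 1" by simp
        then obtain x where x: "0 \<le> x" "x < 2 * pi" "z = cis x"
          using Arg2pi[of z] by (intro that[of "Arg2pi z"]) (auto simp: cis_conv_exp is_Arg_def)
        then show "z \<in> \<Union> (L k)" using P_ex[OF x(1,2), of k] by (auto simp: L_def)
      qed
    qed
    show "L 0 = {unit_circle}" using circ[of 0] by (simp add: L_def lessThan_Suc)
    fix k
    show "partition_on unit_circle (L k)"
    proof (rule partition_onI[OF circ])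
      fix p q assume "p \<in> L k" "q \<in> L k" "p \<noteq> q"
      then show "disjnt p q" unfolding disjnt_def L_def using P_meet by blast
    next
      show "{} \<notin> L k" using P_ne by (auto simp: L_def)
    qed
    show "card (L k) = 2 ^ k" unfolding L_def by (simp add: card_image inj)
    fix I
    show "half_open_arc I" "arc_len I = 1 / 2 ^ k" if I: "I \<in> L k"
    proof -
      obtain j where j: "I = cis ` P k j" using I by (auto simp: L_def)
      have l: "0 < 2 * pi / 2 ^ k" "2 * pi / 2 ^ k \<le> 2 * pi" by (auto simp: field_simps)
      show "half_open_arc I" unfolding half_open_arc_def j P_def using l by blast
      show "arc_len I = 1 / 2 ^ k"
      proof -
        have "arc_len (cis ` P k j) = 2 * pi / 2 ^ k / (2 * pi)"
          by (rule arc_len_cis_image[OF l, of _ "2 * pi * j / 2 ^ k"]) (auto simp: P_def)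
        then show ?thesis by (simp add: j)
      qed
    qed
    show "\<exists>J\<in>L k. I \<subseteq> J" if I: "I \<in> L (Suc k)"
    proof -
      obtain j where j: "I = cis ` P (Suc k) j" "j < 2 ^ Suc k" using I by (auto simp: L_def)
      have "P (Suc k) j \<subseteq> P k (j div 2)"
      proof
        fix x assume "x \<in> P (Suc k) j"
        moreover define y where "y = x * 2 ^ k / (2 * pi)"
        ultimately have "real j \<le> 2 * y" "2 * y < real j + 1" by (auto simp: P_iff mult_ac)
        moreover have "2 * real (j div 2) \<le> real j" "real j + 1 \<le> 2 * real (j div 2) + 2" by linarith+
        ultimately have "real (j div 2) \<le> y" "y < real (j div 2) + 1" by linarith+
        then show "x \<in> P k (j div 2)" unfolding P_iff y_def by simp
      qed
      moreover have "j div 2 < 2 ^ k" using j(2) by auto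
      ultimately show ?thesis unfolding L_def j(1) by blast
    qed
  qed
  then show ?thesis by blast
qed

section \<open>Covering--packing duality for laminar families\<close>

text \<open>Greedy packing: members are served in the order of decreasing \<open>h\<close>, each receiving all the mass that the
  capacities of its supersets still admit. When \<open>I\<close> is served, some superset becomes tight, and from then on all mass
  inside it sits on members with at least the value \<open>h I\<close>.\<close>

lemma greedy_packing:
  fixes c h :: "'a set \<Rightarrow> real"
  assumes S: "finite S" and T: "T \<subseteq> S" and c: "\<forall>J\<in>S. 0 \<le> c J"
  shows "\<exists>\<mu>. (\<forall>I. 0 \<le> \<mu> I) \<and> (\<forall>J\<in>S. (\<Sum>I | I \<in> T \<and> I \<subseteq> J. \<mu> I) \<le> c J) \<and>
    (\<forall>I\<in>T. \<exists>J\<in>S. I \<subseteq> J \<and> (\<Sum>K | K \<in> T \<and> K \<subseteq> J. \<mu> K) = c J \<and>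
              (\<forall>K\<in>T. K \<subseteq> J \<longrightarrow> 0 < \<mu> K \<longrightarrow> h I \<le> h K))"
proof -
  have "finite T" using S T finite_subset by blast
  then show ?thesis using T
  proof (induction T rule: finite_ranking_induct[where f = "\<lambda>I. - h I"])
    case empty
    then show ?case by (intro exI[of _ "\<lambda>_. 0"]) (use c in auto)
  next
    case (insert x T)
    show ?case
    proof (cases "x \<in> T")
      case True
      then show ?thesis using insert.IH insert.prems by (simp add: insert_absorb)
    next
      case False
      have xS: "x \<in> S" and TS: "T \<subseteq> S" using insert.prems by auto
      obtain \<mu> where \<mu>: "\<forall>I. 0 \<le> \<mu> I"
        "\<forall>J\<in>S. (\<Sum>I | I \<in> T \<and> I \<subseteq> J. \<mu> I) \<le> c J"
        "\<forall>I\<in>T. \<exists>J\<in>S. I \<subseteq> J \<and> (\<Sum>K | K \<in> T \<and> K \<subseteq> J. \<mu> K) = c J \<and>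
              (\<forall>K\<in>T. K \<subseteq> J \<longrightarrow> 0 < \<mu> K \<longrightarrow> h I \<le> h K)"
        using insert.IH[OF TS] by (elim exE conjE) (rule that)
      note \<mu>0 = \<mu>(1)[rule_format] and \<mu>c = \<mu>(2)[rule_format] and \<mu>t = \<mu>(3)[THEN bspec]
      define G where "G = (\<lambda>J. c J - (\<Sum>I | I \<in> T \<and> I \<subseteq> J. \<mu> I)) ` {J \<in> S. x \<subseteq> J}"
      define \<delta> where "\<delta> = Min G"
      have G: "finite G" "G \<noteq> {}" using S xS by (auto simp: G_def)
      have \<delta>0: "0 \<le> \<delta>" unfolding \<delta>_def using G \<mu>c by (subst Min_ge_iff) (auto simp: G_def)
      have \<delta>_le: "\<delta> \<le> c J - (\<Sum>I | I \<in> T \<and> I \<subseteq> J. \<mu> I)" if "J \<in> S" "x \<subseteq> J" for J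
        unfolding \<delta>_def using G that by (intro Min_le) (auto simp: G_def)
      have "\<delta> \<in> G" unfolding \<delta>_def using G by (rule Min_in)
      then obtain J0 where J0: "J0 \<in> S" "x \<subseteq> J0" "\<delta> = c J0 - (\<Sum>I | I \<in> T \<and> I \<subseteq> J0. \<mu> I)"
        by (auto simp: G_def)
      define \<nu> where "\<nu> = \<mu>(x := \<delta>)"
      have \<nu>T: "\<nu> I = \<mu> I" if "I \<in> T" for I using that False by (auto simp: \<nu>_def)
      have sum_\<nu>: "(\<Sum>I | I \<in> insert x T \<and> I \<subseteq> J. \<nu> I)
          = (if x \<subseteq> J then \<delta> else 0) + (\<Sum>I | I \<in> T \<and> I \<subseteq> J. \<mu> I)" for J
      proof -
        have fin: "finite {I \<in> T. I \<subseteq> J}" using insert.hyps(1) by simp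
        have eq: "(\<Sum>I | I \<in> T \<and> I \<subseteq> J. \<nu> I) = (\<Sum>I | I \<in> T \<and> I \<subseteq> J. \<mu> I)"
          by (rule sum.cong) (auto simp: \<nu>T)
        show ?thesis
        proof (cases "x \<subseteq> J")
          case True
          then have "{I. I \<in> insert x T \<and> I \<subseteq> J} = insert x {I \<in> T. I \<subseteq> J}" by auto
          then show ?thesis using fin False True eq by (simp add: \<nu>_def)
        next
          case x: False
          then have "{I. I \<in> insert x T \<and> I \<subseteq> J} = {I \<in> T. I \<subseteq> J}" by auto
          then show ?thesis using x eq by simp
        qed
      qed
      show ?thesis
      proof (intro exI[of _ \<nu>] conjI ballI allI)
        show "0 \<le> \<nu> I" for I using \<mu>0 \<delta>0 by (simp add: \<nu>_def)
        show "(\<Sum>I | I \<in> insert x T \<and> I \<subseteq> J. \<nu> I) \<le> c J" if "J \<in> S" for J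
          using \<mu>c[OF that] \<delta>_le[OF that] unfolding sum_\<nu> by auto
        fix I assume "I \<in> insert x T"
        then consider "I = x" | "I \<in> T" by auto
        then show "\<exists>J\<in>S. I \<subseteq> J \<and> (\<Sum>K | K \<in> insert x T \<and> K \<subseteq> J. \<nu> K) = c J \<and>
              (\<forall>K\<in>insert x T. K \<subseteq> J \<longrightarrow> 0 < \<nu> K \<longrightarrow> h I \<le> h K)"
        proof cases
          case 1
          show ?thesis unfolding 1
          proof (intro bexI[OF _ J0(1)] conjI)
            show "\<forall>K\<in>insert x T. K \<subseteq> J0 \<longrightarrow> 0 < \<nu> K \<longrightarrow> h x \<le> h K"
              using insert.hyps(2) by auto
            show "(\<Sum>K | K \<in> insert x T \<and> K \<subseteq> J0. \<nu> K) = c J0"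
              unfolding sum_\<nu> using J0 by simp
          qed (use J0 in auto)
        next
          case 2
          obtain J where J: "J \<in> S" "I \<subseteq> J" "(\<Sum>K | K \<in> T \<and> K \<subseteq> J. \<mu> K) = c J"
            "\<And>K. K \<in> T \<Longrightarrow> K \<subseteq> J \<Longrightarrow> 0 < \<mu> K \<Longrightarrow> h I \<le> h K" using \<mu>t[OF 2] by blast
          have \<delta>J: "\<delta> = 0" if "x \<subseteq> J" using \<delta>_le[OF J(1) that] J(3) \<delta>0 by simp
          show ?thesis
          proof (intro bexI[OF _ J(1)] conjI ballI impI)
            show "(\<Sum>K | K \<in> insert x T \<and> K \<subseteq> J. \<nu> K) = c J"
              unfolding sum_\<nu> using J(3) \<delta>J by simp
            fix K assume K: "K \<in> insert x T" "K \<subseteq> J" "0 < \<nu> K"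
            then have "K \<noteq> x" using \<delta>J by (auto simp: \<nu>_def)
            then show "h I \<le> h K" using K J(4) \<nu>T by auto
          qed (use J in auto)
        qed
      qed
    qed
  qed
qed

text \<open>The covering weights are read off from the greedy packing. For tight \<open>J\<close> let \<open>m J\<close> be the smallest value of \<open>h\<close>
  that carries mass inside \<open>J\<close>, and let \<open>v I\<close> be the largest \<open>m J\<close> over the tight supersets of \<open>I\<close>. Then \<open>v\<close> is at least
  \<open>h\<close> everywhere and at most \<open>h\<close> where there is mass. Its increments along chains are covering weights that
  live on tight sets, so their cost equals the integral of \<open>v\<close> against the packing.\<close>

lemma laminar_covering_packing:
  fixes c h :: "'a set \<Rightarrow> real"
  assumes S: "finite S" and c: "\<And>J. J \<in> S \<Longrightarrow> 0 < c J"
    and chain: "\<And>I J K. I \<in> S \<Longrightarrow> J \<in> S \<Longrightarrow> K \<in> S \<Longrightarrow> I \<subseteq> J \<Longrightarrow> I \<subseteq> K \<Longrightarrow> J \<subseteq> K \<or> K \<subseteq> J"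
    and h: "\<And>I. I \<in> S \<Longrightarrow> 0 \<le> h I"
    and packing: "\<And>\<mu>. (\<And>I. 0 \<le> \<mu> I) \<Longrightarrow> (\<And>J. J \<in> S \<Longrightarrow> (\<Sum>I | I \<in> S \<and> I \<subseteq> J. \<mu> I) \<le> c J)
        \<Longrightarrow> (\<Sum>I\<in>S. h I * \<mu> I) \<le> B"
  shows "\<exists>lam. (\<forall>J\<in>S. 0 \<le> lam J) \<and> (\<forall>I\<in>S. h I \<le> (\<Sum>J | J \<in> S \<and> I \<subseteq> J. lam J)) \<and>
    (\<Sum>J\<in>S. lam J * c J) \<le> B"
proof -
  have c0: "\<forall>J\<in>S. 0 \<le> c J" using c by (simp add: less_imp_le)
  obtain \<mu> where \<mu>: "\<forall>I. 0 \<le> \<mu> I"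
    "\<forall>J\<in>S. (\<Sum>I | I \<in> S \<and> I \<subseteq> J. \<mu> I) \<le> c J"
    "\<forall>I\<in>S. \<exists>J\<in>S. I \<subseteq> J \<and> (\<Sum>K | K \<in> S \<and> K \<subseteq> J. \<mu> K) = c J \<and>
          (\<forall>K\<in>S. K \<subseteq> J \<longrightarrow> 0 < \<mu> K \<longrightarrow> h I \<le> h K)"
    using greedy_packing[OF S order_refl, where c = c and h = h, OF c0] by (elim exE conjE) (rule that)
  note \<mu>0 = \<mu>(1)[rule_format] and \<mu>c = \<mu>(2)[rule_format] and \<mu>t = \<mu>(3)[THEN bspec]
  define mass where "mass J = (\<Sum>I | I \<in> S \<and> I \<subseteq> J. \<mu> I)" for J
  define tight where "tight J \<longleftrightarrow> J \<in> S \<and> mass J = c J" for J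
  define supp where "supp J = {I \<in> S. I \<subseteq> J \<and> 0 < \<mu> I}" for J
  define m where "m J = Min (h ` supp J)" for J
  define v where "v I = Max (insert 0 (m ` {J. tight J \<and> I \<subseteq> J}))" for I
  define v' where "v' I = Max (insert 0 (m ` {J. tight J \<and> I \<subset> J}))" for I
  define lam where "lam J = v J - v' J" for J
  have fin_supp: "finite (supp J)" for J using S by (simp add: supp_def)
  have fin_tight: "finite {J. tight J \<and> Q J}" for Q
    by (rule finite_subset[OF _ S]) (auto simp: tight_def)
  have supp_ne: "supp J \<noteq> {}" if "tight J" for J
  proof
    assume "supp J = {}"
    then have "mass J = 0" unfolding mass_def
      using \<mu>0 by (intro sum.neutral) (force simp: supp_def less_le)
    then show False using that c[of J] by (auto simp: tight_def)
  qed
  have lam0: "0 \<le> lam J" for J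
  proof -
    have "v' J \<le> v J" unfolding v_def v'_def
      by (rule Max_mono) (use fin_tight in auto)
    then show ?thesis by (simp add: lam_def)
  qed
  have lam_tight: "lam J = 0" if "\<not> tight J" for J
  proof -
    have "{K. tight K \<and> J \<subseteq> K} = {K. tight K \<and> J \<subset> K}" using that by auto
    then show ?thesis by (simp add: lam_def v_def v'_def)
  qed
  have path: "(\<Sum>J | J \<in> S \<and> I \<subseteq> J. lam J) = v I" if "I \<in> S" for I
    using that
  proof (induction "card {J \<in> S. I \<subseteq> J}" arbitrary: I rule: less_induct)
    case less
    let ?U = "{J \<in> S. I \<subset> J}"
    have fin: "finite ?U" using S by simp
    have ins: "{J \<in> S. I \<subseteq> J} = insert I ?U" using less.prems by auto
    have split: "(\<Sum>J | J \<in> S \<and> I \<subseteq> J. lam J) = lam I + (\<Sum>J\<in>?U. lam J)"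
      unfolding ins using fin by simp
    show ?case
    proof (cases "?U = {}")
      case True
      then have "{J. tight J \<and> I \<subset> J} = {}" by (auto simp: tight_def)
      then have "v' I = 0" by (simp only: v'_def image_empty Max_singleton)
      then show ?thesis unfolding split True by (simp add: lam_def)
    next
      case False
      obtain P where P: "P \<in> ?U" and min: "\<And>J. J \<in> ?U \<Longrightarrow> J \<subseteq> P \<Longrightarrow> P = J"
        using finite_has_minimal[OF fin False] by blast
      have U: "?U = {J \<in> S. P \<subseteq> J}"
      proof
        show "?U \<subseteq> {J \<in> S. P \<subseteq> J}"
        proof
          fix J assume J: "J \<in> ?U"
          then have "J \<subseteq> P \<or> P \<subseteq> J" using chain[OF less.prems, of J P] P by auto
          then show "J \<in> {J \<in> S. P \<subseteq> J}" using J min[OF J] by auto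
        qed
        show "{J \<in> S. P \<subseteq> J} \<subseteq> ?U" using P by auto
      qed
      have "{J \<in> S. P \<subseteq> J} \<subset> {J \<in> S. I \<subseteq> J}" unfolding ins U[symmetric] using less.prems by auto
      then have "card {J \<in> S. P \<subseteq> J} < card {J \<in> S. I \<subseteq> J}" using S by (intro psubset_card_mono) auto
      then have IH: "(\<Sum>J | J \<in> S \<and> P \<subseteq> J. lam J) = v P" using less.hyps P by auto
      have "{J. tight J \<and> I \<subset> J} = {J. tight J \<and> P \<subseteq> J}"
        using U by (auto simp: tight_def set_eq_iff)
      then have "v' I = v P" by (simp only: v'_def v_def)
      then show ?thesis unfolding split U IH by (simp add: lam_def)
    qed
  qed
  have v_ge: "h I \<le> v I" if I: "I \<in> S" for I
  proof -
    obtain J where J: "J \<in> S" "I \<subseteq> J" "mass J = c J" "\<And>K. K \<in> S \<Longrightarrow> K \<subseteq> J \<Longrightarrow> 0 < \<mu> K \<Longrightarrow> h I \<le> h K"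
      using \<mu>t[OF I] unfolding mass_def by blast
    have "tight J" using J by (simp add: tight_def)
    have "h I \<le> m J" unfolding m_def
      using J(4) supp_ne[OF \<open>tight J\<close>] fin_supp[of J] by (subst Min_ge_iff) (auto simp: supp_def)
    also have "m J \<le> v I" unfolding v_def
      using \<open>tight J\<close> J(2) fin_tight by (intro Max_ge) auto
    finally show ?thesis .
  qed
  have v_le: "v I \<le> h I" if I: "I \<in> S" "0 < \<mu> I" for I
  proof -
    have "m J \<le> h I" if "I \<subseteq> J" for J
      unfolding m_def using I that fin_supp[of J] by (intro Min_le) (auto simp: supp_def)
    then show ?thesis unfolding v_def using fin_tight h[OF I(1)] by (subst Max_le_iff) auto
  qed
  have "(\<Sum>J\<in>S. lam J * c J) = (\<Sum>J\<in>S. \<Sum>I | I \<in> S \<and> I \<subseteq> J. lam J * \<mu> I)"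
  proof (rule sum.cong[OF refl])
    fix J assume "J \<in> S"
    then have "lam J * c J = lam J * mass J" using lam_tight[of J] by (cases "tight J") (auto simp: tight_def)
    then show "lam J * c J = (\<Sum>I | I \<in> S \<and> I \<subseteq> J. lam J * \<mu> I)" by (simp add: mass_def sum_distrib_left)
  qed
  also have "\<dots> = (\<Sum>I\<in>S. \<Sum>J | J \<in> S \<and> I \<subseteq> J. lam J * \<mu> I)"
    by (rule sum.swap_restrict[OF S S])
  also have "\<dots> = (\<Sum>I\<in>S. v I * \<mu> I)"
    by (rule sum.cong[OF refl]) (simp add: path flip: sum_distrib_right)
  also have "\<dots> \<le> (\<Sum>I\<in>S. h I * \<mu> I)"
  proof (rule sum_mono)
    fix I assume "I \<in> S"
    then show "v I * \<mu> I \<le> h I * \<mu> I" using v_le[of I] \<mu>0[of I] by (cases "0 < \<mu> I") (auto simp: less_le)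
  qed
  also have "\<dots> \<le> B" using packing[OF \<mu>0 \<mu>c] by blast
  finally have cost: "(\<Sum>J\<in>S. lam J * c J) \<le> B" .
  show ?thesis
    by (intro exI[of _ lam] conjI) (use lam0 path v_ge cost in auto)
qed

context dyadic_tree
begin

abbreviation levels :: "nat \<Rightarrow> complex set set" where
  "levels N \<equiv> (\<Union>k\<le>N. L k)"

text \<open>A diagonal limit of optimal coverings of the finite trees covers the whole tree: only finitely many nodes contain a
  given node, and the cost is lower semicontinuous.\<close>

lemma dyadic_gauge_le:
  assumes \<eta>: "\<And>I. I \<in> nodes \<Longrightarrow> h I = ennreal (\<eta> I)" "\<And>I. I \<in> nodes \<Longrightarrow> 0 \<le> \<eta> I"
    and packing: "\<And>N \<mu>. (\<And>I. 0 \<le> \<mu> I) \<Longrightarrow>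
        (\<And>J. J \<in> levels N \<Longrightarrow> (\<Sum>I | I \<in> levels N \<and> I \<subseteq> J. \<mu> I) \<le> arc_len J powr p) \<Longrightarrow>
        (\<Sum>I\<in>levels N. \<eta> I * \<mu> I) \<le> B"
  shows "dyadic_gauge p nodes h \<le> ennreal B"
proof -
  have lev: "finite (levels N)" "levels N \<subseteq> nodes" for N
    using finite_level by (auto simp: nodes_def)
  let ?c = "\<lambda>J. arc_len J powr p"
  have cpos: "0 < ?c J" if "J \<in> nodes" for J
    using half_open_arcE(1)[OF node_arc[OF that]] by simp
  have chain: "J \<subseteq> K \<or> K \<subseteq> J" if "I \<in> nodes" "J \<in> nodes" "K \<in> nodes" "I \<subseteq> J" "I \<subseteq> K" for I J K
    using nodes_nested[OF that(2,3)] node_nonempty[OF that(1)] that(4,5) by blast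
  have "\<exists>lam. (\<forall>J\<in>levels N. 0 \<le> lam J) \<and> (\<forall>I\<in>levels N. \<eta> I \<le> (\<Sum>J | J \<in> levels N \<and> I \<subseteq> J. lam J)) \<and>
    (\<Sum>J\<in>levels N. lam J * ?c J) \<le> B" for N
  proof (rule laminar_covering_packing[OF lev(1)])
    show "J \<subseteq> K \<or> K \<subseteq> J" if "I \<in> levels N" "J \<in> levels N" "K \<in> levels N" "I \<subseteq> J" "I \<subseteq> K" for I J K
      using chain[of I J K] that lev(2)[of N] by blast
    show "(\<Sum>I\<in>levels N. \<eta> I * \<mu> I) \<le> B"
      if "\<And>I. 0 \<le> \<mu> I" "\<And>J. J \<in> levels N \<Longrightarrow> (\<Sum>I | I \<in> levels N \<and> I \<subseteq> J. \<mu> I) \<le> ?c J" for \<mu>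
      by (rule packing[OF that])
  qed (use cpos \<eta>(2) lev(2)[of N] in blast)+
  then have "\<forall>N. \<exists>lam. (\<forall>J\<in>levels N. 0 \<le> lam J) \<and> (\<forall>I\<in>levels N. \<eta> I \<le> (\<Sum>J | J \<in> levels N \<and> I \<subseteq> J. lam J)) \<and>
    (\<Sum>J\<in>levels N. lam J * ?c J) \<le> B" by (rule allI)
  from choice[OF this] obtain lam where lam: "\<forall>N. (\<forall>J\<in>levels N. 0 \<le> lam N J) \<and>
    (\<forall>I\<in>levels N. \<eta> I \<le> (\<Sum>J | J \<in> levels N \<and> I \<subseteq> J. lam N J)) \<and>
    (\<Sum>J\<in>levels N. lam N J * ?c J) \<le> B" by (rule exE)
  note lam0 = lam[THEN spec, THEN conjunct1, THEN bspec]
    and lam_path = lam[THEN spec, THEN conjunct2, THEN conjunct1, THEN bspec]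
    and lam_cost = lam[THEN spec, THEN conjunct2, THEN conjunct2]
  define f where "f N J = (if J \<in> levels N then lam N J * ?c J else 0)" for N J
  have f0: "0 \<le> f N J" for N J using lam0 by (simp add: f_def)
  have f_sum: "(\<Sum>J\<in>F. f N J) \<le> B" if "finite F" for N F
  proof -
    have "(\<Sum>J\<in>F. f N J) = (\<Sum>J\<in>F \<inter> levels N. f N J)"
      using that by (intro sum.mono_neutral_right) (auto simp: f_def)
    also have "\<dots> \<le> (\<Sum>J\<in>levels N. f N J)"
      using lev f0 by (intro sum_mono2) auto
    also have "\<dots> = (\<Sum>J\<in>levels N. lam N J * ?c J)" by (rule sum.cong) (auto simp: f_def)
    also note lam_cost
    finally show ?thesis .
  qed
  have "norm (f N J) \<le> B" for N J using f_sum[of "{J}" N] f0[of N J] by simp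
  then obtain k :: "nat \<Rightarrow> nat" where k: "strict_mono k" "\<And>J. J \<in> nodes \<Longrightarrow> \<exists>l. (\<lambda>n. f (k n) J) \<longlonglongrightarrow> l"
    using function_convergent_subsequence[OF countable_nodes, of f B] by blast
  then obtain l where l: "\<And>J. J \<in> nodes \<Longrightarrow> (\<lambda>n. f (k n) J) \<longlonglongrightarrow> l J" by metis
  define \<Lambda> where "\<Lambda> J = l J / ?c J" for J
  have l0: "0 \<le> l J" if "J \<in> nodes" for J
    by (rule tendsto_lowerbound[OF l[OF that]]) (use f0 in auto)
  have \<Lambda>0: "0 \<le> \<Lambda> J" if "J \<in> nodes" for J using l0[OF that] by (simp add: \<Lambda>_def)
  have path: "h I \<le> (\<Sum>\<^sub>\<infinity>J\<in>{J\<in>nodes. I \<subseteq> J}. ennreal (\<Lambda> J))" if I: "I \<in> nodes" for I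
  proof -
    let ?A = "{J \<in> nodes. I \<subseteq> J}"
    obtain m where m: "I \<in> L m" using I by (auto simp: nodes_def)
    have A_sub: "?A \<subseteq> levels m" using superset_level[OF m] by blast
    have finA: "finite ?A" by (rule finite_subset[OF A_sub lev(1)])
    have "(\<lambda>n. \<Sum>J\<in>?A. f (k n) J / ?c J) \<longlonglongrightarrow> (\<Sum>J\<in>?A. \<Lambda> J)"
      unfolding \<Lambda>_def using cpos by (intro tendsto_sum tendsto_divide tendsto_const l) (auto simp: less_imp_neq[THEN not_sym])
    moreover have "\<eta> I \<le> (\<Sum>J\<in>?A. f (k n) J / ?c J)" if n: "m \<le> n" for n
    proof -
      have kn: "m \<le> k n" using n seq_suble[OF k(1), of n] by simp
      have sub: "levels m \<subseteq> levels (k n)" using kn by force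
      have A_eq: "{J. J \<in> levels (k n) \<and> I \<subseteq> J} = ?A"
        using A_sub sub lev(2)[of "k n"] by blast
      have "\<eta> I \<le> (\<Sum>J | J \<in> levels (k n) \<and> I \<subseteq> J. lam (k n) J)"
        using m sub by (intro lam_path) auto
      also have "\<dots> = (\<Sum>J\<in>?A. f (k n) J / ?c J)"
        unfolding A_eq
      proof (rule sum.cong[OF refl])
        fix J assume J: "J \<in> ?A"
        then have "J \<in> levels (k n)" using A_sub sub by blast
        then have "f (k n) J = lam (k n) J * ?c J" unfolding f_def by (rule if_P)
        moreover have "0 < ?c J" using cpos J by blast
        ultimately show "lam (k n) J = f (k n) J / ?c J" by (metis nonzero_mult_div_cancel_right less_irrefl)
      qed
      finally show ?thesis .
    qed
    ultimately have "\<eta> I \<le> (\<Sum>J\<in>?A. \<Lambda> J)"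
      by (intro tendsto_lowerbound[of _ _ sequentially]) (auto simp: eventually_sequentially)
    then have "h I \<le> ennreal (\<Sum>J\<in>?A. \<Lambda> J)" using \<eta>(1)[OF I] ennreal_leI by simp
    also have "\<dots> = (\<Sum>J\<in>?A. ennreal (\<Lambda> J))" using \<Lambda>0 by (subst sum_ennreal) auto
    also have "\<dots> = (\<Sum>\<^sub>\<infinity>J\<in>?A. ennreal (\<Lambda> J))" using finA by simp
    finally show ?thesis .
  qed
  have cost: "(\<Sum>\<^sub>\<infinity>J\<in>nodes. ennreal (\<Lambda> J * ?c J)) \<le> ennreal B"
  proof (rule infsum_le_finite_sums)
    fix F assume F: "finite F" "F \<subseteq> nodes"
    have "(\<Sum>J\<in>F. ennreal (\<Lambda> J * ?c J)) = (\<Sum>J\<in>F. ennreal (l J))"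
    proof (rule sum.cong[OF refl])
      fix J assume "J \<in> F"
      then have "0 < ?c J" using cpos F by blast
      then show "ennreal (\<Lambda> J * ?c J) = ennreal (l J)" unfolding \<Lambda>_def by (metis nonzero_eq_divide_eq less_irrefl)
    qed
    also have "\<dots> = ennreal (\<Sum>J\<in>F. l J)" using l0 F by (intro sum_ennreal) auto
    also have "\<dots> \<le> ennreal B"
    proof (rule ennreal_leI, rule tendsto_upperbound)
      show "(\<lambda>n. \<Sum>J\<in>F. f (k n) J) \<longlonglongrightarrow> (\<Sum>J\<in>F. l J)" using F by (intro tendsto_sum l) auto
    qed (use f_sum F in auto)
    finally show "(\<Sum>J\<in>F. ennreal (\<Lambda> J * ?c J)) \<le> ennreal B" .
  qed (rule nonneg_summable_on_complete, simp)
  have "dyadic_gauge p nodes h \<le> (\<Sum>\<^sub>\<infinity>J\<in>nodes. ennreal (\<Lambda> J * ?c J))"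
    unfolding dyadic_gauge_def
    by (rule Inf_lower) (use \<Lambda>0 path in blast)
  also note cost
  finally show ?thesis .
qed

end

section \<open>Coverings control the embedding\<close>

lemma nn_integral_Qp_le_seminorm:
  "a \<in> unit_disc \<Longrightarrow>
    (\<integral>\<^sup>+z. ennreal ((cmod (deriv f z))\<^sup>2 * green z a powr p) \<partial>disc_area) \<le> Qp_seminorm_sq p f"
  unfolding Qp_seminorm_sq_def by (rule SUP_upper)

lemma deriv_sq_measurable:
  assumes "F holomorphic_on unit_disc"
  shows "(\<lambda>z. ennreal ((cmod (deriv F z))\<^sup>2)) \<in> borel_measurable disc_area"
proof -
  have "deriv F holomorphic_on unit_disc" by (rule holomorphic_deriv[OF assms]) simp
  then have "(\<lambda>z. (cmod (deriv F z))\<^sup>2) \<in> borel_measurable disc_area"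
    by (intro continuous_on_borel_measurable_disc_area continuous_intros holomorphic_on_imp_continuous_on)
  then show ?thesis by (rule measurable_compose[OF _ measurable_ennreal])
qed

lemma cmod_one_minus_le:
  assumes "half_open_arc J" "cmod (u - box_centre J) \<le> c * arc_len J"
  shows "cmod (1 - cnj (box_centre J) * u) \<le> (3 / 2 + c) * arc_len J"
proof -
  let ?a = "box_centre J"
  note J = half_open_arcE(1,2)[OF assms(1)]
  have a: "cmod ?a = 1 - 3 / 4 * arc_len J" by (rule cmod_box_centre[OF assms(1)])
  have "1 - cnj ?a * u = of_real (1 - (cmod ?a)\<^sup>2) - cnj ?a * (u - ?a)"
    unfolding of_real_diff complex_norm_square by (simp add: algebra_simps)
  then have "cmod (1 - cnj ?a * u) \<le> cmod (of_real (1 - (cmod ?a)\<^sup>2)) + cmod (cnj ?a * (u - ?a))"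
    by (metis norm_triangle_ineq4)
  also have "cmod (of_real (1 - (cmod ?a)\<^sup>2)) = 1 - (cmod ?a)\<^sup>2"
    unfolding norm_of_real using a J by (simp add: power_le_one)
  also have "\<dots> \<le> 3 / 2 * arc_len J"
    unfolding a by (simp add: power2_eq_square algebra_simps)
  also have "cmod (cnj ?a * (u - ?a)) \<le> 1 * (c * arc_len J)"
    unfolding norm_mult using assms(2) a J by (intro mult_mono) auto
  finally show ?thesis by (simp add: algebra_simps)
qed

text \<open>The Carleson estimate behind the \<open>Q\<^sub>p\<close> seminorm: near the box centre \<open>a\<close> of \<open>J\<close> the Green function with pole \<open>a\<close>
  dominates a constant multiple of \<open>(1 - |u|) / |J|\<close>.\<close>

lemma carleson_le_seminorm:
  assumes J: "half_open_arc J" and p: "0 < p" and F: "F holomorphic_on unit_disc"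
  shows "(\<integral>\<^sup>+u. ennreal ((cmod (deriv F u))\<^sup>2) * ennreal ((1 - cmod u) powr p)
              * indicator (cball (box_centre J) (9 * arc_len J)) u \<partial>disc_area)
    \<le> ennreal (294 powr p * arc_len J powr p) * Qp_seminorm_sq p F"
proof -
  let ?a = "box_centre J" and ?s = "arc_len J"
  note s = half_open_arcE(1,2)[OF J]
  have a: "?a \<in> unit_disc" by (rule box_centre_in_disc[OF J])
  have cmod_a: "cmod ?a = 1 - 3 / 4 * ?s" by (rule cmod_box_centre[OF J])
  have pw: "ennreal ((cmod (deriv F u))\<^sup>2) * ennreal ((1 - cmod u) powr p) * indicator (cball ?a (9 * ?s)) u
      \<le> ennreal (294 powr p * ?s powr p) * ennreal ((cmod (deriv F u))\<^sup>2 * green u ?a powr p)"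
    if u: "u \<in> unit_disc" "u \<noteq> ?a" for u
  proof (cases "u \<in> cball ?a (9 * ?s)")
    case True
    then have "cmod (u - ?a) \<le> 9 * ?s" by (simp add: dist_norm norm_minus_commute)
    from cmod_one_minus_le[OF J this] have d: "cmod (1 - cnj ?a * u) \<le> 10.5 * ?s" by simp
    have d0: "0 < cmod (1 - cnj ?a * u)" by (rule cmod_one_minus_bounds(4)[OF a u(1)])
    have sq: "1 - t \<le> 1 - t\<^sup>2" if "0 \<le> t" "t \<le> 1" for t :: real
      using that by (simp add: power2_eq_square mult_left_le)
    have "1 - cmod ?a \<le> 1 - (cmod ?a)\<^sup>2" "1 - cmod u \<le> 1 - (cmod u)\<^sup>2"
      using a u by (intro sq; simp)+
    then have "(3 / 4 * ?s) * (1 - cmod u) \<le> (1 - (cmod ?a)\<^sup>2) * (1 - (cmod u)\<^sup>2)"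
      using s u cmod_a by (intro mult_mono) auto
    then have "(3 / 4 * ?s) * (1 - cmod u) / (10.5 * ?s)\<^sup>2 \<le> (1 - (cmod ?a)\<^sup>2) * (1 - (cmod u)\<^sup>2) / (cmod (1 - cnj ?a * u))\<^sup>2"
      using d d0 s u a by (intro frac_le mult_nonneg_nonneg power_mono) (auto simp: power_le_one)
    also have "\<dots> \<le> 2 * green u ?a" by (rule green_lower[OF a u])
    also have "(3 / 4 * ?s) * (1 - cmod u) / (10.5 * ?s)\<^sup>2 = (1 - cmod u) / (147 * ?s)"
      using s by (simp add: power2_eq_square frac_eq_eq)
    finally have "1 - cmod u \<le> 2 * green u ?a * (147 * ?s)"
      using s by (subst (asm) pos_divide_le_eq) auto
    then have "1 - cmod u \<le> 294 * ?s * green u ?a" by (simp add: mult_ac)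
    then have "(1 - cmod u) powr p \<le> (294 * ?s * green u ?a) powr p"
      using u p by (intro powr_mono2) auto
    also have "\<dots> = 294 powr p * ?s powr p * green u ?a powr p"
      using s green_upper(1)[OF a u(1)] by (simp add: powr_mult)
    finally have "(cmod (deriv F u))\<^sup>2 * (1 - cmod u) powr p
      \<le> (cmod (deriv F u))\<^sup>2 * (294 powr p * ?s powr p * green u ?a powr p)"
      by (rule mult_left_mono) simp
    then have "ennreal ((cmod (deriv F u))\<^sup>2 * (1 - cmod u) powr p)
      \<le> ennreal ((294 powr p * ?s powr p) * ((cmod (deriv F u))\<^sup>2 * green u ?a powr p))"
      by (intro ennreal_leI) (simp add: mult_ac)
    then show ?thesis using True by (simp add: ennreal_mult')
  qed simp
  have gm: "(\<lambda>u. ennreal ((cmod (deriv F u))\<^sup>2 * green u ?a powr p)) \<in> borel_measurable disc_area"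
  proof -
    have "(\<lambda>u. green u ?a powr p) \<in> borel_measurable borel"
      unfolding green_def disc_automorphism_def by measurable
    from measurable_compose[OF borel_measurable_disc_area[OF this] measurable_ennreal]
    have "(\<lambda>u. ennreal (green u ?a powr p)) \<in> borel_measurable disc_area" .
    with deriv_sq_measurable[OF F]
    have "(\<lambda>u. ennreal ((cmod (deriv F u))\<^sup>2) * ennreal (green u ?a powr p)) \<in> borel_measurable disc_area"
      by (rule borel_measurable_times_ennreal)
    then show ?thesis by (simp add: ennreal_mult')
  qed
  have "(\<integral>\<^sup>+u. ennreal ((cmod (deriv F u))\<^sup>2) * ennreal ((1 - cmod u) powr p) * indicator (cball ?a (9 * ?s)) u \<partial>disc_area)
    \<le> (\<integral>\<^sup>+u. ennreal (294 powr p * ?s powr p) * ennreal ((cmod (deriv F u))\<^sup>2 * green u ?a powr p) \<partial>disc_area)"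
  proof (rule nn_integral_mono_AE)
    show "AE u in disc_area. ennreal ((cmod (deriv F u))\<^sup>2) * ennreal ((1 - cmod u) powr p) * indicator (cball ?a (9 * ?s)) u
      \<le> ennreal (294 powr p * ?s powr p) * ennreal ((cmod (deriv F u))\<^sup>2 * green u ?a powr p)"
      using AE_disc_area_neq[of ?a] AE_space by eventually_elim (rule pw, simp_all)
  qed
  also have "\<dots> = ennreal (294 powr p * ?s powr p) * (\<integral>\<^sup>+u. ennreal ((cmod (deriv F u))\<^sup>2 * green u ?a powr p) \<partial>disc_area)"
    by (rule nn_integral_cmult[OF gm])
  also have "\<dots> \<le> ennreal (294 powr p * ?s powr p) * Qp_seminorm_sq p F"
    by (intro mult_left_mono nn_integral_Qp_le_seminorm a) auto
  finally show ?thesis .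
qed

text \<open>A set comparable to the upper box that contains the balls of radius \<open>|I|/4\<close> about all its points: \<open>4 |I| + |I|/4 \<le> 5 |I|\<close>.\<close>

definition fat_box :: "complex set \<Rightarrow> complex set" where
  "fat_box I = {u. arc_len I / 4 \<le> 1 - cmod u} \<inter> cball (box_centre I) (5 * arc_len I)"

lemma borel_fat_box: "fat_box I \<in> sets borel"
  unfolding fat_box_def by (intro sets.Int borel_closed closed_Collect_le continuous_intros) auto

text \<open>The mean value inequality replaces \<open>|F'|\<^sup>2\<close> on the box by a constant. The weight then enters through its mass on the
  box alone, and \<open>1 - |u|\<close> is comparable to \<open>|I|\<close> where the average is taken.\<close>

lemma box_integral_le:
  assumes I: "half_open_arc I" and p: "0 < p" and F: "F holomorphic_on unit_disc"
    and V: "V \<in> borel_measurable disc_area"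
  shows "(\<integral>\<^sup>+z. ennreal ((cmod (deriv F z))\<^sup>2) * ennreal (V z) * indicator (upper_box I) z \<partial>disc_area)
    \<le> ennreal (512 * 4 powr p) * (box_density p V I *
        (\<integral>\<^sup>+u. ennreal ((cmod (deriv F u))\<^sup>2) * ennreal ((1 - cmod u) powr p) * indicator (fat_box I) u \<partial>disc_area))"
    (is "?lhs \<le> _ * (_ * ?T)")
proof -
  let ?s = "arc_len I" and ?G = "\<lambda>z. ennreal ((cmod (deriv F z))\<^sup>2)"
  note s = half_open_arcE(1,2)[OF I]
  have hol: "deriv F holomorphic_on unit_disc" by (rule holomorphic_deriv[OF F]) simp
  have G: "?G \<in> borel_measurable disc_area" by (rule deriv_sq_measurable[OF F])
  have pm: "(\<lambda>u. ennreal ((1 - cmod u) powr p)) \<in> borel_measurable disc_area"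
    by (rule borel_measurable_disc_area) measurable
  have Em: "(\<lambda>u. indicator (fat_box I) u :: ennreal) \<in> borel_measurable disc_area"
    by (rule borel_measurable_disc_area, rule borel_measurable_indicator, rule borel_fat_box)
  have Qm: "(\<lambda>u. indicator (upper_box I) u :: ennreal) \<in> borel_measurable disc_area"
    by (rule borel_measurable_disc_area, rule borel_measurable_indicator, rule borel_upper_box[OF I])
  have Vm: "(\<lambda>u. ennreal (V u)) \<in> borel_measurable disc_area"
    by (rule measurable_compose[OF V measurable_ennreal])
  have pw: "?G z \<le> ennreal (512 * 4 powr p / ?s powr (p + 2)) * ?T" if z: "z \<in> upper_box I" for z
  proof -
    have zn: "cmod z < 1 - ?s / 2" by (rule cmod_upper_box(2)[OF I z])
    have tri: "cmod u \<le> cmod z + cmod (u - z)" for u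
      using norm_triangle_ineq[of z "u - z"] by simp
    have sub: "ball z (?s / 4) \<subseteq> fat_box I"
    proof
      fix u assume "u \<in> ball z (?s / 4)"
      then have u: "cmod (u - z) < ?s / 4" by (simp add: dist_norm norm_minus_commute)
      have "cmod (u - box_centre I) \<le> cmod (u - z) + cmod (z - box_centre I)"
        using norm_triangle_ineq[of "u - z" "z - box_centre I"] by simp
      also have "\<dots> \<le> 5 * ?s" using u upper_box_near_centre[OF I z] s by simp
      finally show "u \<in> fat_box I"
        using tri[of u] u zn by (simp add: fat_box_def dist_norm norm_minus_commute)
    qed
    have subD: "ball z (?s / 4) \<subseteq> unit_disc"
      using sub s by (auto simp: fat_box_def)
    have "?G z \<le> ennreal (32 / (?s / 4)\<^sup>2) * (\<integral>\<^sup>+u. ?G u * indicator (ball z (?s / 4)) u \<partial>disc_area)"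
      by (rule area_mean_le[OF hol _ subD]) (use s in simp)
    also have "(\<integral>\<^sup>+u. ?G u * indicator (ball z (?s / 4)) u \<partial>disc_area)
      \<le> (\<integral>\<^sup>+u. ennreal ((4 / ?s) powr p) * (?G u * ennreal ((1 - cmod u) powr p) * indicator (fat_box I) u) \<partial>disc_area)"
    proof (rule nn_integral_mono)
      fix u
      show "?G u * indicator (ball z (?s / 4)) u \<le> ennreal ((4 / ?s) powr p) * (?G u * ennreal ((1 - cmod u) powr p) * indicator (fat_box I) u)"
      proof (cases "u \<in> ball z (?s / 4)")
        case True
        then have uE: "u \<in> fat_box I" using sub by blast
        then have "1 \<le> 4 / ?s * (1 - cmod u)" using s by (simp add: fat_box_def field_simps)
        then have "1 \<le> (4 / ?s * (1 - cmod u)) powr p" using p by (intro ge_one_powr_ge_zero) auto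
        then have one: "1 \<le> (4 / ?s) powr p * (1 - cmod u) powr p"
          using s uE by (subst (asm) powr_mult) (auto simp: fat_box_def)
        have "?G u * 1 \<le> ?G u * ennreal ((4 / ?s) powr p * (1 - cmod u) powr p)"
          by (intro mult_left_mono) (use one ennreal_leI[OF one] in auto)
        then show ?thesis using True uE by (simp add: ennreal_mult' mult_ac)
      qed simp
    qed
    also have "\<dots> = ennreal ((4 / ?s) powr p) * ?T"
      by (rule nn_integral_cmult) (intro borel_measurable_times_ennreal G pm Em)
    finally have "?G z \<le> ennreal (32 / (?s / 4)\<^sup>2) * (ennreal ((4 / ?s) powr p) * ?T)"
      by (simp add: mult_left_mono)
    also have "\<dots> = ennreal (32 / (?s / 4)\<^sup>2 * (4 / ?s) powr p) * ?T"
      unfolding mult.assoc[symmetric] by (subst ennreal_mult[symmetric]) auto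
    also have "32 / (?s / 4)\<^sup>2 * (4 / ?s) powr p = 512 * 4 powr p / ?s powr (p + 2)"
      using s by (simp add: powr_add powr_divide power2_eq_square)
    finally show ?thesis .
  qed
  have "?lhs \<le> (\<integral>\<^sup>+z. (ennreal (512 * 4 powr p / ?s powr (p + 2)) * ?T) * (ennreal (V z) * indicator (upper_box I) z) \<partial>disc_area)"
  proof (rule nn_integral_mono)
    fix z
    show "?G z * ennreal (V z) * indicator (upper_box I) z
      \<le> (ennreal (512 * 4 powr p / ?s powr (p + 2)) * ?T) * (ennreal (V z) * indicator (upper_box I) z)"
      using pw[of z] by (cases "z \<in> upper_box I") (auto intro!: mult_right_mono)
  qed
  also have "\<dots> = (ennreal (512 * 4 powr p / ?s powr (p + 2)) * ?T) * (\<integral>\<^sup>+z. ennreal (V z) * indicator (upper_box I) z \<partial>disc_area)"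
    by (rule nn_integral_cmult) (intro borel_measurable_times_ennreal Vm Qm)
  also have "ennreal (512 * 4 powr p / ?s powr (p + 2)) = ennreal (512 * 4 powr p) * ennreal (1 / ?s powr (p + 2))"
    by (subst ennreal_mult[symmetric]) auto
  finally show ?thesis by (simp add: box_density_def mult_ac)
qed

context dyadic_tree
begin

text \<open>Sums over nodes are written as integrals over a counting measure, so that Fubini's theorem can interchange them
  with each other and with area integrals.\<close>

lemma nn_integral_count_space_le_infsum:
  fixes f :: "complex set \<Rightarrow> ennreal"
  shows "(\<integral>\<^sup>+J. f J \<partial>count_space nodes) \<le> (\<Sum>\<^sub>\<infinity>J\<in>nodes. f J)"
proof -
  have lev: "finite (levels N)" "levels N \<subseteq> nodes" for N
    using finite_level by (auto simp: nodes_def)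
  have "(\<integral>\<^sup>+J. f J \<partial>count_space nodes) = (\<integral>\<^sup>+J. (SUP N. f J * indicator (levels N) J) \<partial>count_space nodes)"
  proof (rule nn_integral_cong)
    fix J assume "J \<in> space (count_space nodes)"
    then obtain k where "J \<in> L k" by (auto simp: nodes_def)
    then have k: "J \<in> levels k" by auto
    show "f J = (SUP N. f J * indicator (levels N) J)"
    proof (rule antisym)
      show "f J \<le> (SUP N. f J * indicator (levels N) J)" by (rule SUP_upper2[of k]) (use k in auto)
      show "(SUP N. f J * indicator (levels N) J) \<le> f J" by (rule SUP_least) (auto simp: indicator_def)
    qed
  qed
  also have "\<dots> = (SUP N. \<integral>\<^sup>+J. f J * indicator (levels N) J \<partial>count_space nodes)"
  proof (rule nn_integral_monotone_convergence_SUP)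
    show "incseq (\<lambda>N J. f J * indicator (levels N) J)"
    proof (intro incseq_SucI le_funI mult_left_mono)
      fix N J
      show "(indicator (levels N) J :: ennreal) \<le> indicator (levels (Suc N)) J"
        by (rule indicator_leI) force
    qed auto
  qed simp
  also have "\<dots> \<le> (\<Sum>\<^sub>\<infinity>J\<in>nodes. f J)"
  proof (rule SUP_least)
    fix N
    have "(\<integral>\<^sup>+J. f J * indicator (levels N) J \<partial>count_space nodes) = (\<Sum>J\<in>levels N. f J)"
    proof -
      have "(\<integral>\<^sup>+J. f J * indicator (levels N) J \<partial>count_space nodes) = (\<Sum>J\<in>levels N. f J * indicator (levels N) J)"
        by (rule nn_integral_count_space'[OF lev(1)]) (use lev(2) in auto)
      also have "\<dots> = (\<Sum>J\<in>levels N. f J)" by (rule sum.cong) auto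
      finally show ?thesis .
    qed
    also have "\<dots> = (\<Sum>\<^sub>\<infinity>J\<in>levels N. f J)" using lev by simp
    also have "\<dots> \<le> (\<Sum>\<^sub>\<infinity>J\<in>nodes. f J)"
    proof (rule infsum_mono_neutral)
      show "f J \<le> 0" if "J \<in> levels N - nodes" for J using that lev(2)[of N] by blast
    qed (auto intro!: nonneg_summable_on_complete)
    finally show "(\<integral>\<^sup>+J. f J * indicator (levels N) J \<partial>count_space nodes) \<le> (\<Sum>\<^sub>\<infinity>J\<in>nodes. f J)" .
  qed
  finally show ?thesis .
qed

text \<open>A point \<open>u\<close> lies in the fat boxes of boundedly many arcs only: their lengths are comparable to \<open>1 - |u|\<close>, and their
  box centres are at comparable distance from \<open>u\<close>.\<close>

lemma fat_box_overlap:
  assumes J: "J \<in> nodes"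
  shows "(\<integral>\<^sup>+I. indicator {I. I \<subseteq> J} I * indicator (fat_box I) u \<partial>count_space nodes)
    \<le> 923521 * indicator (cball (box_centre J) (9 * arc_len J)) u"
proof -
  define A where "A = {I \<in> nodes. I \<subseteq> J \<and> u \<in> fat_box I}"
  have card: "card S \<le> 923521" if S: "S \<subseteq> A" "finite S" for S
  proof (cases "S = {}")
    case False
    define t where "t = 1 - cmod u"
    have node: "half_open_arc I" "I \<in> nodes" "arc_len I / 4 \<le> t" "cmod (u - box_centre I) \<le> 5 * arc_len I" if "I \<in> S" for I
      using that S node_arc by (auto simp: A_def fat_box_def t_def dist_norm norm_minus_commute)
    obtain I0 where "I0 \<in> S" using False by auto
    then have t: "0 < t" using node(3)[of I0] half_open_arcE(1)[OF node(1), of I0] by simp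
    \<comment> \<open>Membership in the fat box gives \<open>t / 6 \<le> |I| \<le> 4 t\<close> and distance at most \<open>5 |I| \<le> 20 t = 120 (t / 6)\<close>; and \<open>961\<^sup>2 = 923521\<close>.\<close>
    have "real (card S) \<le> (8 * 120 + 1)\<^sup>2"
    proof (rule card_near_le[where \<rho> = "t / 6" and u = u])
      fix I assume I: "I \<in> S"
      have "cmod (box_centre I) \<le> cmod u + cmod (u - box_centre I)"
        using norm_triangle_ineq4[of u "u - box_centre I"] by simp
      then show "t / 6 \<le> arc_len I"
        using node(4)[OF I] cmod_box_centre[OF node(1)[OF I]] half_open_arcE(1)[OF node(1)[OF I]] by (simp add: t_def)
      show "cmod (box_centre I - u) \<le> 120 * (t / 6)"
        using node(3,4)[OF I] by (simp add: norm_minus_commute)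
    qed (use S t node in \<open>auto simp: A_def\<close>)
    then show ?thesis by simp
  qed simp
  have A: "finite A" "card A \<le> 923521"
    using finite_if_finite_subsets_card_bdd[of A 923521] card by auto
  have "(\<integral>\<^sup>+I. indicator {I. I \<subseteq> J} I * indicator (fat_box I) u \<partial>count_space nodes)
    = (\<integral>\<^sup>+I. indicator A I \<partial>count_space nodes)"
    by (rule nn_integral_cong) (auto simp: A_def indicator_def)
  also have "\<dots> = emeasure (count_space nodes) A"
    by (rule nn_integral_indicator) (auto simp: A_def)
  also have "\<dots> = of_nat (card A)"
    using A by (subst emeasure_count_space_finite) (auto simp: A_def)
  finally have eq: "(\<integral>\<^sup>+I. indicator {I. I \<subseteq> J} I * indicator (fat_box I) u \<partial>count_space nodes) = of_nat (card A)" .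
  show ?thesis
  proof (cases "A = {}")
    case True
    then show ?thesis unfolding eq by simp
  next
    case False
    then obtain I where I: "I \<in> nodes" "I \<subseteq> J" "u \<in> fat_box I" by (auto simp: A_def)
    have "cmod (u - box_centre J) \<le> cmod (u - box_centre I) + cmod (box_centre I - box_centre J)"
      using norm_triangle_ineq[of "u - box_centre I" "box_centre I - box_centre J"] by simp
    also have "\<dots> \<le> 5 * arc_len J + 4 * arc_len J"
    proof (rule add_mono)
      show "cmod (u - box_centre I) \<le> 5 * arc_len J"
        using I(3) arc_len_mono[OF node_arc node_arc, OF I(1) J I(2)]
        by (simp add: fat_box_def dist_norm norm_minus_commute)
      show "cmod (box_centre I - box_centre J) \<le> 4 * arc_len J"
        by (rule box_centre_near[OF node_arc node_arc, OF I(1) J I(2)])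
    qed
    finally have "u \<in> cball (box_centre J) (9 * arc_len J)" by (simp add: dist_norm norm_minus_commute)
    moreover have "(of_nat (card A) :: ennreal) \<le> of_nat 923521" using A(2) of_nat_mono by blast
    ultimately show ?thesis unfolding eq by simp
  qed
qed

text \<open>The area is split into boxes, the density of each box is replaced by the sum of the weights above it, and the
  sums are interchanged: what is left for \<open>J\<close> is the mass of \<open>|F'|\<^sup>2 (1 - |u|)\<^sup>p\<close> over the fat boxes of all arcs inside \<open>J\<close>,
  which the Carleson estimate bounds.\<close>

lemma covering_bounds_area_integral:
  assumes p: "0 < p" and F: "F holomorphic_on unit_disc"
    and V: "V \<in> borel_measurable disc_area" "\<And>z. z \<in> unit_disc \<Longrightarrow> 0 \<le> V z"
    and lam: "\<And>J. J \<in> nodes \<Longrightarrow> 0 \<le> lam J"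
    and cover: "\<And>I. I \<in> nodes \<Longrightarrow> box_density p V I \<le> (\<Sum>\<^sub>\<infinity>J\<in>{J\<in>nodes. I \<subseteq> J}. ennreal (lam J))"
  shows "(\<integral>\<^sup>+z. ennreal ((cmod (deriv F z))\<^sup>2 * V z) \<partial>disc_area)
    \<le> ennreal (512 * 4 powr p * 923521 * 294 powr p)
        * (\<Sum>\<^sub>\<infinity>J\<in>nodes. ennreal (lam J * arc_len J powr p)) * Qp_seminorm_sq p F"
proof -
  let ?G = "\<lambda>z. ennreal ((cmod (deriv F z))\<^sup>2)" and ?N = "count_space nodes"
  let ?K = "ennreal (512 * 4 powr p)"
  define H where "H u = ?G u * ennreal ((1 - cmod u) powr p)" for u
  define T where "T I = (\<integral>\<^sup>+u. H u * indicator (fat_box I) u \<partial>disc_area)" for I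
  have G: "?G \<in> borel_measurable disc_area" by (rule deriv_sq_measurable[OF F])
  have Hm: "H \<in> borel_measurable disc_area"
    unfolding H_def by (intro borel_measurable_times_ennreal G borel_measurable_disc_area) measurable
  have Em: "(\<lambda>u. indicator A u :: ennreal) \<in> borel_measurable disc_area" if "A \<in> sets borel" for A :: "complex set"
    by (rule borel_measurable_disc_area, rule borel_measurable_indicator, rule that)
  have Vm: "(\<lambda>u. ennreal (V u)) \<in> borel_measurable disc_area"
    by (rule measurable_compose[OF V(1) measurable_ennreal])
  have sum_T: "(\<integral>\<^sup>+I. indicator {I. I \<subseteq> J} I * T I \<partial>?N) \<le> 923521 * (ennreal (294 powr p * arc_len J powr p) * Qp_seminorm_sq p F)"
    if J: "J \<in> nodes" for J
  proof -
    have "(\<integral>\<^sup>+I. indicator {I. I \<subseteq> J} I * T I \<partial>?N)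
      = (\<integral>\<^sup>+I. \<integral>\<^sup>+u. H u * (indicator {I. I \<subseteq> J} I * indicator (fat_box I) u) \<partial>disc_area \<partial>?N)"
    proof (rule nn_integral_cong)
      fix I
      have "indicator {I. I \<subseteq> J} I * T I = (\<integral>\<^sup>+u. indicator {I. I \<subseteq> J} I * (H u * indicator (fat_box I) u) \<partial>disc_area)"
        unfolding T_def by (rule nn_integral_cmult[symmetric]) (intro borel_measurable_times_ennreal Hm Em borel_fat_box)
      then show "indicator {I. I \<subseteq> J} I * T I = (\<integral>\<^sup>+u. H u * (indicator {I. I \<subseteq> J} I * indicator (fat_box I) u) \<partial>disc_area)"
        by (simp only: mult.left_commute)
    qed
    also have "\<dots> = (\<integral>\<^sup>+u. \<integral>\<^sup>+I. H u * (indicator {I. I \<subseteq> J} I * indicator (fat_box I) u) \<partial>?N \<partial>disc_area)"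
      by (rule nn_integral_count_space_nn_integral[OF countable_nodes, symmetric])
         (intro borel_measurable_times_ennreal Hm Em borel_fat_box borel_measurable_const)
    also have "\<dots> = (\<integral>\<^sup>+u. H u * (\<integral>\<^sup>+I. indicator {I. I \<subseteq> J} I * indicator (fat_box I) u \<partial>?N) \<partial>disc_area)"
      by (simp only: nn_integral_cmult borel_measurable_count_space)
    also have "\<dots> \<le> (\<integral>\<^sup>+u. H u * (923521 * indicator (cball (box_centre J) (9 * arc_len J)) u) \<partial>disc_area)"
      by (intro nn_integral_mono mult_left_mono fat_box_overlap[OF J]) auto
    also have "\<dots> = (\<integral>\<^sup>+u. 923521 * (H u * indicator (cball (box_centre J) (9 * arc_len J)) u) \<partial>disc_area)"
      by (simp only: mult.left_commute)
    also have "\<dots> = 923521 * (\<integral>\<^sup>+u. H u * indicator (cball (box_centre J) (9 * arc_len J)) u \<partial>disc_area)"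
      by (rule nn_integral_cmult) (intro borel_measurable_times_ennreal Hm Em borel_closed closed_cball)
    also have "\<dots> \<le> 923521 * (ennreal (294 powr p * arc_len J powr p) * Qp_seminorm_sq p F)"
      unfolding H_def by (intro mult_left_mono carleson_le_seminorm node_arc J p F) auto
    finally show ?thesis .
  qed
  have "(\<integral>\<^sup>+z. ennreal ((cmod (deriv F z))\<^sup>2 * V z) \<partial>disc_area)
    \<le> (\<integral>\<^sup>+z. \<integral>\<^sup>+I. ?G z * ennreal (V z) * indicator (upper_box I) z \<partial>?N \<partial>disc_area)"
  proof (rule nn_integral_mono)
    fix z assume "z \<in> space disc_area"
    then obtain I where I: "I \<in> nodes" "z \<in> upper_box I" using upper_boxes_cover[of z] by auto
    have "ennreal ((cmod (deriv F z))\<^sup>2 * V z) = ?G z * ennreal (V z) * indicator (upper_box I) z"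
      using I by (simp add: ennreal_mult')
    also have "\<dots> \<le> (\<integral>\<^sup>+I. ?G z * ennreal (V z) * indicator (upper_box I) z \<partial>?N)"
      using nn_integral_ge_point[of I nodes "\<lambda>I. ?G z * ennreal (V z) * indicator (upper_box I) z"] I by simp
    finally show "ennreal ((cmod (deriv F z))\<^sup>2 * V z) \<le> \<dots>" .
  qed
  also have "\<dots> = (\<integral>\<^sup>+I. \<integral>\<^sup>+z. ?G z * ennreal (V z) * indicator (upper_box I) z \<partial>disc_area \<partial>?N)"
    by (rule nn_integral_count_space_nn_integral[OF countable_nodes])
       (intro borel_measurable_times_ennreal G Vm Em borel_upper_box node_arc)
  also have "\<dots> \<le> (\<integral>\<^sup>+I. ?K * (\<integral>\<^sup>+J. ennreal (lam J) * (indicator {I. I \<subseteq> J} I * T I) \<partial>?N) \<partial>?N)"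
  proof (rule nn_integral_mono)
    fix I assume "I \<in> space ?N"
    then have I: "I \<in> nodes" by simp
    obtain m where m: "I \<in> L m" using I by (auto simp: nodes_def)
    have fin: "finite {J \<in> nodes. I \<subseteq> J}"
      by (rule finite_subset[of _ "levels m"]) (use superset_level[OF m] finite_level in auto)
    have "box_density p V I \<le> (\<Sum>J\<in>{J\<in>nodes. I \<subseteq> J}. ennreal (lam J))"
      using cover[OF I] fin by simp
    also have "\<dots> = (\<Sum>J\<in>{J\<in>nodes. I \<subseteq> J}. ennreal (lam J) * indicator {I. I \<subseteq> J} I)"
      by (rule sum.cong) auto
    also have "\<dots> = (\<integral>\<^sup>+J. ennreal (lam J) * indicator {I. I \<subseteq> J} I \<partial>?N)"
      by (rule nn_integral_count_space'[symmetric, OF fin]) auto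
    finally have dens: "box_density p V I \<le> (\<integral>\<^sup>+J. ennreal (lam J) * indicator {I. I \<subseteq> J} I \<partial>?N)" .
    have "(\<integral>\<^sup>+z. ?G z * ennreal (V z) * indicator (upper_box I) z \<partial>disc_area) \<le> ?K * (box_density p V I * T I)"
      unfolding T_def H_def by (rule box_integral_le[OF node_arc[OF I] p F V(1)])
    also have "\<dots> \<le> ?K * ((\<integral>\<^sup>+J. ennreal (lam J) * indicator {I. I \<subseteq> J} I \<partial>?N) * T I)"
      by (intro mult_left_mono mult_right_mono dens) auto
    also have "(\<integral>\<^sup>+J. ennreal (lam J) * indicator {I. I \<subseteq> J} I \<partial>?N) * T I
      = (\<integral>\<^sup>+J. ennreal (lam J) * (indicator {I. I \<subseteq> J} I * T I) \<partial>?N)"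
      by (subst nn_integral_multc[symmetric]) (auto simp: mult.assoc)
    finally show "(\<integral>\<^sup>+z. ?G z * ennreal (V z) * indicator (upper_box I) z \<partial>disc_area)
      \<le> ?K * (\<integral>\<^sup>+J. ennreal (lam J) * (indicator {I. I \<subseteq> J} I * T I) \<partial>?N)" .
  qed
  also have "\<dots> = ?K * (\<integral>\<^sup>+I. \<integral>\<^sup>+J. ennreal (lam J) * (indicator {I. I \<subseteq> J} I * T I) \<partial>?N \<partial>?N)"
    by (rule nn_integral_cmult) simp
  also have "(\<integral>\<^sup>+I. \<integral>\<^sup>+J. ennreal (lam J) * (indicator {I. I \<subseteq> J} I * T I) \<partial>?N \<partial>?N)
    = (\<integral>\<^sup>+J. \<integral>\<^sup>+I. ennreal (lam J) * (indicator {I. I \<subseteq> J} I * T I) \<partial>?N \<partial>?N)"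
    by (rule nn_integral_count_space_nn_integral[OF countable_nodes]) simp
  also have "\<dots> = (\<integral>\<^sup>+J. ennreal (lam J) * (\<integral>\<^sup>+I. indicator {I. I \<subseteq> J} I * T I \<partial>?N) \<partial>?N)"
    by (simp only: nn_integral_cmult borel_measurable_count_space)
  also have "\<dots> \<le> (\<integral>\<^sup>+J. ennreal (923521 * 294 powr p) * Qp_seminorm_sq p F * ennreal (lam J * arc_len J powr p) \<partial>?N)"
  proof (rule nn_integral_mono)
    fix J assume "J \<in> space ?N"
    then have J: "J \<in> nodes" by simp
    have "ennreal (lam J) * (\<integral>\<^sup>+I. indicator {I. I \<subseteq> J} I * T I \<partial>?N)
      \<le> ennreal (lam J) * (923521 * (ennreal (294 powr p * arc_len J powr p) * Qp_seminorm_sq p F))"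
      by (intro mult_left_mono sum_T J) auto
    also have "\<dots> = ennreal (923521 * 294 powr p) * Qp_seminorm_sq p F * ennreal (lam J * arc_len J powr p)"
      using lam[OF J] by (simp add: ennreal_mult' ennreal_mult'' mult_ac flip: ennreal_numeral)
    finally show "ennreal (lam J) * (\<integral>\<^sup>+I. indicator {I. I \<subseteq> J} I * T I \<partial>?N) \<le> \<dots>" .
  qed
  also have "\<dots> = ennreal (923521 * 294 powr p) * Qp_seminorm_sq p F * (\<integral>\<^sup>+J. ennreal (lam J * arc_len J powr p) \<partial>?N)"
    by (rule nn_integral_cmult) simp
  also have "\<dots> \<le> ennreal (923521 * 294 powr p) * Qp_seminorm_sq p F * (\<Sum>\<^sub>\<infinity>J\<in>nodes. ennreal (lam J * arc_len J powr p))"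
    by (intro mult_left_mono nn_integral_count_space_le_infsum) auto
  finally have "(\<integral>\<^sup>+z. ennreal ((cmod (deriv F z))\<^sup>2 * V z) \<partial>disc_area)
    \<le> ?K * (ennreal (923521 * 294 powr p) * Qp_seminorm_sq p F * (\<Sum>\<^sub>\<infinity>J\<in>nodes. ennreal (lam J * arc_len J powr p)))"
    by (simp add: mult_left_mono)
  also have "\<dots> = (?K * ennreal (923521 * 294 powr p)) * (\<Sum>\<^sub>\<infinity>J\<in>nodes. ennreal (lam J * arc_len J powr p)) * Qp_seminorm_sq p F"
    by (simp only: mult_ac)
  also have "?K * ennreal (923521 * 294 powr p) = ennreal (512 * 4 powr p * 923521 * 294 powr p)"
    by (subst ennreal_mult[symmetric]) auto
  finally show ?thesis .
qed

end

section \<open>Test functions in the \<open>Q\<^sub>p\<close> space\<close>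

lemma powr_half_minus: "0 < x \<Longrightarrow> (x / 2) powr (- r) = 2 powr r * x powr (- r)" for x r :: real
  by (simp add: powr_divide powr_minus_divide)

lemma two_powr_le_one: "x \<le> 0 \<Longrightarrow> 2 powr x \<le> (1::real)"
  using powr_mono[of x 0 2] by simp

text \<open>The exponent has to exceed \<open>2 + p/2\<close> for the area integrals of the kernels to be dominated by their behaviour at the box.\<close>

definition box_kernel :: "complex set \<Rightarrow> complex \<Rightarrow> complex" where
  "box_kernel I z = (of_real (arc_len I) / (1 - cnj (box_centre I) * z)) ^ 3"

lemma cmod_box_kernel:
  assumes "half_open_arc I"
  shows "cmod (box_kernel I z) = (arc_len I / cmod (1 - cnj (box_centre I) * z)) ^ 3"
  using half_open_arcE(1)[OF assms] by (simp add: box_kernel_def norm_power norm_divide)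

lemma box_kernel_holomorphic:
  assumes "half_open_arc I"
  shows "box_kernel I holomorphic_on unit_disc"
proof -
  have "1 - cnj (box_centre I) * z \<noteq> 0" if "z \<in> unit_disc" for z
    using cmod_one_minus_bounds(4)[OF box_centre_in_disc[OF assms] that] by auto
  then show ?thesis unfolding box_kernel_def[abs_def] by (intro holomorphic_intros) auto
qed

text \<open>On the box the denominator is at most \<open>11/2 |I|\<close>, and \<open>27681\<close> is \<open>(11/2)\<^sup>6\<close> rounded up.\<close>

lemma box_kernel_lower:
  assumes I: "half_open_arc I" and z: "z \<in> upper_box I"
  shows "1 \<le> 27681 * (cmod (box_kernel I z))\<^sup>2"
proof -
  let ?X = "cmod (1 - cnj (box_centre I) * z)"
  note s = half_open_arcE(1,2)[OF I]
  have zD: "z \<in> unit_disc" using cmod_upper_box(2)[OF I z] s by simp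
  have X: "?X \<le> 5.5 * arc_len I" using cmod_one_minus_le[OF I upper_box_near_centre[OF I z]] by simp
  have X0: "0 < ?X" by (rule cmod_one_minus_bounds(4)[OF box_centre_in_disc[OF I] zD])
  have "1 / 5.5 \<le> arc_len I / ?X" using X X0 by (simp add: field_simps)
  then have "(1 / 5.5) ^ 6 \<le> (arc_len I / ?X) ^ 6" by (rule power_mono) simp
  also have "\<dots> = (cmod (box_kernel I z))\<^sup>2"
    unfolding cmod_box_kernel[OF I] by (simp flip: power_mult)
  finally have "(1 / 5.5) ^ 6 \<le> (cmod (box_kernel I z))\<^sup>2" .
  moreover have "1 / 27681 \<le> (1 / 5.5 :: real) ^ 6" by (simp add: power_divide eval_nat_numeral)
  ultimately show ?thesis by linarith
qed

text \<open>Replacing each summand by its average over the ball around the box centre turns the sum over disjoint balls into one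
  area integral with the kernel \<open>|1 - cnj v z|\<close>.\<close>

lemma (in dyadic_tree) sum_box_kernel_le:
  assumes S: "finite S" "S \<subseteq> nodes" and q: "0 < q" "q \<le> 1" and z: "z \<in> unit_disc"
  shows "(\<Sum>I\<in>S. arc_len I powr (- q) * cmod (box_kernel I z))
    \<le> 4096 / (1 - 2 powr (- q)) * (1 - cmod z) powr (- q)"
proof -
  define Y where "Y v = max (1 - cmod z) (cmod (v - z))" for v
  define \<Delta> where "\<Delta> I = ball (box_centre I) (arc_len I / 8)" for I
  have z1: "0 < 1 - cmod z" using z by simp
  have Ym: "(\<lambda>v. ennreal (Y v powr (- (2 + q)))) \<in> borel_measurable disc_area"
    unfolding Y_def by (rule borel_measurable_disc_area) measurable
  have single: "ennreal (arc_len I powr (- q) * cmod (box_kernel I z))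
      \<le> 1024 * (\<integral>\<^sup>+v. ennreal (Y v powr (- (2 + q))) * indicator (\<Delta> I) v \<partial>disc_area)"
    if I: "I \<in> S" for I
  proof -
    let ?s = "arc_len I" and ?w = "box_centre I"
    have arcI: "half_open_arc I" using I S node_arc by blast
    note s = half_open_arcE(1,2)[OF arcI]
    have w: "?w \<in> unit_disc" "cmod ?w = 1 - 3 / 4 * ?s" by (rule box_centre_in_disc[OF arcI], rule cmod_box_centre[OF arcI])
    have sub: "\<Delta> I \<subseteq> unit_disc"
    proof
      fix v assume "v \<in> \<Delta> I"
      then have "v \<in> upper_box I" using ball_subset_upper_box[OF arcI] by (auto simp: \<Delta>_def)
      then show "v \<in> unit_disc" using cmod_upper_box(2)[OF arcI] s by force
    qed
    define X where "X = cmod (1 - cnj ?w * z)"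
    have X: "0 < X" "3 / 4 * ?s \<le> X" unfolding X_def
      using cmod_one_minus_bounds(2,4)[OF w(1) z] w(2) by auto
    have pw: "?s powr (- q) * cmod (box_kernel I z) \<le> 16 * ?s\<^sup>2 * Y v powr (- (2 + q))" if v: "v \<in> \<Delta> I" for v
    proof -
      have vD: "v \<in> unit_disc" using v sub by blast
      have "1 - cnj v * z = (1 - cnj ?w * z) + cnj (?w - v) * z" by (simp add: algebra_simps)
      then have "cmod (1 - cnj v * z) \<le> X + cmod (cnj (?w - v) * z)" unfolding X_def by (metis norm_triangle_ineq)
      also have "cmod (cnj (?w - v) * z) \<le> cmod (?w - v)"
        using z unfolding norm_mult complex_mod_cnj by (simp add: mult_left_le)
      also have "cmod (?w - v) \<le> X" using v X by (simp add: \<Delta>_def dist_norm)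
      finally have "cmod (1 - cnj v * z) \<le> 2 * X" by simp
      then have Y2: "Y v \<le> 2 * X" unfolding Y_def
        using cmod_one_minus_bounds(1,3)[OF vD z] by (simp add: norm_minus_commute)
      have Y0: "0 < Y v" unfolding Y_def using z1 by simp
      have "?s powr (- q) * cmod (box_kernel I z) = ?s powr (- q) * (?s powr 3 * X powr (- 3))"
        unfolding cmod_box_kernel[OF arcI] X_def[symmetric] using s X
        by (simp add: power_divide powr_minus_divide)
      also have "\<dots> = ?s powr 2 * ?s powr (1 - q) * X powr (- 3)"
        using s by (simp add: mult.assoc[symmetric] del: powr_numeral flip: powr_add)
      also have "\<dots> \<le> ?s powr 2 * (2 * X powr (1 - q)) * X powr (- 3)"
      proof (intro mult_right_mono mult_left_mono)
        have "?s powr (1 - q) \<le> (2 * X) powr (1 - q)" using s X q by (intro powr_mono2) auto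
        also have "\<dots> = 2 powr (1 - q) * X powr (1 - q)" by (rule powr_mult)
        also have "\<dots> \<le> 2 powr 1 * X powr (1 - q)" using q by (intro mult_right_mono powr_mono) auto
        finally show "?s powr (1 - q) \<le> 2 * X powr (1 - q)" by simp
      qed auto
      also have "\<dots> = 2 * ?s\<^sup>2 * X powr (- (2 + q))"
        using s X by (simp add: mult.assoc flip: powr_add)
      also have "X powr (- (2 + q)) \<le> (Y v / 2) powr (- (2 + q))"
        using Y2 Y0 q by (intro powr_mono2') auto
      also have "(Y v / 2) powr (- (2 + q)) = 2 powr (2 + q) * Y v powr (- (2 + q))"
        by (rule powr_half_minus[OF Y0])
      also have "2 * ?s\<^sup>2 * (2 powr (2 + q) * Y v powr (- (2 + q))) \<le> 2 * ?s\<^sup>2 * (2 powr 3 * Y v powr (- (2 + q)))"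
        using q by (intro mult_left_mono mult_right_mono powr_mono) auto
      finally show ?thesis by (simp add: mult_left_mono)
    qed
    have "ennreal (?s powr (- q) * cmod (box_kernel I z))
        = ennreal (64 / ?s\<^sup>2) * (ennreal (?s powr (- q) * cmod (box_kernel I z)) * ennreal ((?s / 8)\<^sup>2))"
      using s by (simp add: power2_eq_square field_simps flip: ennreal_mult)
    also have "ennreal ((?s / 8)\<^sup>2) = (\<integral>\<^sup>+v. indicator (\<Delta> I) v \<partial>disc_area)"
      using nn_integral_disc_area_ball[of "?s / 8" ?w] s sub by (simp add: \<Delta>_def)
    also have "ennreal (?s powr (- q) * cmod (box_kernel I z)) * (\<integral>\<^sup>+v. indicator (\<Delta> I) v \<partial>disc_area)
        = (\<integral>\<^sup>+v. ennreal (?s powr (- q) * cmod (box_kernel I z)) * indicator (\<Delta> I) v \<partial>disc_area)"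
      unfolding \<Delta>_def by (rule nn_integral_cmult[symmetric, OF indicator_ball_measurable(2)])
    also have "\<dots> \<le> (\<integral>\<^sup>+v. ennreal (16 * ?s\<^sup>2) * (ennreal (Y v powr (- (2 + q))) * indicator (\<Delta> I) v) \<partial>disc_area)"
    proof (rule nn_integral_mono)
      fix v
      show "ennreal (?s powr (- q) * cmod (box_kernel I z)) * indicator (\<Delta> I) v
        \<le> ennreal (16 * ?s\<^sup>2) * (ennreal (Y v powr (- (2 + q))) * indicator (\<Delta> I) v)"
        using ennreal_leI[OF pw[of v]] by (cases "v \<in> \<Delta> I") (simp_all add: ennreal_mult'')
    qed
    also have "\<dots> = ennreal (16 * ?s\<^sup>2) * (\<integral>\<^sup>+v. ennreal (Y v powr (- (2 + q))) * indicator (\<Delta> I) v \<partial>disc_area)"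
      unfolding \<Delta>_def by (rule nn_integral_cmult) (intro borel_measurable_times_ennreal Ym indicator_ball_measurable)
    finally have "ennreal (?s powr (- q) * cmod (box_kernel I z))
      \<le> ennreal (64 / ?s\<^sup>2) * (ennreal (16 * ?s\<^sup>2) * (\<integral>\<^sup>+v. ennreal (Y v powr (- (2 + q))) * indicator (\<Delta> I) v \<partial>disc_area))"
      by (simp add: mult_left_mono)
    also have "\<dots> = ennreal (64 / ?s\<^sup>2 * (16 * ?s\<^sup>2)) * (\<integral>\<^sup>+v. ennreal (Y v powr (- (2 + q))) * indicator (\<Delta> I) v \<partial>disc_area)"
      unfolding mult.assoc[symmetric] by (subst ennreal_mult[symmetric]) auto
    also have "64 / ?s\<^sup>2 * (16 * ?s\<^sup>2) = 1024" using s by simp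
    finally show ?thesis by simp
  qed
  have "ennreal (\<Sum>I\<in>S. arc_len I powr (- q) * cmod (box_kernel I z))
      = (\<Sum>I\<in>S. ennreal (arc_len I powr (- q) * cmod (box_kernel I z)))"
    by (rule sum_ennreal[symmetric]) simp
  also have "\<dots> \<le> (\<Sum>I\<in>S. 1024 * (\<integral>\<^sup>+v. ennreal (Y v powr (- (2 + q))) * indicator (\<Delta> I) v \<partial>disc_area))"
    by (rule sum_mono[OF single])
  also have "\<dots> = 1024 * (\<Sum>I\<in>S. \<integral>\<^sup>+v. ennreal (Y v powr (- (2 + q))) * indicator (\<Delta> I) v \<partial>disc_area)"
    by (simp only: sum_distrib_left)
  also have "(\<Sum>I\<in>S. \<integral>\<^sup>+v. ennreal (Y v powr (- (2 + q))) * indicator (\<Delta> I) v \<partial>disc_area)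
      = (\<integral>\<^sup>+v. (\<Sum>I\<in>S. ennreal (Y v powr (- (2 + q))) * indicator (\<Delta> I) v) \<partial>disc_area)"
    unfolding \<Delta>_def by (rule nn_integral_sum[symmetric]) (intro borel_measurable_times_ennreal Ym indicator_ball_measurable)
  also have "\<dots> \<le> (\<integral>\<^sup>+v. ennreal (Y v powr (- (2 + q))) \<partial>disc_area)"
  proof (rule nn_integral_mono)
    fix v
    have "(\<Sum>I\<in>S. indicator (\<Delta> I) v :: ennreal) \<le> 1"
    proof (cases "\<exists>I\<in>S. v \<in> \<Delta> I")
      case True
      then obtain I where I: "I \<in> S" "v \<in> \<Delta> I" by blast
      have "v \<notin> \<Delta> J" if "J \<in> S" "J \<noteq> I" for J
      proof
        assume "v \<in> \<Delta> J"
        then have "v \<in> upper_box J \<inter> upper_box I"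
          using I that ball_subset_upper_box[OF node_arc] S by (auto simp: \<Delta>_def subset_iff)
        then show False using upper_box_disjoint[of J I] that I S by blast
      qed
      then have "(\<Sum>J\<in>S. indicator (\<Delta> J) v :: ennreal) = (\<Sum>J\<in>{I}. indicator (\<Delta> J) v)"
        using I S by (intro sum.mono_neutral_right) auto
      then show ?thesis using I by simp
    next
      case False
      then have "(\<Sum>J\<in>S. indicator (\<Delta> J) v :: ennreal) = 0" by (intro sum.neutral) auto
      then show ?thesis by simp
    qed
    then have "ennreal (Y v powr (- (2 + q))) * (\<Sum>I\<in>S. indicator (\<Delta> I) v) \<le> ennreal (Y v powr (- (2 + q))) * 1"
      by (rule mult_left_mono) simp
    then show "(\<Sum>I\<in>S. ennreal (Y v powr (- (2 + q))) * indicator (\<Delta> I) v) \<le> ennreal (Y v powr (- (2 + q)))"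
      by (simp add: sum_distrib_left)
  qed
  also have "\<dots> \<le> ennreal (4 / (1 - 2 powr (2 - (2 + q))) * (1 - cmod z) powr (2 - (2 + q)))"
    unfolding Y_def by (rule nn_integral_max_powr_le) (use q z1 in auto)
  finally have "ennreal (\<Sum>I\<in>S. arc_len I powr (- q) * cmod (box_kernel I z))
      \<le> 1024 * ennreal (4 / (1 - 2 powr (- q)) * (1 - cmod z) powr (- q))"
    by (simp add: mult_left_mono)
  also have "\<dots> = ennreal (4096 / (1 - 2 powr (- q)) * (1 - cmod z) powr (- q))"
    by (subst ennreal_numeral[symmetric], subst ennreal_mult'[symmetric]) auto
  finally show ?thesis
  proof (subst (asm) ennreal_le_iff)
    have "2 powr (- q) \<le> (1::real)" using q by (intro two_powr_le_one) auto
    then show "0 \<le> 4096 / (1 - 2 powr (- q)) * (1 - cmod z) powr (- q)" by simp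
  qed
qed

definition kernel_green_const :: "real \<Rightarrow> real" where
  "kernel_green_const p = 16 * 4 powr p * (4 / (1 - 2 powr (p / 2 - 1)) + 4 / (1 - 2 powr (3 * p / 2 - 2)))"

lemma kernel_green_const_nonneg:
  assumes "0 < p" "p \<le> 1"
  shows "0 \<le> kernel_green_const p"
proof -
  have "2 powr (p / 2 - 1) \<le> (1::real)" "2 powr (3 * p / 2 - 2) \<le> (1::real)"
    by (rule two_powr_le_one, use assms in simp)+
  then show ?thesis unfolding kernel_green_const_def by (intro mult_nonneg_nonneg add_nonneg_nonneg) auto
qed

text \<open>The kernel lives near the box centre \<open>w\<close> and the Green function near \<open>a\<close>. Where \<open>z\<close> is farther from \<open>a\<close> than
  half of \<open>d = |1 - cnj a w|\<close>, the Green factor is at most its size at \<open>w\<close> and the kernel is integrated; otherwise the kernel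
  is comparable to its size at \<open>a\<close> and the pole is integrated.\<close>

lemma kernel_green_integral_le:
  assumes I: "half_open_arc I" and a: "a \<in> unit_disc" and p: "0 < p" "p \<le> 1"
  shows "(\<integral>\<^sup>+z. ennreal (cmod (box_kernel I z) * (1 - cmod z) powr (- (p / 2)) * green z a powr p) \<partial>disc_area)
    \<le> ennreal (kernel_green_const p * arc_len I powr (2 + p / 2)
          * ((1 - cmod a) / (cmod (1 - cnj a * box_centre I))\<^sup>2) powr p)"
proof -
  let ?s = "arc_len I" and ?w = "box_centre I"
  define q where "q = p / 2"
  have q: "0 < q" "q \<le> 1 / 2" "p = 2 * q" using p by (auto simp: q_def)
  note s = half_open_arcE(1,2)[OF I]
  have w: "?w \<in> unit_disc" "cmod ?w = 1 - 3 / 4 * ?s" by (rule box_centre_in_disc[OF I], rule cmod_box_centre[OF I])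
  define d where "d = cmod (1 - cnj a * ?w)"
  define A where "A = 1 - cmod a"
  define \<eta> where "\<eta> = 3 / 4 * ?s"
  have d0: "0 < d" and d\<eta>: "\<eta> \<le> d" unfolding d_def \<eta>_def
    using cmod_one_minus_bounds(3,4)[OF a w(1)] w(2) by auto
  have A0: "0 < A" using a by (simp add: A_def)
  have \<eta>0: "0 < \<eta>" using s by (simp add: \<eta>_def)
  \<comment> \<open>The two summands majorize the product far from \<open>a\<close> and near \<open>a\<close>, up to the constant factors.\<close>
  define \<Phi> where "\<Phi> z = (d / 2) powr (- 2 * p) * max \<eta> (cmod (z - ?w)) powr (- (3 - q))
      + (d / 2) powr (- 3) * (cmod (z - a) powr (- (3 * q)) * indicator (ball a (d / 2)) z)" for z
  have pw: "cmod (box_kernel I z) * (1 - cmod z) powr (- q) * green z a powr p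
      \<le> 4 powr p * A powr p * ?s ^ 3 * \<Phi> z" if z: "z \<in> unit_disc" for z
  proof (cases "z = a")
    case True
    then have "green z a = 0" by (simp add: green_def disc_automorphism_def)
    then show ?thesis using A0 s by (auto simp: \<Phi>_def intro!: mult_nonneg_nonneg add_nonneg_nonneg)
  next
    case False
    define x where "x = cmod (1 - cnj ?w * z)"
    define y where "y = cmod (1 - cnj a * z)"
    define e where "e = cmod (z - a)"
    define t where "t = 1 - cmod z"
    have t0: "0 < t" using z by (simp add: t_def)
    have e0: "0 < e" using False by (simp add: e_def)
    have x: "0 < x" "t \<le> x" "max \<eta> (cmod (z - ?w)) \<le> x" unfolding x_def t_def \<eta>_def
      using cmod_one_minus_bounds(1-4)[OF w(1) z] w(2) by auto
    have y: "0 < y" "t \<le> y" "e \<le> y" unfolding y_def t_def e_def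
      using cmod_one_minus_bounds(1,3,4)[OF a z] by auto
    have g: "green z a powr p \<le> 4 powr p * A powr p * (t powr p * y powr (- p) * e powr (- p))"
    proof -
      have "green z a \<le> 4 * (A * t) / (y * e)"
        using green_upper(2)[OF a z] by (simp add: A_def t_def y_def e_def)
      then have "green z a powr p \<le> (4 * (A * t) / (y * e)) powr p"
        using green_upper(1)[OF a z] p by (intro powr_mono2) auto
      also have "\<dots> = 4 powr p * A powr p * (t powr p * y powr (- p) * e powr (- p))"
        using A0 t0 y e0 by (simp add: powr_divide powr_mult powr_minus_divide)
      finally show ?thesis .
    qed
    have core: "x powr (- 3) * t powr q * y powr (- p) * e powr (- p) \<le> \<Phi> z"
    proof (cases "e < d / 2")
      case False
      have "x powr (- 3) * t powr q \<le> x powr (- 3) * x powr q"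
        using x t0 q by (intro mult_left_mono powr_mono2) auto
      also have "\<dots> = x powr (- (3 - q))" by (simp flip: powr_add)
      also have "\<dots> \<le> max \<eta> (cmod (z - ?w)) powr (- (3 - q))"
        using x \<eta>0 q by (intro powr_mono2') auto
      finally have 1: "x powr (- 3) * t powr q \<le> max \<eta> (cmod (z - ?w)) powr (- (3 - q))" .
      have "y powr (- p) * e powr (- p) \<le> (d / 2) powr (- p) * (d / 2) powr (- p)"
        using False y d0 p by (intro mult_mono powr_mono2') auto
      also have "\<dots> = (d / 2) powr (- 2 * p)" by (simp flip: powr_add)
      finally have 2: "y powr (- p) * e powr (- p) \<le> (d / 2) powr (- 2 * p)" .
      have "x powr (- 3) * t powr q * (y powr (- p) * e powr (- p))
          \<le> max \<eta> (cmod (z - ?w)) powr (- (3 - q)) * (d / 2) powr (- 2 * p)"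
        by (intro mult_mono 1 2) auto
      also have "\<dots> \<le> \<Phi> z" unfolding \<Phi>_def by (simp add: mult.commute)
      finally show ?thesis by (simp add: mult.assoc)
    next
      case True
      have "cmod (1 - cnj ?w * a) = d"
        unfolding d_def by (metis complex_cnj_cnj complex_cnj_diff complex_cnj_mult complex_cnj_one complex_mod_cnj mult.commute)
      moreover have "1 - cnj ?w * a = (1 - cnj ?w * z) + cnj ?w * (z - a)" by (simp add: algebra_simps)
      ultimately have "d \<le> x + cmod (cnj ?w * (z - a))" unfolding x_def by (metis norm_triangle_ineq)
      also have "cmod (cnj ?w * (z - a)) \<le> e"
        unfolding norm_mult e_def complex_mod_cnj using w(1) by (intro mult_left_le_one_le) auto
      finally have "d / 2 \<le> x" using True by simp
      then have 1: "x powr (- 3) \<le> (d / 2) powr (- 3)" using d0 by (intro powr_mono2') auto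
      have "t powr q * y powr (- p) \<le> y powr q * y powr (- p)"
        using y t0 q by (intro mult_right_mono powr_mono2) auto
      also have "\<dots> = y powr (- q)" by (simp add: q(3) flip: powr_add)
      also have "\<dots> \<le> e powr (- q)" using y e0 q by (intro powr_mono2') auto
      finally have "t powr q * y powr (- p) * e powr (- p) \<le> e powr (- q) * e powr (- p)"
        by (rule mult_right_mono) simp
      also have "\<dots> = e powr (- (3 * q))" by (simp add: q(3) flip: powr_add)
      finally have 2: "t powr q * y powr (- p) * e powr (- p) \<le> e powr (- (3 * q))" .
      have "x powr (- 3) * (t powr q * y powr (- p) * e powr (- p)) \<le> (d / 2) powr (- 3) * e powr (- (3 * q))"
        by (intro mult_mono 1 2) auto
      also have "\<dots> \<le> \<Phi> z"
        unfolding \<Phi>_def using True by (simp add: e_def dist_norm norm_minus_commute)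
      finally show ?thesis by (simp add: mult.assoc)
    qed
    have kern: "cmod (box_kernel I z) = ?s ^ 3 * x powr (- 3)"
      unfolding cmod_box_kernel[OF I] x_def[symmetric] using x by (simp add: power_divide powr_minus_divide)
    have "cmod (box_kernel I z) * t powr (- q) * green z a powr p
        \<le> cmod (box_kernel I z) * t powr (- q) * (4 powr p * A powr p * (t powr p * y powr (- p) * e powr (- p)))"
      by (intro mult_left_mono g) auto
    also have "\<dots> = ?s ^ 3 * x powr (- 3) * t powr (- q) * (4 powr p * A powr p * (t powr p * y powr (- p) * e powr (- p)))"
      by (simp only: kern)
    also have "?s ^ 3 * x powr (- 3) * t powr (- q) * (4 powr p * A powr p * (t powr p * y powr (- p) * e powr (- p)))
        = 4 powr p * A powr p * ?s ^ 3 * (x powr (- 3) * (t powr (- q) * t powr p) * y powr (- p) * e powr (- p))"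
      by (simp only: mult_ac)
    also have "t powr (- q) * t powr p = t powr q" by (simp add: q(3) flip: powr_add)
    also have "4 powr p * A powr p * ?s ^ 3 * (x powr (- 3) * t powr q * y powr (- p) * e powr (- p))
        \<le> 4 powr p * A powr p * ?s ^ 3 * \<Phi> z"
      using s by (intro mult_left_mono core) auto
    finally show ?thesis by (simp add: t_def)
  qed
  have m1: "(\<lambda>z. ennreal (max \<eta> (cmod (z - ?w)) powr (- (3 - q)))) \<in> borel_measurable disc_area"
    by (rule borel_measurable_disc_area) measurable
  have m2: "(\<lambda>z. ennreal (cmod (z - a) powr (- (3 * q))) * indicator (ball a (d / 2)) z) \<in> borel_measurable disc_area"
    by (intro borel_measurable_times_ennreal indicator_ball_measurable, rule borel_measurable_disc_area) measurable
  have \<Phi>_eq: "ennreal (\<Phi> z) = ennreal ((d / 2) powr (- 2 * p)) * ennreal (max \<eta> (cmod (z - ?w)) powr (- (3 - q)))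
      + ennreal ((d / 2) powr (- 3)) * (ennreal (cmod (z - a) powr (- (3 * q))) * indicator (ball a (d / 2)) z)" for z
    unfolding \<Phi>_def by (subst ennreal_plus) (auto simp: ennreal_mult' indicator_def)
  have \<Phi>m: "(\<lambda>z. ennreal (\<Phi> z)) \<in> borel_measurable disc_area"
    unfolding \<Phi>_eq by (intro borel_measurable_add borel_measurable_times_ennreal m1 m2 borel_measurable_const)
  let ?c1 = "4 / (1 - 2 powr (q - 1)) :: real" and ?c2 = "4 / (1 - 2 powr (3 * q - 2)) :: real"
  have c: "0 \<le> ?c1" "0 \<le> ?c2"
  proof -
    have "2 powr (q - 1) \<le> (1::real)" "2 powr (3 * q - 2) \<le> (1::real)"
      by (rule two_powr_le_one, use q in simp)+
    then show "0 \<le> ?c1" "0 \<le> ?c2" by auto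
  qed
  have "(\<integral>\<^sup>+z. ennreal (\<Phi> z) \<partial>disc_area) =
      ennreal ((d / 2) powr (- 2 * p)) * (\<integral>\<^sup>+z. ennreal (max \<eta> (cmod (z - ?w)) powr (- (3 - q))) \<partial>disc_area)
      + ennreal ((d / 2) powr (- 3)) * (\<integral>\<^sup>+z. ennreal (cmod (z - a) powr (- (3 * q))) * indicator (ball a (d / 2)) z \<partial>disc_area)"
    unfolding \<Phi>_eq
    by (simp only: nn_integral_add nn_integral_cmult m1 m2 borel_measurable_times_ennreal borel_measurable_const)
  also have "\<dots> \<le> ennreal ((d / 2) powr (- 2 * p)) * ennreal (4 / (1 - 2 powr (2 - (3 - q))) * \<eta> powr (2 - (3 - q)))
      + ennreal ((d / 2) powr (- 3)) * ennreal (4 / (1 - 2 powr (3 * q - 2)) * (d / 2) powr (2 - 3 * q))"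
    by (intro add_mono mult_left_mono nn_integral_max_powr_le nn_integral_powr_ball_le) (use q \<eta>0 d0 in auto)
  also have "\<dots> = ennreal ((d / 2) powr (- 2 * p) * (?c1 * \<eta> powr (q - 1)) + (d / 2) powr (- 3) * (?c2 * (d / 2) powr (2 - 3 * q)))"
  proof -
    have gen: "ennreal x * ennreal y + ennreal x' * ennreal y' = ennreal (x * y + x' * y')"
      if "0 \<le> x" "0 \<le> y" "0 \<le> x'" "0 \<le> y'" for x y x' y' :: real
      using that by (simp add: ennreal_mult ennreal_plus)
    have "2 - (3 - q) = q - 1" by simp
    then show ?thesis
      by (simp only:) (intro gen mult_nonneg_nonneg c powr_ge_zero)
  qed
  also have "\<dots> \<le> ennreal (16 * (?c1 + ?c2) * (d powr (- 2 * p) * ?s powr (q - 1)))"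
  proof (rule ennreal_leI)
    have qs: "(?s / 4) powr (q - 1) \<le> 4 * ?s powr (q - 1)"
    proof -
      have "(?s / 4) powr (q - 1) = 4 powr (1 - q) * ?s powr (q - 1)"
      proof -
        have "(?s / 4) powr (q - 1) = ?s powr (q - 1) / 4 powr (q - 1)" using s by (simp add: powr_divide)
        also have "\<dots> = ?s powr (q - 1) * 4 powr (- (q - 1))" by (simp only: powr_minus_divide) simp
        finally show ?thesis by (simp add: mult.commute)
      qed
      also have "\<dots> \<le> 4 powr 1 * ?s powr (q - 1)" using q by (intro mult_right_mono powr_mono) auto
      finally show ?thesis by simp
    qed
    have 1: "\<eta> powr (q - 1) \<le> 4 * ?s powr (q - 1)"
      using qs powr_mono2'[of "q - 1" "?s / 4" \<eta>] s q by (simp add: \<eta>_def)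
    have 2: "(d / 2) powr (q - 1) \<le> 4 * ?s powr (q - 1)"
      using qs powr_mono2'[of "q - 1" "?s / 4" "d / 2"] s q d\<eta> by (simp add: \<eta>_def)
    have "(d / 2) powr (- 2 * p) = 2 powr (2 * p) * d powr (- 2 * p)"
      using powr_half_minus[OF d0, of "2 * p"] by simp
    also have "\<dots> \<le> 2 powr 2 * d powr (- 2 * p)" using p by (intro mult_right_mono powr_mono) auto
    finally have 3: "(d / 2) powr (- 2 * p) \<le> 4 * d powr (- 2 * p)" by simp
    have "(d / 2) powr (- 3) * (d / 2) powr (2 - 3 * q) = (d / 2) powr (- 2 * p) * (d / 2) powr (q - 1)"
      by (simp add: q(3) algebra_simps flip: powr_add)
    then have "(d / 2) powr (- 2 * p) * (?c1 * \<eta> powr (q - 1)) + (d / 2) powr (- 3) * (?c2 * (d / 2) powr (2 - 3 * q))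
        = (d / 2) powr (- 2 * p) * (?c1 * \<eta> powr (q - 1)) + (d / 2) powr (- 2 * p) * (?c2 * (d / 2) powr (q - 1))"
      by (simp only: mult.left_commute[of _ "?c2"])
    also have "\<dots> \<le> (4 * d powr (- 2 * p)) * (?c1 * (4 * ?s powr (q - 1))) + (4 * d powr (- 2 * p)) * (?c2 * (4 * ?s powr (q - 1)))"
      using c by (intro add_mono mult_mono 1 2 3 mult_nonneg_nonneg) auto
    also have "\<dots> = 16 * (?c1 + ?c2) * (d powr (- 2 * p) * ?s powr (q - 1))"
      by (simp only: distrib_left distrib_right mult_ac)
    finally show "(d / 2) powr (- 2 * p) * (?c1 * \<eta> powr (q - 1)) + (d / 2) powr (- 3) * (?c2 * (d / 2) powr (2 - 3 * q))
        \<le> 16 * (?c1 + ?c2) * (d powr (- 2 * p) * ?s powr (q - 1))" .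
  qed
  finally have int\<Phi>: "(\<integral>\<^sup>+z. ennreal (\<Phi> z) \<partial>disc_area) \<le> ennreal (16 * (?c1 + ?c2) * (d powr (- 2 * p) * ?s powr (q - 1)))" .
  have "(\<integral>\<^sup>+z. ennreal (cmod (box_kernel I z) * (1 - cmod z) powr (- q) * green z a powr p) \<partial>disc_area)
      \<le> (\<integral>\<^sup>+z. ennreal (4 powr p * A powr p * ?s ^ 3) * ennreal (\<Phi> z) \<partial>disc_area)"
    using s by (intro nn_integral_mono) (auto simp: simp flip: ennreal_mult' intro!: ennreal_leI pw)
  also have "\<dots> = ennreal (4 powr p * A powr p * ?s ^ 3) * (\<integral>\<^sup>+z. ennreal (\<Phi> z) \<partial>disc_area)"
    by (rule nn_integral_cmult[OF \<Phi>m])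
  also have "\<dots> \<le> ennreal (4 powr p * A powr p * ?s ^ 3) * ennreal (16 * (?c1 + ?c2) * (d powr (- 2 * p) * ?s powr (q - 1)))"
    by (intro mult_left_mono int\<Phi>) auto
  also have "\<dots> = ennreal (4 powr p * A powr p * ?s ^ 3 * (16 * (?c1 + ?c2) * (d powr (- 2 * p) * ?s powr (q - 1))))"
    using s by (subst ennreal_mult') auto
  also have "4 powr p * A powr p * ?s ^ 3 * (16 * (?c1 + ?c2) * (d powr (- 2 * p) * ?s powr (q - 1)))
      = (16 * 4 powr p * (?c1 + ?c2)) * (?s powr 3 * ?s powr (q - 1)) * (A powr p * d powr (- 2 * p))"
    using s by (simp add: mult_ac)
  also have "?s powr 3 * ?s powr (q - 1) = ?s powr (2 + q)" by (simp del: powr_numeral flip: powr_add)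
  also have "A powr p * d powr (- 2 * p) = (A / d\<^sup>2) powr p"
  proof -
    have "(d\<^sup>2) powr p = d powr (2 * p)" using d0 by (simp add: powr_powr flip: powr_numeral)
    then show ?thesis using A0 d0 by (simp add: powr_divide powr_minus_divide)
  qed
  also have "16 * 4 powr p * (?c1 + ?c2) = kernel_green_const p"
    by (simp add: kernel_green_const_def q_def)
  finally show ?thesis by (simp add: q_def A_def d_def)
qed

lemma sum_UN_le_sum:
  fixes f :: "'a \<Rightarrow> real"
  assumes "finite A" "\<And>J. finite (B J)" "\<And>x. 0 \<le> f x"
  shows "sum f (\<Union>J\<in>A. B J) \<le> (\<Sum>J\<in>A. sum f (B J))"
  using assms(1)
proof (induction A rule: finite_induct)
  case (insert J A)
  have "finite (\<Union>J\<in>A. B J)" using insert.hyps(1) assms(2) by simp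
  then have "sum f (B J \<union> (\<Union>J\<in>A. B J)) + sum f (B J \<inter> (\<Union>J\<in>A. B J)) = sum f (B J) + sum f (\<Union>J\<in>A. B J)"
    by (rule sum.union_inter[OF assms(2)])
  moreover have "0 \<le> sum f (B J \<inter> (\<Union>J\<in>A. B J))" using assms(3) by (intro sum_nonneg)
  ultimately show ?case using insert.IH insert.hyps by simp
qed simp

definition packing_const :: "real \<Rightarrow> real" where
  "packing_const p = 13448 / (1 - 2 powr (- p))"

definition test_function_const :: "real \<Rightarrow> real" where
  "test_function_const p = 4096 / (1 - 2 powr (- (p / 2))) * (kernel_green_const p * packing_const p)"

lemma test_function_const_nonneg:
  assumes "0 < p" "p \<le> 1"
  shows "0 \<le> test_function_const p"
proof -
  have "2 powr (- (p / 2)) \<le> (1::real)" "2 powr (- p) \<le> (1::real)"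
    by (rule two_powr_le_one, use assms in simp)+
  then show ?thesis
    unfolding test_function_const_def packing_const_def
    using kernel_green_const_nonneg[OF assms] by (intro mult_nonneg_nonneg) auto
qed

context dyadic_tree
begin

text \<open>Packings are Carleson measures: the arcs whose box centre lies within \<open>R\<close> of \<open>a\<close> are covered by boundedly many arcs of
  length comparable to \<open>R\<close>.\<close>

lemma packing_mass_near_le:
  assumes a: "a \<in> unit_disc" and p: "0 < p" "p \<le> 1" and R: "0 < R"
    and \<mu>: "\<And>I. 0 \<le> \<mu> I"
    and packing: "\<And>J. J \<in> levels N \<Longrightarrow> (\<Sum>I | I \<in> levels N \<and> I \<subseteq> J. \<mu> I) \<le> arc_len J powr p"
  shows "(\<Sum>I | I \<in> levels N \<and> cmod (1 - cnj a * box_centre I) < R. \<mu> I) \<le> 6724 * R powr p"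
proof -
  let ?S = "levels N"
  have fin: "finite ?S" and nod: "?S \<subseteq> nodes" using finite_level by (auto simp: nodes_def)
  define T where "T = {I. I \<in> ?S \<and> cmod (1 - cnj a * box_centre I) < R}"
  have finT: "finite T" unfolding T_def using fin by simp
  have TS: "T \<subseteq> ?S" by (auto simp: T_def)
  show ?thesis
  proof (cases "1 / 2 \<le> R")
    case True
    have circ: "unit_circle \<in> ?S" using root by auto
    have "T \<subseteq> {I. I \<in> ?S \<and> I \<subseteq> unit_circle}" using TS nod circle_node(2) by blast
    then have "sum \<mu> T \<le> (\<Sum>I | I \<in> ?S \<and> I \<subseteq> unit_circle. \<mu> I)"
      using fin \<mu> by (intro sum_mono2) auto
    also have "\<dots> \<le> 1" using packing[OF circ] circle_node(3) by simp
    also have "1 \<le> (2 * R) powr p" using True p by (intro ge_one_powr_ge_zero) auto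
    also have "\<dots> = 2 powr p * R powr p" by (rule powr_mult)
    also have "\<dots> \<le> 2 powr 1 * R powr p" using p by (intro mult_right_mono powr_mono) auto
    also have "\<dots> \<le> 6724 * R powr p" by simp
    finally show ?thesis by (simp add: T_def)
  next
    case False
    \<comment> \<open>The generation with \<open>2 R \<le> 2\<^sup>-\<^sup>j < 4 R\<close>: its arcs are longer than every arc of \<open>T\<close>.\<close>
    define j where "j = nat \<lfloor>log 2 (1 / (2 * R))\<rfloor>"
    have "0 \<le> log 2 (1 / (2 * R))" using False R by simp
    then have j: "real j \<le> log 2 (1 / (2 * R))" "log 2 (1 / (2 * R)) < real j + 1" by (auto simp: j_def)
    then have "2 ^ j \<le> 1 / (2 * R)" "1 / (2 * R) < 2 ^ (j + 1)"
      using R by (auto simp: le_log_iff log_less_iff powr_add powr_realpow)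
    then have jR: "2 * R \<le> 1 / 2 ^ j" "1 / 2 ^ j < 4 * R" using R by (auto simp: field_simps)
    define \<J> where "\<J> = {J \<in> L j. \<exists>I\<in>T. I \<subseteq> J}"
    have fin\<J>: "finite \<J>" unfolding \<J>_def using finite_level by simp
    have TI: "\<exists>J\<in>\<J>. I \<subseteq> J \<and> J \<in> ?S \<and> cmod (box_centre J - a) \<le> 5 * (1 / 2 ^ j)" if I: "I \<in> T" for I
    proof -
      obtain m where m: "I \<in> L m" "m \<le> N" using I TS by auto
      have arcI: "half_open_arc I" using arc[OF m(1)] .
      have wI: "box_centre I \<in> unit_disc" by (rule box_centre_in_disc[OF arcI])
      have near: "cmod (1 - cnj a * box_centre I) < R" using I by (simp add: T_def)
      have "3 / 4 * arc_len I < R"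
        using cmod_one_minus_bounds(3)[OF a wI] near cmod_box_centre[OF arcI] by simp
      then have "1 / 2 ^ m < 1 / (2::real) ^ j" using len[OF m(1)] jR by simp
      then have "(2::real) ^ j < 2 ^ m" by (simp add: field_simps)
      then have jm: "j \<le> m" by simp
      obtain J where J: "J \<in> L j" "I \<subseteq> J" using ancestor[OF m(1) jm] by blast
      have "cmod (box_centre J - a) \<le> cmod (box_centre I - box_centre J) + cmod (box_centre I - a)"
        using norm_triangle_ineq4[of "box_centre I - a" "box_centre I - box_centre J"] by simp
      also have "\<dots> \<le> 4 * arc_len J + R"
        using box_centre_near[OF arcI arc[OF J(1)] J(2)] cmod_one_minus_bounds(1)[OF a wI] near by linarith
      also have "\<dots> \<le> 5 * (1 / 2 ^ j)" using len[OF J(1)] jR R by simp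
      finally have near': "cmod (box_centre J - a) \<le> 5 * (1 / 2 ^ j)" .
      have "J \<in> \<J>" using J I unfolding \<J>_def by blast
      moreover have "J \<in> ?S" using J(1) jm m(2) by force
      ultimately show ?thesis using J(2) near' by blast
    qed
    have "real (card \<J>) \<le> (8 * 5 + 1)\<^sup>2"
    proof (rule card_near_le[OF fin\<J>, where \<rho> = "1 / 2 ^ j" and u = a])
      show "\<J> \<subseteq> nodes" by (auto simp: \<J>_def nodes_def)
      fix J assume J: "J \<in> \<J>"
      then have JL: "J \<in> L j" by (simp add: \<J>_def)
      show "1 / 2 ^ j \<le> arc_len J" using len[OF JL] by simp
      obtain I where I: "I \<in> T" "I \<subseteq> J" using J by (auto simp: \<J>_def)
      obtain J' where J': "J' \<in> \<J>" "I \<subseteq> J'" "cmod (box_centre J' - a) \<le> 5 * (1 / 2 ^ j)" using TI[OF I(1)] by blast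
      have "I \<noteq> {}" using node_nonempty nod TS I(1) by blast
      then have "J' = J" using level_unique[of J' j J] J'(1,2) JL I(2) by (auto simp: \<J>_def)
      then show "cmod (box_centre J - a) \<le> 5 * (1 / 2 ^ j)" using J'(3) by simp
    qed auto
    then have card: "real (card \<J>) \<le> 1681" by simp
    have "sum \<mu> T \<le> sum \<mu> (\<Union>J\<in>\<J> \<inter> ?S. {I. I \<in> ?S \<and> I \<subseteq> J})"
    proof (rule sum_mono2)
      show "T \<subseteq> (\<Union>J\<in>\<J> \<inter> ?S. {I. I \<in> ?S \<and> I \<subseteq> J})"
      proof
        fix I assume I: "I \<in> T"
        then obtain J where "J \<in> \<J>" "I \<subseteq> J" "J \<in> ?S" using TI by blast
        moreover have "I \<in> ?S" using TS I by (rule subsetD)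
        ultimately show "I \<in> (\<Union>J\<in>\<J> \<inter> ?S. {I. I \<in> ?S \<and> I \<subseteq> J})"
          by (intro UN_I[of J] IntI CollectI conjI)
      qed
    next
      show "finite (\<Union>J\<in>\<J> \<inter> ?S. {I. I \<in> ?S \<and> I \<subseteq> J})"
        by (rule finite_subset[OF _ fin]) blast
    qed (rule \<mu>)
    also have "\<dots> \<le> (\<Sum>J\<in>\<J> \<inter> ?S. sum \<mu> {I. I \<in> ?S \<and> I \<subseteq> J})"
    proof (rule sum_UN_le_sum)
      show "finite (\<J> \<inter> ?S)" using fin\<J> by simp
      show "finite {I. I \<in> ?S \<and> I \<subseteq> J}" for J using fin by simp
    qed (rule \<mu>)
    also have "\<dots> \<le> (\<Sum>J\<in>\<J> \<inter> ?S. (1 / 2 ^ j) powr p)"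
    proof (rule sum_mono)
      fix J assume J: "J \<in> \<J> \<inter> ?S"
      then have "arc_len J = 1 / 2 ^ j" using len[of J j] by (auto simp: \<J>_def)
      then show "sum \<mu> {I. I \<in> ?S \<and> I \<subseteq> J} \<le> (1 / 2 ^ j) powr p" using packing[of J] J by simp
    qed
    also have "\<dots> = real (card (\<J> \<inter> ?S)) * (1 / 2 ^ j) powr p" by simp
    also have "\<dots> \<le> 1681 * (4 powr p * R powr p)"
    proof (intro mult_mono)
      have "card (\<J> \<inter> ?S) \<le> card \<J>" using fin\<J> by (intro card_mono) auto
      then show "real (card (\<J> \<inter> ?S)) \<le> 1681" using card by linarith
      have "(1 / 2 ^ j) powr p \<le> (4 * R) powr p" using jR p by (intro powr_mono2) auto
      then show "(1 / 2 ^ j) powr p \<le> 4 powr p * R powr p" by (simp add: powr_mult)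
    qed auto
    also have "\<dots> \<le> 1681 * (4 powr 1 * R powr p)"
      using p by (intro mult_left_mono mult_right_mono powr_mono) auto
    finally show ?thesis by (simp add: T_def)
  qed
qed

text \<open>Summation over the shells where \<open>|1 - cnj a w|\<close> is comparable to \<open>2\<^sup>k (1 - |a|)\<close>: the packing mass of a shell grows like
  \<open>2\<^sup>k\<^sup>p\<close> and the summand decays like \<open>2\<^sup>-\<^sup>2\<^sup>k\<^sup>p\<close>.\<close>

lemma packing_carleson_le:
  assumes a: "a \<in> unit_disc" and p: "0 < p" "p \<le> 1"
    and \<mu>: "\<And>I. 0 \<le> \<mu> I"
    and packing: "\<And>J. J \<in> levels N \<Longrightarrow> (\<Sum>I | I \<in> levels N \<and> I \<subseteq> J. \<mu> I) \<le> arc_len J powr p"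
  shows "(\<Sum>I\<in>levels N. \<mu> I * ((1 - cmod a) / (cmod (1 - cnj a * box_centre I))\<^sup>2) powr p) \<le> packing_const p"
proof -
  let ?S = "levels N"
  have fin: "finite ?S" and nod: "?S \<subseteq> nodes" using finite_level by (auto simp: nodes_def)
  define A where "A = 1 - cmod a"
  define d where "d I = cmod (1 - cnj a * box_centre I)" for I
  have A: "0 < A" "A \<le> 1" using a by (auto simp: A_def)
  define \<theta> where "\<theta> = 2 powr (- p)"
  have \<theta>: "0 < \<theta>" "\<theta> < 1" using p powr_less_mono[of "- p" 0 2] by (auto simp: \<theta>_def)
  define K where "K = nat \<lfloor>log 2 (2 / A)\<rfloor> + 1"
  define c where "c k = \<theta> ^ (2 * k) * A powr (- p)" for k
  have pw: "(A / (d I)\<^sup>2) powr p \<le> (\<Sum>k<K. c k * of_bool (d I < 2 ^ (k + 1) * A))" if I: "I \<in> ?S" for I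
  proof -
    have wI: "box_centre I \<in> unit_disc" using box_centre_in_disc[OF node_arc] nod I by blast
    have dA: "A \<le> d I" "d I \<le> 2" "0 < d I" unfolding A_def d_def
      using cmod_one_minus_bounds(2,4,5)[OF a wI] by auto
    define k where "k = nat \<lfloor>log 2 (d I / A)\<rfloor>"
    have "0 \<le> log 2 (d I / A)" using dA A by simp
    then have k: "real k \<le> log 2 (d I / A)" "log 2 (d I / A) < real k + 1" by (auto simp: k_def)
    then have "2 ^ k \<le> d I / A" "d I / A < 2 ^ (k + 1)"
      using dA A by (auto simp: le_log_iff log_less_iff powr_add powr_realpow)
    then have kd: "2 ^ k * A \<le> d I" "d I < 2 ^ (k + 1) * A" using A by (auto simp: field_simps)
    have "log 2 (d I / A) \<le> log 2 (2 / A)" using dA A by (intro log_mono divide_right_mono) auto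
    then have kK: "k < K" unfolding k_def K_def by (simp add: floor_mono nat_mono less_Suc_eq_le)
    have "(A / (d I)\<^sup>2) powr p \<le> (A / (2 ^ k * A)\<^sup>2) powr p"
      using kd A dA p by (intro powr_mono2 divide_left_mono power_mono mult_pos_pos) auto
    also have "A / (2 ^ k * A)\<^sup>2 = (1 / 2) ^ (2 * k) / A" using A by (simp add: power2_eq_square power_divide power_mult_distrib power_mult field_simps)
    also have "\<dots> powr p = c k"
    proof -
      have "((1 / 2) ^ (2 * k) / A) powr p = ((1 / 2) ^ (2 * k)) powr p / A powr p" using A by (simp add: powr_divide)
      also have "((1 / 2 :: real) ^ (2 * k)) powr p = ((1 / 2) powr p) ^ (2 * k)"
        by (simp add: powr_powr mult.commute flip: powr_realpow)
      also have "(1 / 2 :: real) powr p = \<theta>" by (simp add: \<theta>_def powr_divide powr_minus_divide)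
      finally show ?thesis by (simp add: c_def powr_minus_divide)
    qed
    also have "c k = c k * of_bool (d I < 2 ^ (k + 1) * A)" using kd by simp
    also have "\<dots> \<le> (\<Sum>k<K. c k * of_bool (d I < 2 ^ (k + 1) * A))"
      using kK \<theta> by (intro member_le_sum) (auto simp: c_def)
    finally show ?thesis .
  qed
  have "(\<Sum>I\<in>?S. \<mu> I * (A / (d I)\<^sup>2) powr p) \<le> (\<Sum>I\<in>?S. \<mu> I * (\<Sum>k<K. c k * of_bool (d I < 2 ^ (k + 1) * A)))"
    by (intro sum_mono mult_left_mono pw \<mu>)
  also have "\<dots> = (\<Sum>k<K. c k * (\<Sum>I\<in>?S. \<mu> I * of_bool (d I < 2 ^ (k + 1) * A)))"
    unfolding sum_distrib_left by (subst sum.swap) (simp only: mult.left_commute)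
  also have "\<dots> \<le> (\<Sum>k<K. c k * (6724 * (2 ^ (k + 1) * A) powr p))"
  proof (intro sum_mono mult_left_mono)
    fix k
    have "(\<Sum>I\<in>?S. \<mu> I * of_bool (d I < 2 ^ (k + 1) * A)) = (\<Sum>I | I \<in> ?S \<and> d I < 2 ^ (k + 1) * A. \<mu> I)"
      using fin by (intro sum.mono_neutral_cong_right) auto
    also have "\<dots> \<le> 6724 * (2 ^ (k + 1) * A) powr p"
      unfolding d_def by (rule packing_mass_near_le[OF a p _ \<mu> packing]) (use A in auto)
    finally show "(\<Sum>I\<in>?S. \<mu> I * of_bool (d I < 2 ^ (k + 1) * A)) \<le> 6724 * (2 ^ (k + 1) * A) powr p" .
    show "0 \<le> c k" using \<theta> by (simp add: c_def)
  qed
  also have "\<dots> = (\<Sum>k<K. 6724 * 2 powr p * \<theta> ^ k)"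
  proof (rule sum.cong[OF refl])
    fix k
    have "(2 ^ (k + 1) * A) powr p = (2 powr p) ^ (k + 1) * A powr p"
    proof -
      have "((2::real) ^ (k + 1)) powr p = (2 powr p) ^ (k + 1)"
        by (simp only: powr_realpow[symmetric] powr_powr zero_less_numeral powr_gt_zero) (simp add: mult.commute)
      then show ?thesis by (simp add: powr_mult)
    qed
    moreover have "\<theta> * 2 powr p = 1" by (simp add: \<theta>_def flip: powr_add)
    then have "\<theta> ^ k * (2 powr p) ^ k = 1" by (simp flip: power_mult_distrib)
    moreover have "A powr (- p) * A powr p = 1" using A by (simp flip: powr_add)
    moreover have "\<theta> ^ (2 * k) = \<theta> ^ k * \<theta> ^ k" by (simp add: mult_2 power_add)
    then have "c k * (6724 * ((2 powr p) ^ (k + 1) * A powr p))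
      = 6724 * 2 powr p * \<theta> ^ k * (\<theta> ^ k * (2 powr p) ^ k) * (A powr (- p) * A powr p)"
      by (simp only: c_def power_add power_one_right mult_ac)
    ultimately show "c k * (6724 * (2 ^ (k + 1) * A) powr p) = 6724 * 2 powr p * \<theta> ^ k" by simp
  qed
  also have "\<dots> = 6724 * 2 powr p * (\<Sum>k<K. \<theta> ^ k)" by (simp only: sum_distrib_left)
  also have "\<dots> \<le> 6724 * 2 powr 1 * (1 / (1 - \<theta>))"
  proof (intro mult_mono)
    have "(\<Sum>k<K. \<theta> ^ k) = (1 - \<theta> ^ K) / (1 - \<theta>)" using \<theta> by (simp add: sum_gp_strict)
    also have "\<dots> \<le> 1 / (1 - \<theta>)" using \<theta> by (intro divide_right_mono) auto
    finally show "(\<Sum>k<K. \<theta> ^ k) \<le> 1 / (1 - \<theta>)" .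
    show "2 powr p \<le> (2::real) powr 1" using powr_mono[of p 1 2] p by simp
  qed (use \<theta> in \<open>auto intro: sum_nonneg\<close>)
  finally show ?thesis by (simp add: A_def d_def packing_const_def \<theta>_def)
qed

text \<open>By Cauchy--Schwarz the estimate is insensitive to the signs \<open>\<epsilon>\<close>: \<open>|f|\<^sup>2\<close> is at most a power of \<open>1 - |z|\<close> times a positive
  combination of the kernels, each of which has been integrated against the Green function.\<close>

lemma signed_kernel_sum_seminorm_le:
  assumes p: "0 < p" "p \<le> 1"
    and \<mu>: "\<And>I. 0 \<le> \<mu> I"
    and packing: "\<And>J. J \<in> levels N \<Longrightarrow> (\<Sum>I | I \<in> levels N \<and> I \<subseteq> J. \<mu> I) \<le> arc_len J powr p"
    and \<epsilon>: "\<And>I. \<bar>\<epsilon> I\<bar> = (1::real)"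
    and F: "\<And>z. z \<in> unit_disc \<Longrightarrow>
      deriv F z = (\<Sum>I\<in>levels N. of_real (\<epsilon> I) * (of_real (sqrt (\<mu> I / arc_len I powr (p + 2))) * box_kernel I z))"
  shows "Qp_seminorm_sq p F \<le> ennreal (test_function_const p)"
  unfolding Qp_seminorm_sq_def
proof (rule SUP_least)
  let ?S = "levels N"
  have fin: "finite ?S" and nod: "?S \<subseteq> nodes" using finite_level by (auto simp: nodes_def)
  fix a assume a: "a \<in> unit_disc"
  define q where "q = p / 2"
  have q: "0 < q" "q \<le> 1" using p by (auto simp: q_def)
  define C0 where "C0 = 4096 / (1 - 2 powr (- q))"
  have C0: "0 \<le> C0"
  proof -
    have "2 powr (- q) \<le> (1::real)" by (rule two_powr_le_one) (use q in simp)
    then show ?thesis by (simp add: C0_def)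
  qed
  define m where "m I = \<mu> I * arc_len I powr (q - p - 2)" for I
  define X where "X I z = cmod (box_kernel I z) * (1 - cmod z) powr (- q) * green z a powr p" for I z
  have m0: "0 \<le> m I" for I using \<mu> by (simp add: m_def)
  have pos: "0 < arc_len I" if "I \<in> ?S" for I using half_open_arcE(1)[OF node_arc] nod that by blast
  have pw: "(cmod (deriv F z))\<^sup>2 * green z a powr p \<le> (\<Sum>I\<in>?S. C0 * m I * X I z)" if z: "z \<in> unit_disc" for z
  proof -
    let ?k = "\<lambda>I. cmod (box_kernel I z)" and ?c = "\<lambda>I. sqrt (\<mu> I / arc_len I powr (p + 2))"
    have "cmod (deriv F z) \<le> (\<Sum>I\<in>?S. cmod (of_real (\<epsilon> I) * (of_real (?c I) * box_kernel I z)))"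
      unfolding F[OF z] by (rule norm_sum)
    also have "\<dots> = (\<Sum>I\<in>?S. sqrt (arc_len I powr (- q) * ?k I) * sqrt (m I * ?k I))"
    proof (rule sum.cong[OF refl])
      fix I assume I: "I \<in> ?S"
      have e: "arc_len I powr (- q) * arc_len I powr (q - p - 2) = 1 / arc_len I powr (p + 2)"
        by (simp only: powr_add[symmetric] powr_minus_divide[symmetric]) simp
      have "sqrt (arc_len I powr (- q) * ?k I) * sqrt (m I * ?k I)
          = sqrt ((\<mu> I * (arc_len I powr (- q) * arc_len I powr (q - p - 2))) * (?k I)\<^sup>2)"
        by (simp add: m_def power2_eq_square mult_ac flip: real_sqrt_mult)
      also have "\<dots> = ?c I * ?k I" unfolding e real_sqrt_mult by (simp add: real_sqrt_divide)
      finally show "cmod (of_real (\<epsilon> I) * (of_real (?c I) * box_kernel I z)) = sqrt (arc_len I powr (- q) * ?k I) * sqrt (m I * ?k I)"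
        using \<mu>[of I] by (simp add: norm_mult \<epsilon>)
    qed
    finally have "(cmod (deriv F z))\<^sup>2 \<le> (\<Sum>I\<in>?S. sqrt (arc_len I powr (- q) * ?k I) * sqrt (m I * ?k I))\<^sup>2"
      by (rule power_mono) simp
    also have "\<dots> \<le> (\<Sum>I\<in>?S. (sqrt (arc_len I powr (- q) * ?k I))\<^sup>2) * (\<Sum>I\<in>?S. (sqrt (m I * ?k I))\<^sup>2)"
      by (rule Cauchy_Schwarz_ineq_sum)
    also have "\<dots> = (\<Sum>I\<in>?S. arc_len I powr (- q) * ?k I) * (\<Sum>I\<in>?S. m I * ?k I)"
      using m0 by (simp add: real_sqrt_pow2)
    also have "\<dots> \<le> (C0 * (1 - cmod z) powr (- q)) * (\<Sum>I\<in>?S. m I * ?k I)"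
      unfolding C0_def using m0 by (intro mult_right_mono sum_box_kernel_le fin nod q z sum_nonneg) auto
    finally have "(cmod (deriv F z))\<^sup>2 * green z a powr p
        \<le> (C0 * (1 - cmod z) powr (- q)) * (\<Sum>I\<in>?S. m I * ?k I) * green z a powr p"
      by (rule mult_right_mono) simp
    also have "\<dots> = (\<Sum>I\<in>?S. C0 * m I * X I z)"
      by (simp only: X_def sum_distrib_left sum_distrib_right mult_ac)
    finally show ?thesis .
  qed
  have X0: "0 \<le> X I z" for I z by (simp add: X_def)
  have Xm: "(\<lambda>z. ennreal (X I z)) \<in> borel_measurable disc_area" for I
    unfolding X_def box_kernel_def green_def disc_automorphism_def
    by (rule borel_measurable_disc_area) measurable
  have "(\<integral>\<^sup>+z. ennreal ((cmod (deriv F z))\<^sup>2 * green z a powr p) \<partial>disc_area)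
      \<le> (\<integral>\<^sup>+z. (\<Sum>I\<in>?S. ennreal (C0 * m I) * ennreal (X I z)) \<partial>disc_area)"
  proof (rule nn_integral_mono)
    fix z assume "z \<in> space disc_area"
    then have "ennreal ((cmod (deriv F z))\<^sup>2 * green z a powr p) \<le> ennreal (\<Sum>I\<in>?S. C0 * m I * X I z)"
      by (intro ennreal_leI pw) simp
    also have "\<dots> = (\<Sum>I\<in>?S. ennreal (C0 * m I * X I z))"
      using C0 m0 X0 by (intro sum_ennreal[symmetric]) simp
    also have "\<dots> = (\<Sum>I\<in>?S. ennreal (C0 * m I) * ennreal (X I z))"
      using C0 m0 X0 by (simp add: ennreal_mult)
    finally show "ennreal ((cmod (deriv F z))\<^sup>2 * green z a powr p) \<le> \<dots>" .
  qed
  also have "\<dots> = (\<Sum>I\<in>?S. ennreal (C0 * m I) * (\<integral>\<^sup>+z. ennreal (X I z) \<partial>disc_area))"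
    by (simp only: nn_integral_sum nn_integral_cmult Xm borel_measurable_times_ennreal borel_measurable_const)
  also have "\<dots> \<le> (\<Sum>I\<in>?S. ennreal (C0 * m I) * ennreal (kernel_green_const p * arc_len I powr (2 + p / 2)
          * ((1 - cmod a) / (cmod (1 - cnj a * box_centre I))\<^sup>2) powr p))"
  proof (intro sum_mono mult_left_mono)
    fix I assume "I \<in> ?S"
    then have "half_open_arc I" using node_arc nod by blast
    from kernel_green_integral_le[OF this a p]
    show "(\<integral>\<^sup>+z. ennreal (X I z) \<partial>disc_area) \<le> ennreal (kernel_green_const p * arc_len I powr (2 + p / 2)
          * ((1 - cmod a) / (cmod (1 - cnj a * box_centre I))\<^sup>2) powr p)"
      by (simp add: X_def q_def)
  qed auto
  also have "\<dots> = (\<Sum>I\<in>?S. ennreal (C0 * kernel_green_const p * (\<mu> I * ((1 - cmod a) / (cmod (1 - cnj a * box_centre I))\<^sup>2) powr p)))"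
  proof (rule sum.cong[OF refl])
    fix I assume I: "I \<in> ?S"
    have e: "arc_len I powr (q - p - 2) * arc_len I powr (2 + p / 2) = 1"
      using pos[OF I] by (simp add: q_def flip: powr_add)
    have "C0 * m I * (kernel_green_const p * arc_len I powr (2 + p / 2) * ((1 - cmod a) / (cmod (1 - cnj a * box_centre I))\<^sup>2) powr p)
        = C0 * kernel_green_const p * (\<mu> I * ((1 - cmod a) / (cmod (1 - cnj a * box_centre I))\<^sup>2) powr p)
            * (arc_len I powr (q - p - 2) * arc_len I powr (2 + p / 2))"
      by (simp only: m_def mult_ac)
    note eq = this[unfolded e mult_1_right]
    show "ennreal (C0 * m I) * ennreal (kernel_green_const p * arc_len I powr (2 + p / 2)
          * ((1 - cmod a) / (cmod (1 - cnj a * box_centre I))\<^sup>2) powr p)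
        = ennreal (C0 * kernel_green_const p * (\<mu> I * ((1 - cmod a) / (cmod (1 - cnj a * box_centre I))\<^sup>2) powr p))"
      unfolding eq[symmetric] by (rule ennreal_mult'[symmetric]) (use C0 m0[of I] in simp)
  qed
  also have "\<dots> = ennreal (\<Sum>I\<in>?S. C0 * kernel_green_const p * (\<mu> I * ((1 - cmod a) / (cmod (1 - cnj a * box_centre I))\<^sup>2) powr p))"
    using C0 \<mu> kernel_green_const_nonneg[OF p] by (intro sum_ennreal mult_nonneg_nonneg) auto
  also have "\<dots> \<le> ennreal (test_function_const p)"
  proof (rule ennreal_leI)
    have "(\<Sum>I\<in>?S. C0 * kernel_green_const p * (\<mu> I * ((1 - cmod a) / (cmod (1 - cnj a * box_centre I))\<^sup>2) powr p))
        = C0 * kernel_green_const p * (\<Sum>I\<in>?S. \<mu> I * ((1 - cmod a) / (cmod (1 - cnj a * box_centre I))\<^sup>2) powr p)"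
      by (simp only: sum_distrib_left)
    also have "\<dots> \<le> C0 * kernel_green_const p * packing_const p"
      using C0 kernel_green_const_nonneg[OF p]
      by (intro mult_left_mono packing_carleson_le[OF a p \<mu> packing] mult_nonneg_nonneg)
    also have "\<dots> = test_function_const p"
      by (simp add: test_function_const_def C0_def q_def)
    finally show "(\<Sum>I\<in>?S. C0 * kernel_green_const p * (\<mu> I * ((1 - cmod a) / (cmod (1 - cnj a * box_centre I))\<^sup>2) powr p))
        \<le> test_function_const p" .
  qed
  finally show "(\<integral>\<^sup>+z. ennreal ((cmod (deriv F z))\<^sup>2 * green z a powr p) \<partial>disc_area) \<le> ennreal (test_function_const p)" .
qed

end

section \<open>Averaging over signs\<close>

text \<open>The integral of the square function is the average over all signs of the integrals of the signed sums; the induction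
  uses the parallelogram law for one sign at a time.\<close>

lemma sign_average:
  fixes f :: "'i \<Rightarrow> complex \<Rightarrow> complex"
  assumes S: "finite S" and f: "\<And>I. I \<in> S \<Longrightarrow> f I \<in> borel_measurable M" and g: "g \<in> borel_measurable M"
    and V: "V \<in> borel_measurable M"
    and B: "\<And>\<epsilon> :: 'i \<Rightarrow> real. (\<And>I. \<bar>\<epsilon> I\<bar> = 1) \<Longrightarrow>
        (\<integral>\<^sup>+z. ennreal ((cmod (g z + (\<Sum>I\<in>S. of_real (\<epsilon> I) * f I z)))\<^sup>2) * V z \<partial>M) \<le> B"
  shows "(\<integral>\<^sup>+z. ennreal ((cmod (g z))\<^sup>2 + (\<Sum>I\<in>S. (cmod (f I z))\<^sup>2)) * V z \<partial>M) \<le> B"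
  using S f g B
proof (induction S arbitrary: g rule: finite_induct)
  case empty
  from empty.prems(3)[of "\<lambda>_. 1"] show ?case by simp
next
  case (insert x S)
  note [measurable] = insert.prems(1)[OF insertI1] insert.prems(2) V
  have [measurable]: "f I \<in> borel_measurable M" if "I \<in> S" for I using insert.prems(1) that by blast
  define Q where "Q z = (\<Sum>I\<in>S. (cmod (f I z))\<^sup>2)" for z
  have Q0: "0 \<le> Q z" for z unfolding Q_def by (intro sum_nonneg) auto
  have Qm [measurable]: "Q \<in> borel_measurable M" unfolding Q_def[abs_def] by measurable
  have IH: "(\<integral>\<^sup>+z. ennreal ((cmod (g z + of_real s * f x z))\<^sup>2 + Q z) * V z \<partial>M) \<le> B" if s: "\<bar>s\<bar> = 1" for s :: real
    unfolding Q_def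
  proof (rule insert.IH)
    show "f I \<in> borel_measurable M" if "I \<in> S" for I using insert.prems(1) that by blast
    show "(\<lambda>z. g z + of_real s * f x z) \<in> borel_measurable M" by measurable
    fix \<epsilon> :: "'i \<Rightarrow> real" assume \<epsilon>: "\<And>I. \<bar>\<epsilon> I\<bar> = 1"
    have "(\<integral>\<^sup>+z. ennreal ((cmod (g z + (\<Sum>I\<in>insert x S. of_real ((\<epsilon>(x := s)) I) * f I z)))\<^sup>2) * V z \<partial>M) \<le> B"
      by (rule insert.prems(3)) (use \<epsilon> s in auto)
    moreover have "(\<Sum>I\<in>insert x S. of_real ((\<epsilon>(x := s)) I) * f I z)
        = of_real s * f x z + (\<Sum>I\<in>S. of_real (\<epsilon> I) * f I z)" for z
    proof -
      have "(\<Sum>I\<in>S. of_real ((\<epsilon>(x := s)) I) * f I z) = (\<Sum>I\<in>S. of_real (\<epsilon> I) * f I z)"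
        using insert.hyps by (intro sum.cong) auto
      then show ?thesis using insert.hyps by simp
    qed
    ultimately show "(\<integral>\<^sup>+z. ennreal ((cmod (g z + of_real s * f x z + (\<Sum>I\<in>S. of_real (\<epsilon> I) * f I z)))\<^sup>2) * V z \<partial>M) \<le> B"
      by (simp only: add.assoc)
  qed
  have par: "(cmod (g z + of_real 1 * f x z))\<^sup>2 + Q z + ((cmod (g z + of_real (- 1) * f x z))\<^sup>2 + Q z)
      = 2 * ((cmod (g z))\<^sup>2 + (\<Sum>I\<in>insert x S. (cmod (f I z))\<^sup>2))" for z
    unfolding sum.insert[OF insert.hyps] Q_def[symmetric]
    by (simp add: cmod_power2) (simp add: power2_eq_square algebra_simps)
  have "2 * (\<integral>\<^sup>+z. ennreal ((cmod (g z))\<^sup>2 + (\<Sum>I\<in>insert x S. (cmod (f I z))\<^sup>2)) * V z \<partial>M)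
      = (\<integral>\<^sup>+z. 2 * (ennreal ((cmod (g z))\<^sup>2 + (\<Sum>I\<in>insert x S. (cmod (f I z))\<^sup>2)) * V z) \<partial>M)"
    unfolding sum.insert[OF insert.hyps] Q_def[symmetric] by (rule nn_integral_cmult[symmetric]) measurable
  also have "\<dots> = (\<integral>\<^sup>+z. ennreal ((cmod (g z + of_real 1 * f x z))\<^sup>2 + Q z) * V z
        + ennreal ((cmod (g z + of_real (- 1) * f x z))\<^sup>2 + Q z) * V z \<partial>M)"
  proof (rule nn_integral_cong)
    fix z
    have "2 * ennreal ((cmod (g z))\<^sup>2 + (\<Sum>I\<in>insert x S. (cmod (f I z))\<^sup>2))
        = ennreal (2 * ((cmod (g z))\<^sup>2 + (\<Sum>I\<in>insert x S. (cmod (f I z))\<^sup>2)))"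
      by (subst ennreal_mult') auto
    also have "\<dots> = ennreal ((cmod (g z + of_real 1 * f x z))\<^sup>2 + Q z) + ennreal ((cmod (g z + of_real (- 1) * f x z))\<^sup>2 + Q z)"
      unfolding par[symmetric] using Q0[of z] by (intro ennreal_plus) auto
    finally show "2 * (ennreal ((cmod (g z))\<^sup>2 + (\<Sum>I\<in>insert x S. (cmod (f I z))\<^sup>2)) * V z)
        = ennreal ((cmod (g z + of_real 1 * f x z))\<^sup>2 + Q z) * V z + ennreal ((cmod (g z + of_real (- 1) * f x z))\<^sup>2 + Q z) * V z"
      by (simp only: mult.assoc[symmetric] distrib_right)
  qed
  also have "\<dots> = (\<integral>\<^sup>+z. ennreal ((cmod (g z + of_real 1 * f x z))\<^sup>2 + Q z) * V z \<partial>M)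
        + (\<integral>\<^sup>+z. ennreal ((cmod (g z + of_real (- 1) * f x z))\<^sup>2 + Q z) * V z \<partial>M)"
    by (rule nn_integral_add) measurable
  also have "\<dots> \<le> B + B" by (intro add_mono IH) auto
  also have "\<dots> = 2 * B" by (rule mult_2[symmetric])
  finally show ?case by (subst (asm) ennreal_mult_le_mult_iff) auto
qed

section \<open>The embedding controls packings\<close>

lemma box_density_finite:
  assumes "(\<integral>\<^sup>+z. ennreal (V z) \<partial>disc_area) < \<infinity>"
  shows "box_density p V I < \<infinity>"
proof -
  have "(\<integral>\<^sup>+z\<in>upper_box I. ennreal (V z) \<partial>disc_area) \<le> (\<integral>\<^sup>+z. ennreal (V z) \<partial>disc_area)"
    by (rule nn_integral_mono) (simp add: indicator_def)
  also note assms
  finally show ?thesis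
    by (simp add: box_density_def ennreal_mult_less_top)
qed

context dyadic_tree
begin

text \<open>By duality it suffices to bound the pairing of the densities with a packing. On the upper box of \<open>I\<close> the kernel is bounded below,
  so the pairing is at most the integral of the square function of the kernels.\<close>

lemma gauge_le_of_test_bound:
  assumes p: "0 < p" "p \<le> 1" and B0: "0 \<le> B"
    and V: "V \<in> borel_measurable disc_area" "\<And>z. z \<in> unit_disc \<Longrightarrow> 0 \<le> V z"
    and fin: "(\<integral>\<^sup>+z. ennreal (V z) \<partial>disc_area) < \<infinity>"
    and test: "\<And>F. F holomorphic_on unit_disc \<Longrightarrow> F 0 = 0 \<Longrightarrow> Qp_seminorm_sq p F \<le> ennreal (test_function_const p) \<Longrightarrow>
        (\<integral>\<^sup>+z. ennreal ((cmod (deriv F z))\<^sup>2 * V z) \<partial>disc_area) \<le> ennreal B"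
  shows "dyadic_gauge p nodes (box_density p V) \<le> ennreal (27681 * B)"
proof (rule dyadic_gauge_le[where \<eta> = "\<lambda>I. enn2real (box_density p V I)"])
  show "box_density p V I = ennreal (enn2real (box_density p V I))" for I
    using box_density_finite[OF fin, of p I] by simp
  fix N and \<mu> :: "complex set \<Rightarrow> real"
  assume \<mu>: "\<And>I. 0 \<le> \<mu> I"
    and packing: "\<And>J. J \<in> levels N \<Longrightarrow> (\<Sum>I | I \<in> levels N \<and> I \<subseteq> J. \<mu> I) \<le> arc_len J powr p"
  let ?S = "levels N"
  have finS: "finite ?S" and nod: "?S \<subseteq> nodes" using finite_level by (auto simp: nodes_def)
  have arcS: "half_open_arc I" if "I \<in> ?S" for I using node_arc nod that by blast
  define f where "f I z = of_real (sqrt (\<mu> I / arc_len I powr (p + 2))) * box_kernel I z" for I z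
  have f_hol: "f I holomorphic_on unit_disc" if "I \<in> ?S" for I
    unfolding f_def[abs_def] by (intro holomorphic_intros box_kernel_holomorphic arcS that)
  have fm: "f I \<in> borel_measurable disc_area" if "I \<in> ?S" for I
    by (intro continuous_on_borel_measurable_disc_area holomorphic_on_imp_continuous_on f_hol that)
  have fm2: "(\<lambda>z. ennreal ((cmod (f I z))\<^sup>2)) \<in> borel_measurable disc_area" if "I \<in> ?S" for I
    using fm[OF that] by measurable
  have Vm: "(\<lambda>z. ennreal (V z)) \<in> borel_measurable disc_area"
    by (rule measurable_compose[OF V(1) measurable_ennreal])
  have "(\<integral>\<^sup>+z. ennreal ((cmod (0::complex))\<^sup>2 + (\<Sum>I\<in>?S. (cmod (f I z))\<^sup>2)) * ennreal (V z) \<partial>disc_area) \<le> ennreal B"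
  proof (rule sign_average[OF finS fm _ Vm, where g = "\<lambda>_. 0"])
    fix \<epsilon> :: "complex set \<Rightarrow> real" assume \<epsilon>: "\<And>I. \<bar>\<epsilon> I\<bar> = 1"
    have hol: "(\<lambda>z. \<Sum>I\<in>?S. of_real (\<epsilon> I) * f I z) holomorphic_on unit_disc"
      by (intro holomorphic_intros f_hol)
    obtain F0 where F0: "\<And>z. z \<in> unit_disc \<Longrightarrow> (F0 has_field_derivative (\<Sum>I\<in>?S. of_real (\<epsilon> I) * f I z)) (at z within unit_disc)"
      using holomorphic_convex_primitive'[OF convex_ball open_ball hol] by blast
    define F where "F z = F0 z - F0 0" for z
    have F': "(F has_field_derivative (\<Sum>I\<in>?S. of_real (\<epsilon> I) * f I z)) (at z)" if "z \<in> unit_disc" for z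
    proof -
      have "(F has_field_derivative (\<Sum>I\<in>?S. of_real (\<epsilon> I) * f I z) - 0) (at z within unit_disc)"
        unfolding F_def[abs_def] by (intro derivative_intros F0 that)
      then show ?thesis using that by (simp add: at_within_open[OF _ open_ball])
    qed
    have dF: "deriv F z = (\<Sum>I\<in>?S. of_real (\<epsilon> I) * f I z)" if "z \<in> unit_disc" for z
      by (rule DERIV_imp_deriv[OF F'[OF that]])
    have F_hol: "F holomorphic_on unit_disc"
      unfolding holomorphic_on_open[OF open_ball] using F' by blast
    have "Qp_seminorm_sq p F \<le> ennreal (test_function_const p)"
      by (rule signed_kernel_sum_seminorm_le[OF p \<mu> packing \<epsilon>]) (simp_all add: dF f_def)
    then have "(\<integral>\<^sup>+z. ennreal ((cmod (deriv F z))\<^sup>2 * V z) \<partial>disc_area) \<le> ennreal B"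
      by (intro test F_hol) (simp_all add: F_def)
    moreover have "(\<integral>\<^sup>+z. ennreal ((cmod (0 + (\<Sum>I\<in>?S. of_real (\<epsilon> I) * f I z)))\<^sup>2) * ennreal (V z) \<partial>disc_area)
        = (\<integral>\<^sup>+z. ennreal ((cmod (deriv F z))\<^sup>2 * V z) \<partial>disc_area)"
      by (rule nn_integral_cong) (simp add: dF ennreal_mult')
    ultimately show "(\<integral>\<^sup>+z. ennreal ((cmod (0 + (\<Sum>I\<in>?S. of_real (\<epsilon> I) * f I z)))\<^sup>2) * ennreal (V z) \<partial>disc_area) \<le> ennreal B"
      by simp
  qed auto
  moreover have "(\<integral>\<^sup>+z. ennreal ((cmod (0::complex))\<^sup>2 + (\<Sum>I\<in>?S. (cmod (f I z))\<^sup>2)) * ennreal (V z) \<partial>disc_area)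
      = (\<Sum>I\<in>?S. \<integral>\<^sup>+z. ennreal ((cmod (f I z))\<^sup>2) * ennreal (V z) \<partial>disc_area)"
  proof -
    have "ennreal ((cmod (0::complex))\<^sup>2 + (\<Sum>I\<in>?S. (cmod (f I z))\<^sup>2)) * ennreal (V z)
        = (\<Sum>I\<in>?S. ennreal ((cmod (f I z))\<^sup>2) * ennreal (V z))" for z
      by (simp add: sum_ennreal sum_distrib_right flip: sum_ennreal)
    then show ?thesis
      by (simp only:) (intro nn_integral_sum borel_measurable_times_ennreal fm2 Vm)
  qed
  ultimately have sq: "(\<Sum>I\<in>?S. \<integral>\<^sup>+z. ennreal ((cmod (f I z))\<^sup>2) * ennreal (V z) \<partial>disc_area) \<le> ennreal B" by simp
  have single: "ennreal (enn2real (box_density p V I) * \<mu> I)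
      \<le> 27681 * (\<integral>\<^sup>+z. ennreal ((cmod (f I z))\<^sup>2) * ennreal (V z) \<partial>disc_area)" if I: "I \<in> ?S" for I
  proof -
    let ?s = "arc_len I"
    have Qm: "(\<lambda>u. indicator (upper_box I) u :: ennreal) \<in> borel_measurable disc_area"
      by (rule borel_measurable_disc_area, rule borel_measurable_indicator, rule borel_upper_box[OF arcS[OF I]])
    have "ennreal (enn2real (box_density p V I) * \<mu> I) = box_density p V I * ennreal (\<mu> I)"
      using box_density_finite[OF fin, of p I] \<mu>[of I] by (simp add: ennreal_mult)
    also have "\<dots> = ennreal (\<mu> I / ?s powr (p + 2)) * (\<integral>\<^sup>+z. ennreal (V z) * indicator (upper_box I) z \<partial>disc_area)"
    proof -
      have "ennreal (\<mu> I / ?s powr (p + 2)) = ennreal (1 / ?s powr (p + 2)) * ennreal (\<mu> I)"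
        using \<mu>[of I] by (subst ennreal_mult[symmetric]) auto
      then show ?thesis unfolding box_density_def by (simp only: mult_ac)
    qed
    also have "\<dots> = (\<integral>\<^sup>+z. ennreal (\<mu> I / ?s powr (p + 2)) * (ennreal (V z) * indicator (upper_box I) z) \<partial>disc_area)"
      by (rule nn_integral_cmult[symmetric]) (intro borel_measurable_times_ennreal Vm Qm)
    also have "\<dots> \<le> (\<integral>\<^sup>+z. 27681 * (ennreal ((cmod (f I z))\<^sup>2) * ennreal (V z)) \<partial>disc_area)"
    proof (rule nn_integral_mono)
      fix z
      show "ennreal (\<mu> I / ?s powr (p + 2)) * (ennreal (V z) * indicator (upper_box I) z)
          \<le> 27681 * (ennreal ((cmod (f I z))\<^sup>2) * ennreal (V z))"
      proof (cases "z \<in> upper_box I")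
        case True
        have "\<mu> I / ?s powr (p + 2) * 1 \<le> \<mu> I / ?s powr (p + 2) * (27681 * (cmod (box_kernel I z))\<^sup>2)"
          using \<mu>[of I] by (intro mult_left_mono box_kernel_lower[OF arcS[OF I] True]) auto
        also have "\<dots> = 27681 * (cmod (f I z))\<^sup>2"
          using \<mu>[of I] by (simp add: f_def norm_mult power_mult_distrib)
        finally have "ennreal (\<mu> I / ?s powr (p + 2)) \<le> 27681 * ennreal ((cmod (f I z))\<^sup>2)"
          by (subst ennreal_numeral[symmetric], subst ennreal_mult'[symmetric]) (auto intro: ennreal_leI)
        then have "ennreal (\<mu> I / ?s powr (p + 2)) * ennreal (V z) \<le> 27681 * ennreal ((cmod (f I z))\<^sup>2) * ennreal (V z)"
          by (rule mult_right_mono) simp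
        then show ?thesis using True by (simp add: mult.assoc)
      qed simp
    qed
    also have "\<dots> = 27681 * (\<integral>\<^sup>+z. ennreal ((cmod (f I z))\<^sup>2) * ennreal (V z) \<partial>disc_area)"
      by (rule nn_integral_cmult) (intro borel_measurable_times_ennreal Vm fm2 I)
    finally show ?thesis .
  qed
  have "ennreal (\<Sum>I\<in>?S. enn2real (box_density p V I) * \<mu> I) = (\<Sum>I\<in>?S. ennreal (enn2real (box_density p V I) * \<mu> I))"
    using \<mu> by (intro sum_ennreal[symmetric]) auto
  also have "\<dots> \<le> (\<Sum>I\<in>?S. 27681 * (\<integral>\<^sup>+z. ennreal ((cmod (f I z))\<^sup>2) * ennreal (V z) \<partial>disc_area))"
    by (rule sum_mono[OF single])
  also have "\<dots> = 27681 * (\<Sum>I\<in>?S. \<integral>\<^sup>+z. ennreal ((cmod (f I z))\<^sup>2) * ennreal (V z) \<partial>disc_area)"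
    by (simp only: sum_distrib_left)
  also have "\<dots> \<le> 27681 * ennreal B" by (intro mult_left_mono sq) auto
  also have "\<dots> = ennreal (27681 * B)"
    by (subst ennreal_mult') auto
  finally show "(\<Sum>I\<in>?S. enn2real (box_density p V I) * \<mu> I) \<le> 27681 * B"
    using B0 by (subst (asm) ennreal_le_iff) auto
qed auto

end

section \<open>Littlewood--Paley weights\<close>

lemma tilde_weight_measurable:
  assumes "weight W"
  shows "tilde_weight W \<in> borel_measurable disc_area" "z \<in> unit_disc \<Longrightarrow> 0 \<le> tilde_weight W z"
proof -
  have "(\<lambda>z::complex. (1 - cmod z)\<^sup>2) \<in> borel_measurable disc_area"
    by (rule borel_measurable_disc_area) measurable
  moreover have "W \<in> borel_measurable disc_area" using assms by (simp add: weight_def)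
  ultimately show "tilde_weight W \<in> borel_measurable disc_area"
    unfolding tilde_weight_def[abs_def] by (rule borel_measurable_times)
  show "z \<in> unit_disc \<Longrightarrow> 0 \<le> tilde_weight W z"
    using assms by (simp add: tilde_weight_def weight_def)
qed

lemma comparable_flip:
  assumes "0 < C" "ennreal (1 / C) * B \<le> A"
  shows "B \<le> ennreal C * A"
proof -
  have "B = ennreal C * (ennreal (1 / C) * B)"
    using assms(1) by (simp flip: mult.assoc ennreal_mult')
  also have "\<dots> \<le> ennreal C * A" by (intro mult_left_mono assms(2)) auto
  finally show ?thesis .
qed

text \<open>The estimate of first order with exponent two moves the problem from \<open>F\<close> to its derivative. Applied to the constant function
  \<open>1\<close> it bounds the total mass from above and below, so that \<open>|F 0|\<^sup>2\<close> is controlled by the total mass.\<close>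

lemma LP_estimate_first_order:
  assumes W: "W \<in> LP_class_with K"
  shows "weight W" "1 \<le> K 1 2" "1 \<le> ennreal (K 1 2) * total_mass W" "total_mass W \<le> ennreal (K 1 2)"
    and "\<And>F. F holomorphic_on unit_disc \<Longrightarrow> L2_norm_sq W F \<le>
      ennreal (K 1 2) * ((\<integral>\<^sup>+z. ennreal ((cmod (deriv F z))\<^sup>2 * tilde_weight W z) \<partial>disc_area) + ennreal ((cmod (F 0))\<^sup>2))"
    and "\<And>F. F holomorphic_on unit_disc \<Longrightarrow>
      (\<integral>\<^sup>+z. ennreal ((cmod (deriv F z))\<^sup>2 * tilde_weight W z) \<partial>disc_area) + ennreal ((cmod (F 0))\<^sup>2)
        \<le> ennreal (K 1 2) * L2_norm_sq W F"
proof -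
  show w: "weight W" and K: "1 \<le> K 1 2" using W by (auto simp: LP_class_with_def)
  have LP: "LP_estimate W 1 2 (K 1 2)" using W by (auto simp: LP_class_with_def)
  have est: "comparable (K 1 2) (L2_norm_sq W F)
      ((\<integral>\<^sup>+z. ennreal ((cmod (deriv F z))\<^sup>2 * tilde_weight W z) \<partial>disc_area) + ennreal ((cmod (F 0))\<^sup>2))"
    if F: "F holomorphic_on unit_disc" for F
  proof -
    have a: "(\<integral>\<^sup>+z. ennreal (cmod (F z) powr 2 * W z) \<partial>disc_area) = L2_norm_sq W F"
      by (simp add: L2_norm_sq_def)
    have b: "(\<integral>\<^sup>+z. ennreal (cmod ((deriv ^^ 1) F z) powr 2 * (1 - cmod z) powr (real 1 * 2) * W z) \<partial>disc_area)
        = (\<integral>\<^sup>+z. ennreal ((cmod (deriv F z))\<^sup>2 * tilde_weight W z) \<partial>disc_area)"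
      by (rule nn_integral_cong) (simp add: tilde_weight_def mult.assoc)
    have c: "(\<Sum>j<1::nat. cmod ((deriv ^^ j) F 0) powr 2) = (cmod (F 0))\<^sup>2"
      by simp
    show ?thesis using LP[unfolded LP_estimate_def, THEN spec, THEN mp, OF F] unfolding a b c .
  qed
  show "L2_norm_sq W F \<le>
      ennreal (K 1 2) * ((\<integral>\<^sup>+z. ennreal ((cmod (deriv F z))\<^sup>2 * tilde_weight W z) \<partial>disc_area) + ennreal ((cmod (F 0))\<^sup>2))"
    if "F holomorphic_on unit_disc" for F using est[OF that] by (simp add: comparable_def)
  show lower: "(\<integral>\<^sup>+z. ennreal ((cmod (deriv F z))\<^sup>2 * tilde_weight W z) \<partial>disc_area) + ennreal ((cmod (F 0))\<^sup>2)
        \<le> ennreal (K 1 2) * L2_norm_sq W F"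
    if "F holomorphic_on unit_disc" for F
    using est[OF that] K by (intro comparable_flip) (auto simp: comparable_def)
  have one: "L2_norm_sq W (\<lambda>_. 1) = total_mass W" by (simp add: L2_norm_sq_def total_mass_def)
  have hol: "(\<lambda>_. 1) holomorphic_on unit_disc" by (intro holomorphic_intros)
  show "1 \<le> ennreal (K 1 2) * total_mass W" using lower[OF hol] by (simp add: one)
  show "total_mass W \<le> ennreal (K 1 2)" using est[OF hol] by (simp add: one comparable_def)
qed

section \<open>Comparison of the embedding norm with the gauges\<close>

lemma Qp_norm_bounds:
  assumes "F \<in> Qp_space p"
  shows "0 \<le> Qp_norm p F" "(cmod (F 0))\<^sup>2 \<le> (Qp_norm p F)\<^sup>2" "Qp_seminorm_sq p F \<le> ennreal ((Qp_norm p F)\<^sup>2)"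
proof -
  show 0: "0 \<le> Qp_norm p F" by (simp add: Qp_norm_def)
  show "(cmod (F 0))\<^sup>2 \<le> (Qp_norm p F)\<^sup>2" by (rule power_mono) (simp_all add: Qp_norm_def)
  have "(sqrt (enn2real (Qp_seminorm_sq p F)))\<^sup>2 \<le> (Qp_norm p F)\<^sup>2" by (rule power_mono) (simp_all add: Qp_norm_def)
  then have "enn2real (Qp_seminorm_sq p F) \<le> (Qp_norm p F)\<^sup>2" by simp
  moreover have "Qp_seminorm_sq p F = ennreal (enn2real (Qp_seminorm_sq p F))"
    using assms by (simp add: Qp_space_def)
  ultimately show "Qp_seminorm_sq p F \<le> ennreal ((Qp_norm p F)\<^sup>2)" by (metis ennreal_leI)
qed

definition upper_const :: "real \<Rightarrow> real \<Rightarrow> real" where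
  "upper_const p k = k * (k + 512 * 4 powr p * 923521 * 294 powr p)"

definition lower_const :: "real \<Rightarrow> real \<Rightarrow> real" where
  "lower_const p k = 1 + 27681 * (k * test_function_const p)"

text \<open>The value at the origin is charged to the total mass and the derivative to the cost of the covering.\<close>

lemma L2_norm_le_covering_cost:
  assumes p: "0 < p" and W: "W \<in> LP_class_with K" and D: "dyadic_system D" and F: "F \<in> Qp_space p"
    and lam: "\<forall>J\<in>D. 0 \<le> lam J"
    and cover: "\<forall>I\<in>D. box_density p (tilde_weight W) I \<le> (\<Sum>\<^sub>\<infinity>J\<in>{J\<in>D. I \<subseteq> J}. ennreal (lam J))"
  shows "L2_norm_sq W F \<le> ennreal (upper_const p (K 1 2))
      * (total_mass W + (\<Sum>\<^sub>\<infinity>J\<in>D. ennreal (lam J * arc_len J powr p))) * ennreal ((Qp_norm p F)\<^sup>2)"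
proof -
  obtain L where L: "dyadic_tree L" "D = dyadic_tree.nodes L" using dyadic_systemE[OF D] .
  interpret dyadic_tree L by (rule L(1))
  note LP = LP_estimate_first_order[OF W]
  let ?k = "K 1 2" and ?E = "512 * 4 powr p * 923521 * 294 powr p" and ?n = "ennreal ((Qp_norm p F)\<^sup>2)"
  let ?c = "\<Sum>\<^sub>\<infinity>J\<in>D. ennreal (lam J * arc_len J powr p)"
  have hol: "F holomorphic_on unit_disc" using F by (simp add: Qp_space_def)
  have E0: "0 \<le> ?E" by simp
  have "(\<integral>\<^sup>+z. ennreal ((cmod (deriv F z))\<^sup>2 * tilde_weight W z) \<partial>disc_area) \<le> ennreal ?E * ?c * Qp_seminorm_sq p F"
    unfolding L(2)
    by (rule covering_bounds_area_integral[OF p hol tilde_weight_measurable[OF LP(1)]])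
       (use lam cover L(2) in auto)
  also have "\<dots> \<le> ennreal ?E * ?c * ?n" by (intro mult_left_mono Qp_norm_bounds(3)[OF F]) auto
  finally have 1: "(\<integral>\<^sup>+z. ennreal ((cmod (deriv F z))\<^sup>2 * tilde_weight W z) \<partial>disc_area) \<le> ennreal ?E * ?c * ?n" .
  have "ennreal ((cmod (F 0))\<^sup>2) \<le> 1 * ?n" using Qp_norm_bounds(2)[OF F] by (simp add: ennreal_leI)
  also have "\<dots> \<le> ennreal ?k * total_mass W * ?n" by (intro mult_right_mono LP(3)) auto
  finally have 2: "ennreal ((cmod (F 0))\<^sup>2) \<le> ennreal ?k * total_mass W * ?n" .
  have "L2_norm_sq W F \<le> ennreal ?k * (ennreal ?E * ?c * ?n + ennreal ?k * total_mass W * ?n)"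
    using LP(5)[OF hol] by (rule order_trans) (intro mult_left_mono add_mono 1 2, simp)
  also have "\<dots> \<le> ennreal ?k * (ennreal (?k + ?E) * ?c * ?n + ennreal (?k + ?E) * total_mass W * ?n)"
    using E0 LP(2) by (intro mult_left_mono add_mono mult_right_mono ennreal_leI) auto
  also have "\<dots> = ennreal ?k * ennreal (?k + ?E) * (total_mass W + ?c) * ?n"
    by (simp only: distrib_left distrib_right mult_ac add_ac)
  also have "ennreal ?k * ennreal (?k + ?E) = ennreal (upper_const p ?k)"
    unfolding upper_const_def using LP(2) by (intro ennreal_mult'[symmetric]) auto
  finally show ?thesis .
qed

text \<open>The constant function \<open>1\<close> detects the total mass, and the signed kernel sums detect the gauge.\<close>

lemma mass_and_gauge_le_embedding_bound:
  assumes p: "0 < p" "p \<le> 1" and W: "W \<in> LP_class_with K" and D: "dyadic_system D"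
    and M: "\<And>F. F \<in> Qp_space p \<Longrightarrow> L2_norm_sq W F \<le> ennreal (M * (Qp_norm p F)\<^sup>2)" "0 \<le> M"
  shows "total_mass W + dyadic_gauge p D (box_density p (tilde_weight W)) \<le> ennreal (lower_const p (K 1 2) * M)"
proof -
  obtain L where L: "dyadic_tree L" "D = dyadic_tree.nodes L" using dyadic_systemE[OF D] .
  interpret dyadic_tree L by (rule L(1))
  note LP = LP_estimate_first_order[OF W]
  let ?k = "K 1 2" and ?t = "test_function_const p"
  have t0: "0 \<le> ?t" by (rule test_function_const_nonneg[OF p])
  have mass: "total_mass W \<le> ennreal M"
  proof -
    have "Qp_seminorm_sq p (\<lambda>_. 1) = 0"
      by (simp add: Qp_seminorm_sq_def)
    then have "(\<lambda>_. 1) \<in> Qp_space p" "Qp_norm p (\<lambda>_. 1) = 1" by (auto simp: Qp_space_def Qp_norm_def)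
    then show ?thesis using M(1)[of "\<lambda>_. 1"] by (simp add: L2_norm_sq_def total_mass_def)
  qed
  have fin: "(\<integral>\<^sup>+z. ennreal (tilde_weight W z) \<partial>disc_area) < \<infinity>"
  proof -
    have "(\<integral>\<^sup>+z. ennreal (tilde_weight W z) \<partial>disc_area) \<le> total_mass W"
      unfolding total_mass_def
    proof (rule nn_integral_mono)
      fix z assume "z \<in> space disc_area"
      then have "0 \<le> W z" "(1 - cmod z)\<^sup>2 \<le> 1" using LP(1) by (auto simp: weight_def power_le_one)
      then show "ennreal (tilde_weight W z) \<le> ennreal (W z)"
        unfolding tilde_weight_def by (intro ennreal_leI mult_left_le_one_le) auto
    qed
    also have "\<dots> \<le> ennreal M" by (rule mass)
    also have "\<dots> < \<infinity>" by simp
    finally show ?thesis .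
  qed
  have "dyadic_gauge p nodes (box_density p (tilde_weight W)) \<le> ennreal (27681 * (?k * (M * ?t)))"
  proof (rule gauge_le_of_test_bound[OF p _ tilde_weight_measurable[OF LP(1)] fin])
    show "0 \<le> ?k * (M * ?t)" using LP(2) M(2) t0 by simp
    fix F assume hol: "F holomorphic_on unit_disc" and F0: "F 0 = 0" and semi: "Qp_seminorm_sq p F \<le> ennreal ?t"
    have "Qp_seminorm_sq p F < \<infinity>" using semi by (rule order_le_less_trans) simp
    then have F: "F \<in> Qp_space p" using hol by (simp add: Qp_space_def)
    have "enn2real (Qp_seminorm_sq p F) \<le> ?t" using semi t0 by (intro enn2real_leI)
    then have n: "(Qp_norm p F)\<^sup>2 \<le> ?t" by (simp add: Qp_norm_def F0)
    have "(\<integral>\<^sup>+z. ennreal ((cmod (deriv F z))\<^sup>2 * tilde_weight W z) \<partial>disc_area) \<le> ennreal ?k * L2_norm_sq W F"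
      using LP(6)[OF hol] by (simp add: F0)
    also have "\<dots> \<le> ennreal ?k * ennreal (M * (Qp_norm p F)\<^sup>2)" by (intro mult_left_mono M(1)[OF F]) auto
    also have "\<dots> \<le> ennreal ?k * ennreal (M * ?t)" using n M(2) by (intro mult_left_mono ennreal_leI) auto
    also have "\<dots> = ennreal (?k * (M * ?t))" using LP(2) by (intro ennreal_mult'[symmetric]) simp
    finally show "(\<integral>\<^sup>+z. ennreal ((cmod (deriv F z))\<^sup>2 * tilde_weight W z) \<partial>disc_area) \<le> ennreal (?k * (M * ?t))" .
  qed
  with mass have "total_mass W + dyadic_gauge p nodes (box_density p (tilde_weight W))
      \<le> ennreal M + ennreal (27681 * (?k * (M * ?t)))" by (rule add_mono)
  also have "\<dots> = ennreal (M + 27681 * (?k * (M * ?t)))"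
    using M(2) LP(2) t0 by (intro ennreal_plus[symmetric]) auto
  also have "M + 27681 * (?k * (M * ?t)) = lower_const p ?k * M" by (simp add: lower_const_def algebra_simps)
  finally show ?thesis by (simp add: L(2))
qed

text \<open>Addition and multiplication are not cancellative at infinity, so the inequality is solved for the real lower bound \<open>m\<close> of \<open>X\<close>
  before the infimum is taken.\<close>

lemma le_mult_add_Inf:
  fixes X :: "ennreal set"
  assumes C: "0 < C" and w: "w < \<infinity>" and le: "\<And>x. x \<in> X \<Longrightarrow> a \<le> ennreal C * (w + x)"
  shows "a \<le> ennreal C * (w + Inf X)"
proof (cases "a = \<infinity>")
  case True
  have "x = \<infinity>" if "x \<in> X" for x
    using le[OF that] True w by (auto simp: top_unique ennreal_mult_eq_top_iff)
  then have "top \<le> Inf X" by (intro Inf_greatest) auto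
  then have top: "Inf X = top" by (rule top_unique[THEN iffD1])
  show ?thesis unfolding top using C by (simp add: ennreal_mult_eq_top_iff)
next
  case False
  then obtain a' where a': "a = ennreal a'" "0 \<le> a'" by (cases a) auto
  obtain w' where w': "w = ennreal w'" "0 \<le> w'" using w by (cases w) auto
  define m where "m = max 0 (a' / C - w')"
  have "ennreal m \<le> x" if x: "x \<in> X" for x
  proof (cases x)
    case (real r)
    have "ennreal a' \<le> ennreal (C * (w' + r))"
      using le[OF x] C real w' by (simp add: a' ennreal_mult' flip: ennreal_plus)
    then have "a' \<le> C * (w' + r)" using C real w' by (subst (asm) ennreal_le_iff) auto
    then have "m \<le> r" using C real by (simp add: m_def field_simps)
    then show ?thesis using real by (simp add: ennreal_leI)
  qed simp
  then have m: "ennreal m \<le> Inf X" by (rule Inf_greatest)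
  have "a' \<le> C * (w' + m)" using C by (simp add: m_def field_simps max_def)
  then have "a \<le> ennreal (C * (w' + m))" unfolding a' by (rule ennreal_leI)
  also have "\<dots> = ennreal C * (w + ennreal m)"
    using C w' by (simp add: m_def ennreal_mult' flip: ennreal_plus)
  also have "\<dots> \<le> ennreal C * (w + Inf X)" by (intro mult_left_mono add_left_mono m) auto
  finally show ?thesis .
qed

text \<open>Equivalently, the square root of \<open>y / C\<close> is a lower bound of \<open>X\<close>; for empty \<open>X\<close> the infimum is infinite.\<close>

lemma le_mult_Inf_square:
  fixes X :: "real set"
  assumes C: "0 < C" and le: "\<And>M. M \<in> X \<Longrightarrow> y \<le> ennreal (C * M\<^sup>2)" and X: "\<And>M. M \<in> X \<Longrightarrow> 0 \<le> M"
  shows "y \<le> ennreal C * (Inf (ennreal ` X))\<^sup>2"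
proof (cases "X = {}")
  case True
  then show ?thesis using C by (simp add: ennreal_mult_eq_top_iff power2_eq_square)
next
  case False
  then obtain M0 where "M0 \<in> X" by auto
  have "y < \<infinity>" using le[OF \<open>M0 \<in> X\<close>] by (rule order_le_less_trans) simp
  then obtain y' where y': "y = ennreal y'" "0 \<le> y'" by (cases y) auto
  have "ennreal (sqrt (y' / C)) \<le> Inf (ennreal ` X)"
  proof (rule Inf_greatest)
    fix x assume "x \<in> ennreal ` X"
    then obtain M where M: "M \<in> X" "x = ennreal M" by auto
    have "y' \<le> C * M\<^sup>2" using le[OF M(1)] C unfolding y' by (subst (asm) ennreal_le_iff) auto
    then have "y' / C \<le> M\<^sup>2" using C by (simp add: field_simps)
    then have "sqrt (y' / C) \<le> M" by (intro real_le_lsqrt X[OF M(1)])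
    then show "ennreal (sqrt (y' / C)) \<le> x" unfolding M by (rule ennreal_leI)
  qed
  then have "(ennreal (sqrt (y' / C)))\<^sup>2 \<le> (Inf (ennreal ` X))\<^sup>2" by (rule power_mono_ennreal)
  then have "ennreal C * (ennreal (sqrt (y' / C)))\<^sup>2 \<le> ennreal C * (Inf (ennreal ` X))\<^sup>2" by (rule mult_left_mono) simp
  also have "ennreal C * (ennreal (sqrt (y' / C)))\<^sup>2 = y"
    using C y' by (simp add: ennreal_power flip: ennreal_mult')
  finally show ?thesis .
qed

lemma embedding_norm_sq_le:
  assumes p: "0 < p" and W: "W \<in> LP_class_with K" and D: "dyadic_system D"
  shows "(Qp_embedding_norm p W)\<^sup>2 \<le> ennreal (upper_const p (K 1 2))
    * (total_mass W + dyadic_gauge p D (box_density p (tilde_weight W)))"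
  unfolding dyadic_gauge_def
proof (rule le_mult_add_Inf)
  note LP = LP_estimate_first_order[OF W]
  let ?u = "upper_const p (K 1 2)"
  show u: "0 < ?u" unfolding upper_const_def using LP(2) by (intro mult_pos_pos add_pos_nonneg) auto
  show fin: "total_mass W < \<infinity>" using LP(4) by (rule order_le_less_trans) simp
  fix x
  assume "x \<in> {(\<Sum>\<^sub>\<infinity>J\<in>D. ennreal (lam J * arc_len J powr p)) | lam :: complex set \<Rightarrow> real.
            (\<forall>J\<in>D. 0 \<le> lam J) \<and> (\<forall>I\<in>D. box_density p (tilde_weight W) I \<le> (\<Sum>\<^sub>\<infinity>J\<in>{J\<in>D. I \<subseteq> J}. ennreal (lam J)))}"
  then obtain lam :: "complex set \<Rightarrow> real" where x: "x = (\<Sum>\<^sub>\<infinity>J\<in>D. ennreal (lam J * arc_len J powr p))"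
    and lam: "\<forall>J\<in>D. 0 \<le> lam J" "\<forall>I\<in>D. box_density p (tilde_weight W) I \<le> (\<Sum>\<^sub>\<infinity>J\<in>{J\<in>D. I \<subseteq> J}. ennreal (lam J))"
    by blast
  show "(Qp_embedding_norm p W)\<^sup>2 \<le> ennreal ?u * (total_mass W + x)"
  proof (cases x)
    case (real r)
    obtain w where w: "total_mass W = ennreal w" "0 \<le> w" using fin by (cases "total_mass W") auto
    define M where "M = sqrt (?u * (w + r))"
    have M2: "M\<^sup>2 = ?u * (w + r)" "0 \<le> M" using u w real by (auto simp: M_def)
    have M2e: "ennreal (M\<^sup>2) = ennreal ?u * (total_mass W + x)"
      unfolding M2 w real using u w real by (simp add: ennreal_mult' flip: ennreal_plus)
    have "L2_norm_sq W F \<le> ennreal ((M * Qp_norm p F)\<^sup>2)" if F: "F \<in> Qp_space p" for F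
    proof -
      have "L2_norm_sq W F \<le> ennreal ?u * (total_mass W + x) * ennreal ((Qp_norm p F)\<^sup>2)"
        unfolding x by (rule L2_norm_le_covering_cost[OF p W D F lam])
      also have "\<dots> = ennreal ((M * Qp_norm p F)\<^sup>2)"
        unfolding M2e[symmetric] power_mult_distrib by (rule ennreal_mult'[symmetric]) simp
      finally show ?thesis .
    qed
    then have "Qp_embedding_norm p W \<le> ennreal M"
      unfolding Qp_embedding_norm_def using M2(2) by (intro Inf_lower) blast
    then have "(Qp_embedding_norm p W)\<^sup>2 \<le> (ennreal M)\<^sup>2" by (rule power_mono_ennreal)
    also have "\<dots> = ennreal ?u * (total_mass W + x)" using M2 M2e by (simp add: ennreal_power)
    finally show ?thesis .
  next
    case top
    then show ?thesis using u by (simp add: ennreal_mult_eq_top_iff)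
  qed
qed

lemma mass_and_gauge_le_embedding_norm_sq:
  assumes p: "0 < p" "p \<le> 1" and W: "W \<in> LP_class_with K" and D: "dyadic_system D"
  shows "total_mass W + dyadic_gauge p D (box_density p (tilde_weight W))
    \<le> ennreal (lower_const p (K 1 2)) * (Qp_embedding_norm p W)\<^sup>2"
proof -
  define X where "X = {M. 0 \<le> M \<and> (\<forall>F\<in>Qp_space p. L2_norm_sq W F \<le> ennreal ((M * Qp_norm p F)\<^sup>2))}"
  have norm: "Qp_embedding_norm p W = Inf (ennreal ` X)"
    unfolding Qp_embedding_norm_def X_def by (rule arg_cong[of _ _ Inf]) blast
  note LP = LP_estimate_first_order[OF W]
  show ?thesis unfolding norm
  proof (rule le_mult_Inf_square)
    show "0 < lower_const p (K 1 2)"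
      unfolding lower_const_def using LP(2) test_function_const_nonneg[OF p] by (intro add_pos_nonneg) auto
    fix M assume M: "M \<in> X"
    show "0 \<le> M" using M by (simp add: X_def)
    show "total_mass W + dyadic_gauge p D (box_density p (tilde_weight W)) \<le> ennreal (lower_const p (K 1 2) * M\<^sup>2)"
      by (rule mass_and_gauge_le_embedding_bound[OF p W D]) (use M in \<open>auto simp: X_def power_mult_distrib\<close>)
  qed
qed

lemma embedding_bounded_iff_gauge_finite:
  assumes p: "0 < p" "p \<le> 1" and W: "W \<in> LP_class"
  shows "Qp_embedding_bounded p W \<longleftrightarrow>
    (\<exists>D. dyadic_system D \<and> dyadic_gauge p D (box_density p (tilde_weight W)) < \<infinity>)"
proof -
  obtain K where K: "W \<in> LP_class_with K" using W unfolding LP_class_eq_Union by blast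
  note LP = LP_estimate_first_order[OF K]
  let ?u = "upper_const p (K 1 2)"
  show ?thesis
  proof
    assume "Qp_embedding_bounded p W"
    then obtain C where C: "0 < C" "\<And>F. F \<in> Qp_space p \<Longrightarrow> L2_norm_sq W F \<le> ennreal (C * (Qp_norm p F)\<^sup>2)"
      unfolding Qp_embedding_bounded_def by blast
    obtain D where D: "dyadic_system D" using dyadic_system_exists by blast
    have "dyadic_gauge p D (box_density p (tilde_weight W))
        \<le> total_mass W + dyadic_gauge p D (box_density p (tilde_weight W))" by simp
    also have "\<dots> \<le> ennreal (lower_const p (K 1 2) * C)"
      by (rule mass_and_gauge_le_embedding_bound[OF p K D C(2)]) (use C in auto)
    also have "\<dots> < \<infinity>" by simp
    finally show "\<exists>D. dyadic_system D \<and> dyadic_gauge p D (box_density p (tilde_weight W)) < \<infinity>" using D by blast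
  next
    assume "\<exists>D. dyadic_system D \<and> dyadic_gauge p D (box_density p (tilde_weight W)) < \<infinity>"
    then obtain D lam where D: "dyadic_system D"
      and lam: "\<forall>J\<in>D. 0 \<le> lam J" "\<forall>I\<in>D. box_density p (tilde_weight W) I \<le> (\<Sum>\<^sub>\<infinity>J\<in>{J\<in>D. I \<subseteq> J}. ennreal (lam J))"
      and fin: "(\<Sum>\<^sub>\<infinity>J\<in>D. ennreal (lam J * arc_len J powr p)) < \<infinity>"
      unfolding dyadic_gauge_def Inf_less_iff by blast
    let ?x = "ennreal ?u * (total_mass W + (\<Sum>\<^sub>\<infinity>J\<in>D. ennreal (lam J * arc_len J powr p)))"
    have "total_mass W < \<infinity>" using LP(4) by (rule order_le_less_trans) simp
    then have "?x < \<infinity>" using fin by (simp add: ennreal_mult_less_top)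
    then obtain c where c: "?x = ennreal c" "0 \<le> c" by (cases ?x) auto
    have "L2_norm_sq W F \<le> ennreal ((c + 1) * (Qp_norm p F)\<^sup>2)" if F: "F \<in> Qp_space p" for F
    proof -
      have "L2_norm_sq W F \<le> ?x * ennreal ((Qp_norm p F)\<^sup>2)"
        by (rule L2_norm_le_covering_cost[OF p(1) K D F lam])
      also have "\<dots> = ennreal (c * (Qp_norm p F)\<^sup>2)"
        unfolding c(1) by (rule ennreal_mult'[symmetric, OF c(2)])
      also have "\<dots> \<le> ennreal ((c + 1) * (Qp_norm p F)\<^sup>2)" by (intro ennreal_leI mult_right_mono) auto
      finally show ?thesis .
    qed
    then show "Qp_embedding_bounded p W"
      unfolding Qp_embedding_bounded_def using c(2) by (intro exI[of _ "c + 1"]) auto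
  qed
qed

lemma comparableI:
  assumes "0 < C" "A \<le> ennreal C * B" "B \<le> ennreal C * A"
  shows "comparable C A B"
proof -
  have "ennreal (1 / C) * B \<le> ennreal (1 / C) * (ennreal C * A)" by (intro mult_left_mono assms(3)) auto
  also have "\<dots> = A" using assms(1) by (simp flip: mult.assoc ennreal_mult')
  finally show ?thesis using assms(2) by (simp add: comparable_def)
qed

theorem theorem6p3:
  fixes p :: real
  assumes "0 < p" and "p \<le> 1"
  shows "(\<forall>W\<in>LP_class.
            Qp_embedding_bounded p W \<longleftrightarrow>
            (\<exists>D. dyadic_system D \<and> dyadic_gauge p D (box_density p (tilde_weight W)) < \<infinity>))
       \<and> (\<forall>K. \<exists>C\<ge>1. \<forall>W\<in>LP_class_with K.
            comparable C
              ((Qp_embedding_norm p W)\<^sup>2)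
              (total_mass W
                + (INF D\<in>Collect dyadic_system. dyadic_gauge p D (box_density p (tilde_weight W))))
          \<and> comparable C
              (total_mass W
                + (INF D\<in>Collect dyadic_system. dyadic_gauge p D (box_density p (tilde_weight W))))
              (total_mass W
                + (SUP D\<in>Collect dyadic_system. dyadic_gauge p D (box_density p (tilde_weight W)))))"
proof (intro conjI ballI allI)
  show "Qp_embedding_bounded p W \<longleftrightarrow>
      (\<exists>D. dyadic_system D \<and> dyadic_gauge p D (box_density p (tilde_weight W)) < \<infinity>)"
    if "W \<in> LP_class" for W by (rule embedding_bounded_iff_gauge_finite[OF assms that])
  fix K :: "nat \<Rightarrow> real \<Rightarrow> real"
  \<comment> \<open>The class with constants \<open>K\<close> may be empty, and then \<open>K 1 2\<close> need not be positive.\<close>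
  define k where "k = max 1 (K 1 2)"
  define u where "u = upper_const p k"
  define l where "l = lower_const p k"
  define C where "C = 1 + l + u + l * u"
  have k1: "1 \<le> k" by (simp add: k_def)
  have u0: "0 < u" unfolding u_def upper_const_def using k1 by (intro mult_pos_pos add_pos_nonneg) auto
  have l0: "0 < l" unfolding l_def lower_const_def
    using k1 test_function_const_nonneg[OF assms] by (intro add_pos_nonneg) auto
  have lu0: "0 \<le> l * u" using l0 u0 by simp
  have C: "1 \<le> C" "l \<le> C" "u \<le> C" "1 + l * u \<le> C" using l0 u0 lu0 unfolding C_def by linarith+
  have scale: "x \<le> ennreal C * y" if "x \<le> ennreal c * y" "c \<le> C" for x y c
    using that(1) by (rule order_trans) (intro mult_right_mono ennreal_leI that(2), simp)
  show "\<exists>C\<ge>1. \<forall>W\<in>LP_class_with K.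
            comparable C
              ((Qp_embedding_norm p W)\<^sup>2)
              (total_mass W
                + (INF D\<in>Collect dyadic_system. dyadic_gauge p D (box_density p (tilde_weight W))))
          \<and> comparable C
              (total_mass W
                + (INF D\<in>Collect dyadic_system. dyadic_gauge p D (box_density p (tilde_weight W))))
              (total_mass W
                + (SUP D\<in>Collect dyadic_system. dyadic_gauge p D (box_density p (tilde_weight W))))"
  proof (intro exI[of _ C] conjI ballI C(1))
    fix W assume W: "W \<in> LP_class_with K"
    note LP = LP_estimate_first_order[OF W]
    have kK: "k = K 1 2" using LP(2) by (simp add: k_def)
    define G where "G D = dyadic_gauge p D (box_density p (tilde_weight W))" for D
    define w where "w = total_mass W"
    define n where "n = (Qp_embedding_norm p W)\<^sup>2"
    define lo where "lo = (INF D\<in>Collect dyadic_system. G D)"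
    define hi where "hi = (SUP D\<in>Collect dyadic_system. G D)"
    have wfin: "w < \<infinity>" unfolding w_def using LP(4) by (rule order_le_less_trans) simp
    obtain D0 where D0: "dyadic_system D0" using dyadic_system_exists by blast
    have lower: "w + G D \<le> ennreal l * n" if "dyadic_system D" for D
      unfolding w_def G_def l_def n_def kK by (rule mass_and_gauge_le_embedding_norm_sq[OF assms W that])
    have upper: "n \<le> ennreal u * (w + lo)"
      unfolding lo_def
    proof (rule le_mult_add_Inf[OF u0 wfin])
      fix x assume "x \<in> G ` Collect dyadic_system"
      then show "n \<le> ennreal u * (w + x)"
        unfolding w_def G_def u_def n_def kK using embedding_norm_sq_le[OF assms(1) W] by auto
    qed
    have lo_le: "lo \<le> G D0" unfolding lo_def by (rule INF_lower) (simp add: D0)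
    have hi_ge: "G D0 \<le> hi" unfolding hi_def by (rule SUP_upper) (simp add: D0)
    have wlo: "w + lo \<le> ennreal l * n"
      using add_left_mono[OF lo_le] lower[OF D0] by (rule order_trans)
    have "comparable C n (w + lo)"
      by (rule comparableI) (use C upper wlo scale in auto)
    then show "comparable C ((Qp_embedding_norm p W)\<^sup>2)
        (total_mass W + (INF D\<in>Collect dyadic_system. dyadic_gauge p D (box_density p (tilde_weight W))))"
      by (simp add: n_def w_def lo_def G_def)
    have hi_le: "hi \<le> ennreal (l * u) * (w + lo)"
      unfolding hi_def
    proof (rule SUP_least)
      fix D assume "D \<in> Collect dyadic_system"
      then have "G D \<le> ennreal l * n" using lower[of D] by (auto intro: order_trans[rotated])
      also have "\<dots> \<le> ennreal l * (ennreal u * (w + lo))" by (intro mult_left_mono upper) auto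
      also have "\<dots> = ennreal (l * u) * (w + lo)" using l0 by (simp add: ennreal_mult' mult.assoc)
      finally show "G D \<le> ennreal (l * u) * (w + lo)" .
    qed
    have "w + hi \<le> (w + lo) + ennreal (l * u) * (w + lo)" by (intro add_mono hi_le) simp
    also have "\<dots> = (1 + ennreal (l * u)) * (w + lo)" by (simp only: distrib_right mult_1_left)
    also have "1 + ennreal (l * u) = ennreal (1 + l * u)" using lu0 by (subst ennreal_plus) auto
    finally have 1: "w + hi \<le> ennreal (1 + l * u) * (w + lo)" .
    have "w + lo \<le> ennreal 1 * (w + hi)" using lo_le hi_ge by (simp add: add_left_mono order_trans)
    then have "comparable C (w + lo) (w + hi)"
      by (intro comparableI scale[OF _ C(1)] scale[OF 1 C(4)]) (use C in auto)
    then show "comparable C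
        (total_mass W + (INF D\<in>Collect dyadic_system. dyadic_gauge p D (box_density p (tilde_weight W))))
        (total_mass W + (SUP D\<in>Collect dyadic_system. dyadic_gauge p D (box_density p (tilde_weight W))))"
      by (simp add: w_def lo_def hi_def G_def)
  qed
qed

end
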